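(* Fix an integer $m\ge 2$ and $\eta\in(0,1)$, and let $\rho=\rho_n\in[0,1)$ be a sequence of correlations satisfying $$\rho^2\;\le\;\frac{8(1-\eta)}{m}\cdot\frac{\log n}{n}.$$ Then $\operatorname{TV}(\mathsf P,\mathsf Q)\to0$ as $n\to\infty$. In particular, weak detection is impossible in this regime.
   Context: Let $[n]=\{1,\dots,n\}$, let $\mathcal E_n=\binom{[n]}{2}$ be the set of unordered pairs of distinct elements of $[n]$, and $N=|\mathcal E_n|=\binom n2$. The integer $m\ge2$ is independent of $n$. The data are $X=(X^k_e)_{1\le k\le m,\,e\in\mathcal E_n}\in\mathbb R^{mN}$. Let $\mathfrak S_n$ be the set of permutations of $[n]$; a permutation $\tau\in\mathfrak S_n$ acts on edges by $\tau(\{i,j\})=\{\tau(i),\tau(j)\}$. Null law $\mathsf Q$: all $mN$ coordinates of $X$ are independent standard Gaussians. Planted law $\mathsf P$: there is a latent tuple $\pi^*=(\pi_1^*,\dots,\pi_m^* )$ with $\pi^*_1=\mathrm{Id}$ and $\pi_2^*,\dots,\pi_m^*$ i.i.d. uniform on $\mathfrak S_n$; conditionally on $\pi^*$, the vectors $(X^1_{\pi_1^*(e)},\dots,X^m_{\pi_m^*(e)})$, $e\in\mathcal E_n$, are independent centered Gaussian vectors with common covariance matrix $(1-\rho)I_m+\rho\mathbf 1\mathbf 1^\top$. $\operatorname{TV}(\mathsf P,\mathsf Q)$ denotes the total variation distance between the marginal law of $X$ under $\mathsf P$ and the law $\mathsf Q$ of $X$. A test is a measurable function $\psi:\mathbb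 R^{mN}\to\{0,1\}$; it achieves weak detection if $\mathsf P(\psi(X)=0)+\mathsf Q(\psi(X)=1)=1-\Omega(1)$ as $n\to\infty$. *)

theory Defs
  imports
    "HOL-Probability.Probability"
    "HOL-Library.Ramsey"
    "Jordan_Normal_Form.Determinant"
    "Jordan_Normal_Form.Gauss_Jordan_Elimination"
begin

abbreviation edges :: "nat \<Rightarrow> nat set set" where
  "edges n \<equiv> nsets {1..n} 2"

text \<open>The m copies are numbered 0, ..., m - 1, matching matrix indices; copy 0 is the reference
  copy, whose latent permutation is the identity.  A data point is a function
  \<open>X\<close> with \<open>X (k, e)\<close> the weight of edge \<open>e\<close> in copy \<open>k\<close>.\<close>

definition data_space :: "nat \<Rightarrow> nat \<Rightarrow> (nat \<times> nat set \<Rightarrow> real) measure" where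
  "data_space m n = PiM ({..<m} \<times> edges n) (\<lambda>_. borel)"

definition null_law :: "nat \<Rightarrow> nat \<Rightarrow> (nat \<times> nat set \<Rightarrow> real) measure" where
  "null_law m n = PiM ({..<m} \<times> edges n) (\<lambda>_. std_normal_distribution)"

text \<open>The centered Gaussian law on \<open>\<real>\<^sup>d\<close> with positive definite covariance matrix \<open>\<Sigma>\<close>, given by its
  Lebesgue density; it is meaningful for positive definite \<open>\<Sigma>\<close> only.\<close>

definition centered_gaussian :: "nat \<Rightarrow> real mat \<Rightarrow> (nat \<Rightarrow> real) measure" where
  "centered_gaussian d \<Sigma> = density (PiM {..<d} (\<lambda>_. lborel))
     (\<lambda>x. let v = Matrix.vec d x in
        ennreal (exp (- scalar_prod v (the (mat_inverse \<Sigma>) *\<^sub>v v) / 2)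
                 / sqrt ((2 * pi) ^ d * Determinant.det \<Sigma>)))"

definition equicorrelation :: "nat \<Rightarrow> real \<Rightarrow> real mat" where
  "equicorrelation m \<rho> = (1 - \<rho>) \<cdot>\<^sub>m 1\<^sub>m m + \<rho> \<cdot>\<^sub>m Matrix.mat m m (\<lambda>_. 1)"

definition latent_pmf :: "nat \<Rightarrow> nat \<Rightarrow> (nat \<Rightarrow> nat \<Rightarrow> nat) pmf" where
  "latent_pmf m n = Pi_pmf {..<m} id
     (\<lambda>k. if k = 0 then return_pmf id else pmf_of_set {\<tau>. \<tau> permutes {1..n}})"

text \<open>Given \<open>\<pi>\<close>, the vectors \<open>Y e = (X (k, \<pi> k ` e))\<^sub>k\<close>, for \<open>e\<close> in \<open>edges n\<close>, are i.i.d. Gaussian; hence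
  \<open>X (k, e)\<close> is coordinate \<open>k\<close> of \<open>Y\<close> at the preimage of \<open>e\<close> under \<open>\<pi> k\<close>.\<close>

definition planted_law_given ::
    "nat \<Rightarrow> nat \<Rightarrow> real \<Rightarrow> (nat \<Rightarrow> nat \<Rightarrow> nat) \<Rightarrow> (nat \<times> nat set \<Rightarrow> real) measure" where
  "planted_law_given m n \<rho> \<pi> =
     distr (PiM (edges n) (\<lambda>_. centered_gaussian m (equicorrelation m \<rho>))) (data_space m n)
       (\<lambda>Y. \<lambda>(k, e)\<in>{..<m} \<times> edges n. Y (inv_into UNIV (\<pi> k) ` e) k)"

definition planted_law :: "nat \<Rightarrow> nat \<Rightarrow> real \<Rightarrow> (nat \<times> nat set \<Rightarrow> real) measure" where
  "planted_law m n \<rho> = measure_pmf (latent_pmf m n) \<bind> planted_law_given m n \<rho>"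

definition total_variation :: "'a measure \<Rightarrow> 'a measure \<Rightarrow> real" where
  "total_variation M N = (SUP A\<in>sets M. \<bar>measure M A - measure N A\<bar>)"

text \<open>The error sum being \<open>1 - \<Omega>(1)\<close> means that it is at most \<open>1 - c\<close> for some constant \<open>c > 0\<close>
  and all large \<open>n\<close>.\<close>

definition achieves_weak_detection ::
    "nat \<Rightarrow> (nat \<Rightarrow> real) \<Rightarrow> (nat \<Rightarrow> (nat \<times> nat set \<Rightarrow> real) \<Rightarrow> nat) \<Rightarrow> bool" where
  "achieves_weak_detection m \<rho> \<psi> \<longleftrightarrow>
     (\<exists>c>0. \<forall>\<^sub>F n in sequentially.
        measure (planted_law m n (\<rho> n)) {X \<in> space (data_space m n). \<psi> n X = 0}
        + measure (null_law m n) {X \<in> space (data_space m n). \<psi> n X = 1} \<le> 1 - c)"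

end

theory Submission
  imports Defs "HOL-Real_Asymp.Real_Asymp"
begin

text \<open>The proof is a truncated second moment argument.  Writing \<open>r = \<rho>\<^sup>2\<close>, the likelihood ratio of the
  planted law is the average over the latent tuples of a product over the edges of densities of
  equicorrelated Gaussian vectors.  Such a vector is a common Gaussian plus noise, so its density is a
  Mehler mixture, and the semigroup property turns the product of two likelihoods with relative latent
  tuple \<open>\<phi>\<close> into the same density with \<open>r\<close> in place of \<open>\<rho>\<close>.  Bounding Gaussian exponential moments
  of quadratic forms gives \<open>exp (r * common + r\<^sup>2 * cross + ...)\<close>: the terms quadratic in the
  diagonal cancel against the normalization, and \<open>common\<close> counts the edges on which two of the
  permutations of \<open>\<phi>\<close> agree.

  If every pair of permutations agrees on few vertices, factorial moments of uniform permutations make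
  the contribution \<open>1 + o(1)\<close>.  If some pair agrees on of order \<open>n\<close> vertices, the second moment is too large by
  itself, and the data are restricted to a region on which, for all families of vertex sets, the
  empirical overlap between the copies does not exceed its planted mean by much.  An exponential
  tilt along the overlap then halves the exponent.  A vertex at which \<open>D\<close> of the permutations repeat
  earlier values costs a factor \<open>n ^ (- D)\<close> and contributes at most \<open>m * D\<close> to the agreement
  counts, which is where the constant \<open>8 / m\<close> comes from.\<close>

subsection \<open>Gaussian exponential moments of quadratic forms\<close>

text \<open>An untruncated second moment would stop at \<open>4 / m\<close>. The tuple whose
  permutations all coincide has probability about \<open>exp (- (m - 1) n ln n)\<close>, while its
  exponent is about \<open>\<rho>^2 m (m - 1) n^2 / 4\<close>; at
  \<open>\<rho>^2 = (8 / m) ln n / n\<close> this is twice what that probability pays for, and the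
  truncation removes exactly this factor 2. The region must be one set for all relative tuples,
  hence the quantification over families of vertex sets. There are only exp(O(n)) of them, which is
  negligible against deviations on the scale n ln n. Two Gaussian bounds are needed because their
  errors differ. Passing from \<rho> to \<rho>^2 leaves an error of order n^2 \<rho>^6, which
  vanishes, so that 1 + o(1) can be reached. The tilt depends on the data themselves and has to be
  integrated over all copies with parameter \<rho>; its error n^2 \<rho>^3 may grow like n^(1/2) (ln
  n)^(3/2). That is harmless only where a gain of order n ln n is available, that is, when some pair
  agrees on of order n vertices.\<close>

lemma ln_one_plus_ge_quadratic:
  fixes y :: real
  assumes "0 \<le> y"
  shows "y - y\<^sup>2 / 2 \<le> ln (1 + y)"
proof -
  have "(\<lambda>y. ln (1 + y) - y + y\<^sup>2 / 2) 0 \<le> (\<lambda>y. ln (1 + y) - y + y\<^sup>2 / 2) y"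
  proof (rule DERIV_nonneg_imp_nondecreasing[OF assms])
    fix x :: real assume x: "0 \<le> x" "x \<le> y"
    have "((\<lambda>y. ln (1 + y) - y + y\<^sup>2 / 2) has_real_derivative (1 / (1 + x) - 1 + x)) (at x)"
      using x by (auto intro!: derivative_eq_intros)
    moreover have "1 / (1 + x) - 1 + x = x\<^sup>2 / (1 + x)"
      using x by (simp add: field_simps power2_eq_square)
    ultimately show "\<exists>z. ((\<lambda>y. ln (1 + y) - y + y\<^sup>2 / 2) has_real_derivative z) (at x) \<and> 0 \<le> z"
      using x by force
  qed
  then show ?thesis by simp
qed

lemma ln_one_minus_ge_cubic:
  fixes x :: real
  assumes "0 \<le> x" "x \<le> 1 / 2"
  shows "- x - x\<^sup>2 / 2 - x ^ 3 \<le> ln (1 - x)"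
proof -
  have "(\<lambda>y. ln (1 - y) + y + y\<^sup>2 / 2 + y ^ 3) 0 \<le> (\<lambda>y. ln (1 - y) + y + y\<^sup>2 / 2 + y ^ 3) x"
  proof (rule DERIV_nonneg_imp_nondecreasing[OF assms(1)])
    fix y :: real assume y: "0 \<le> y" "y \<le> x"
    have "((\<lambda>y. ln (1 - y) + y + y\<^sup>2 / 2 + y ^ 3) has_real_derivative
        (- (1 / (1 - y)) + 1 + y + 3 * y\<^sup>2)) (at y)"
      using y assms by (auto intro!: derivative_eq_intros)
    moreover have "- (1 / (1 - y)) + 1 + y + 3 * y\<^sup>2 = y\<^sup>2 * (2 - 3 * y) / (1 - y)"
      using y assms by (simp add: divide_simps) (simp add: algebra_simps power2_eq_square power3_eq_cube)
    ultimately show "\<exists>z. ((\<lambda>y. ln (1 - y) + y + y\<^sup>2 / 2 + y ^ 3) has_real_derivative z) (at y) \<and> 0 \<le> z"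
      using y assms by force
  qed
  then show ?thesis by simp
qed

lemma minus_ln_one_minus_le:
  fixes x :: real
  assumes "\<bar>x\<bar> \<le> 1 / 2"
  shows "- ln (1 - x) \<le> x + x\<^sup>2 / 2 + \<bar>x\<bar> ^ 3"
proof (cases "0 \<le> x")
  case True
  then show ?thesis using ln_one_minus_ge_cubic[of x] assms by simp
next
  case False
  then have "- ln (1 - x) \<le> x + x\<^sup>2 / 2"
    using ln_one_plus_ge_quadratic[of "- x"] by simp
  moreover have "0 \<le> \<bar>x\<bar> ^ 3" by simp
  ultimately show ?thesis by linarith
qed

text \<open>Completing the square: with \<open>d = 1 - \<alpha>\<close> the integrand is a constant
  times the density of the normal law with mean \<open>\<beta> / d\<close> and variance
  \<open>1 / d\<close>.\<close>

lemma std_normal_quadratic_integral: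
  fixes \<alpha> \<beta> :: real
  assumes "\<alpha> < 1"
  shows "(\<integral>\<^sup>+ x. ennreal (exp (\<alpha> * x\<^sup>2 / 2 + \<beta> * x)) \<partial>std_normal_distribution)
    = ennreal (exp (\<beta>\<^sup>2 / (2 * (1 - \<alpha>))) / sqrt (1 - \<alpha>))"
proof -
  define d where "d = 1 - \<alpha>"
  have d: "d > 0" and \<alpha>: "\<alpha> = 1 - d" using assms by (auto simp: d_def)
  define s where "s = 1 / sqrt d"
  define \<mu> where "\<mu> = \<beta> / d"
  have s: "s > 0" "s\<^sup>2 = 1 / d"
    using d by (auto simp: s_def power_divide)
  have eq: "std_normal_density x * exp (\<alpha> * x\<^sup>2 / 2 + \<beta> * x)
      = (exp (\<beta>\<^sup>2 / (2 * d)) / sqrt d) * normal_density \<mu> s x" for x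
  proof -
    have a: "- (x\<^sup>2 / 2) + (\<alpha> * x\<^sup>2 / 2 + \<beta> * x) = \<beta>\<^sup>2 / (2 * d) - (x - \<mu>)\<^sup>2 / (2 * s\<^sup>2)"
      using d unfolding s(2) \<mu>_def \<alpha> by (simp add: field_simps power2_eq_square)
    have b: "sqrt (2 * pi * s\<^sup>2) = sqrt (2 * pi) / sqrt d"
      unfolding s(2) by (simp add: real_sqrt_divide)
    have "std_normal_density x * exp (\<alpha> * x\<^sup>2 / 2 + \<beta> * x)
        = 1 / sqrt (2 * pi) * exp (- (x\<^sup>2 / 2) + (\<alpha> * x\<^sup>2 / 2 + \<beta> * x))"
      unfolding std_normal_density_def exp_add by simp
    also have "\<dots> = 1 / sqrt (2 * pi) * (exp (\<beta>\<^sup>2 / (2 * d)) * exp (- (x - \<mu>)\<^sup>2 / (2 * s\<^sup>2)))"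
      unfolding a by (simp add: exp_diff exp_minus field_simps)
    also have "\<dots> = (exp (\<beta>\<^sup>2 / (2 * d)) / sqrt d) * normal_density \<mu> s x"
      unfolding normal_density_def b using d by simp
    finally show ?thesis .
  qed
  have "(\<integral>\<^sup>+ x. ennreal (exp (\<alpha> * x\<^sup>2 / 2 + \<beta> * x)) \<partial>std_normal_distribution)
      = (\<integral>\<^sup>+ x. ennreal (exp (\<beta>\<^sup>2 / (2 * d)) / sqrt d) * ennreal (normal_density \<mu> s x) \<partial>lborel)"
    using d by (subst nn_integral_density) (auto simp: ennreal_mult[symmetric] eq)
  also have "\<dots> = ennreal (exp (\<beta>\<^sup>2 / (2 * d)) / sqrt d) * (\<integral>\<^sup>+ x. ennreal (normal_density \<mu> s x) \<partial>lborel)"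
    by (rule nn_integral_cmult) auto
  also have "(\<integral>\<^sup>+ x. ennreal (normal_density \<mu> s x) \<partial>lborel) = 1"
    using prob_space.emeasure_space_1[OF prob_space_normal_density[OF s(1), of \<mu>]]
    by (simp add: emeasure_density)
  finally show ?thesis by (simp add: d_def)
qed

abbreviation gaussian_on :: "'i set \<Rightarrow> ('i \<Rightarrow> real) measure" where
  "gaussian_on I \<equiv> PiM I (\<lambda>_. std_normal_distribution)"

lemma prob_space_std_normal: "prob_space std_normal_distribution"
  by (rule prob_space_normal_density) simp

interpretation std_normal: product_sigma_finite "\<lambda>_ :: 'i. std_normal_distribution"
  by unfold_locales (intro sigma_finite_measure.sigma_finite_countable
      prob_space_imp_sigma_finite prob_space_std_normal)

text \<open>Accounting for one elimination in \<open>gaussian_quadratic_mgf_le\<close>. Integrating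
  out a coordinate with diagonal entry \<open>x\<close> costs \<open>- ln (1 - x) / 2\<close>; it
  raises the trace of the remaining matrix by \<open>S2 / (1 - x)\<close> and its sum of squares by
  the bracket over 4. The coordinate's own share of trace and squares is \<open>x\<close> and
  \<open>x^2 + 2 * S2\<close>. The two sides agree to second order, and the rest is absorbed by
  \<open>q ^ 3\<close>.\<close>

lemma gaussian_quadratic_step:
  fixes x q u S2 S3 :: real
  assumes "\<bar>x\<bar> + u \<le> q" "q \<le> 1 / 2" "0 \<le> u" "0 \<le> S2" "S2 \<le> u\<^sup>2" "\<bar>S3\<bar> \<le> q ^ 3"
  shows "- ln (1 - x) / 2 + (S2 / (1 - x)) / 2 + (2 * S3 / (1 - x) + S2\<^sup>2 / (1 - x)\<^sup>2) / 4
    \<le> x / 2 + (x\<^sup>2 + 2 * S2) / 4 + 3 * q ^ 3"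
proof -
  define c where "c = 1 / (1 - x)"
  have q: "0 \<le> q" "\<bar>x\<bar> \<le> q" "u \<le> q" using assms by auto
  have c: "0 < c" "c \<le> 2" "c = 1 + c * x"
    using assms q by (auto simp: c_def field_simps)
  \<comment> \<open>Stated for plain variables, so that the nonlinear terms become atoms of a linear
    problem. The same device returns in the moment bounds below.\<close>
  have combine: "L / 2 + A / 2 + (2 * B + C) / 4 \<le> x / 2 + (y + 2 * S) / 4 + 3 * p"
    if "L \<le> x + y / 2 + z" "z \<le> p" "D \<le> 2 * p" "B \<le> 2 * p" "C \<le> 2 * p" "A = S + D"
    for L A B C D S y z p :: real
    using that by (simp add: field_simps)
  have "- ln (1 - x) \<le> x + x\<^sup>2 / 2 + \<bar>x\<bar> ^ 3"
    using assms q by (intro minus_ln_one_minus_le) auto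
  moreover have "\<bar>x\<bar> ^ 3 \<le> q ^ 3" by (intro power_mono q) auto
  moreover have "S2 * (c * x) \<le> 2 * q ^ 3"
  proof -
    have "c * x \<le> c * \<bar>x\<bar>" using c by (intro mult_left_mono) auto
    also have "\<dots> \<le> 2 * q" using c q by (intro mult_mono) auto
    finally have "S2 * (c * x) \<le> S2 * (2 * q)" using assms by (intro mult_left_mono) auto
    also have "\<dots> \<le> q\<^sup>2 * (2 * q)"
      using assms q by (intro mult_right_mono order_trans[OF assms(5)] power_mono) auto
    finally have "S2 * (c * x) \<le> q\<^sup>2 * (2 * q)" .
    then show ?thesis by (simp add: power2_eq_square power3_eq_cube)
  qed
  moreover have "S3 * c \<le> 2 * q ^ 3"
  proof -
    have "S3 * c \<le> \<bar>S3\<bar> * c" using c by (intro mult_right_mono) auto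
    also have "\<dots> \<le> q ^ 3 * 2" using c q assms by (intro mult_mono) auto
    finally show ?thesis by simp
  qed
  moreover have "S2\<^sup>2 * c\<^sup>2 \<le> 2 * q ^ 3"
  proof -
    have "S2\<^sup>2 * c\<^sup>2 \<le> (q\<^sup>2)\<^sup>2 * 2\<^sup>2"
      using assms q c by (intro mult_mono power_mono order_trans[OF assms(5)]) auto
    also have "\<dots> = q ^ 3 * (4 * q)" by (simp add: power2_eq_square power3_eq_cube)
    also have "\<dots> \<le> q ^ 3 * 2" using assms q by (intro mult_left_mono) auto
    finally show ?thesis by simp
  qed
  moreover have "S2 * c = S2 + S2 * (c * x)" 
    by (subst c(3)) (simp add: algebra_simps)
  ultimately have "- ln (1 - x) / 2 + (S2 * c) / 2 + (2 * (S3 * c) + S2\<^sup>2 * c\<^sup>2) / 4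
    \<le> x / 2 + (x\<^sup>2 + 2 * S2) / 4 + 3 * q ^ 3"
    by (rule combine)
  then show ?thesis by (simp add: c_def power_divide)
qed

text \<open>The exact value is \<open>det (I - M)\<close> to the power -1/2, and its logarithm
  begins with half the trace of \<open>M\<close> and a quarter of the trace of its square. Instead
  of diagonalizing, the induction integrates out one coordinate at a time, which is Gaussian
  elimination on \<open>I - M\<close>. The bound \<open>q\<close> on absolute row sums is a diagonal
  dominance that survives each elimination, so every coordinate adds the same cubic error.\<close>

lemma gaussian_quadratic_mgf_le:
  fixes M :: "'i \<Rightarrow> 'i \<Rightarrow> real" and q :: real
  assumes "finite I"
    and "\<And>i j. i \<in> I \<Longrightarrow> j \<in> I \<Longrightarrow> M i j = M j i"
    and "\<And>i. i \<in> I \<Longrightarrow> (\<Sum>j\<in>I. \<bar>M i j\<bar>) \<le> q"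
    and "0 \<le> q" "q \<le> 1 / 2"
  shows "(\<integral>\<^sup>+ x. ennreal (exp ((\<Sum>i\<in>I. \<Sum>j\<in>I. M i j * x i * x j) / 2)) \<partial>gaussian_on I)
    \<le> ennreal (exp ((\<Sum>i\<in>I. M i i) / 2 + (\<Sum>i\<in>I. \<Sum>j\<in>I. (M i j)\<^sup>2) / 4 + 3 * card I * q ^ 3))"
  using assms(1-3)
proof (induction I arbitrary: M rule: finite_induct)
  case empty
  then show ?case by (simp add: PiM_empty)
next
  case (insert i I)
  note fin = insert.hyps
  have symm: "M j l = M l j" if "j \<in> insert i I" "l \<in> insert i I" for j l
    using insert.prems(1) that by blast
  have rows: "(\<Sum>l\<in>insert i I. \<bar>M j l\<bar>) \<le> q" if "j \<in> insert i I" for j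
    using insert.prems(2) that by blast
  define x where "x = M i i"
  define c where "c = 1 / (1 - x)"
  \<comment> \<open>The Schur complement: completing the square in coordinate \<open>i\<close> adds
    a rank-one term to the matrix on the remaining coordinates.\<close>
  define M' where "M' j l = M j l + c * M i j * M i l" for j l
  define u where "u = (\<Sum>j\<in>I. \<bar>M i j\<bar>)"
  define S2 where "S2 = (\<Sum>j\<in>I. (M i j)\<^sup>2)"
  define S3 where "S3 = (\<Sum>j\<in>I. \<Sum>l\<in>I. M j l * M i j * M i l)"
  have xu: "\<bar>x\<bar> + u \<le> q" using rows[of i] fin by (simp add: x_def u_def)
  have u0: "0 \<le> u" by (auto simp: u_def intro: sum_nonneg)
  have x1: "x < 1" "\<bar>x\<bar> \<le> q" "u \<le> q" using xu u0 assms(4,5) by auto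
  have c: "0 < c" "c * (q - \<bar>x\<bar>) \<le> 1"
    using x1 assms(4,5) by (auto simp: c_def field_simps abs_if split: if_splits)
  have "0 \<le> S2" by (auto simp: S2_def intro: sum_nonneg)
  have S2u: "S2 \<le> u\<^sup>2"
  proof -
    have "S2 \<le> (\<Sum>j\<in>I. \<bar>M i j\<bar> * u)"
      unfolding S2_def power2_eq_square u_def
    proof (rule sum_mono)
      fix j assume "j \<in> I"
      then have "\<bar>M i j\<bar> \<le> (\<Sum>j\<in>I. \<bar>M i j\<bar>)" using fin by (intro member_le_sum) auto
      then have "\<bar>M i j\<bar> * \<bar>M i j\<bar> \<le> \<bar>M i j\<bar> * (\<Sum>j\<in>I. \<bar>M i j\<bar>)" by (intro mult_left_mono) auto
      then show "M i j * M i j \<le> \<bar>M i j\<bar> * (\<Sum>j\<in>I. \<bar>M i j\<bar>)" by simp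
    qed
    then show ?thesis by (simp add: sum_distrib_right[symmetric] u_def power2_eq_square)
  qed
  have S3: "\<bar>S3\<bar> \<le> q ^ 3"
  proof -
    have "\<bar>S3\<bar> \<le> (\<Sum>j\<in>I. \<Sum>l\<in>I. \<bar>M j l\<bar> * (\<bar>M i j\<bar> * q))"
      unfolding S3_def
    proof (intro order_trans[OF sum_abs] sum_mono)
      fix j l assume jl: "j \<in> I" "l \<in> I"
      have "\<bar>M i l\<bar> \<le> u" unfolding u_def using fin jl by (intro member_le_sum) auto
      then show "\<bar>M j l * M i j * M i l\<bar> \<le> \<bar>M j l\<bar> * (\<bar>M i j\<bar> * q)"
        using x1 by (auto simp: abs_mult mult.assoc intro!: mult_left_mono)
    qed
    also have "\<dots> = (\<Sum>j\<in>I. (\<Sum>l\<in>I. \<bar>M j l\<bar>) * (\<bar>M i j\<bar> * q))"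
      by (simp add: sum_distrib_right)
    also have "\<dots> \<le> (\<Sum>j\<in>I. q * (\<bar>M i j\<bar> * q))"
    proof (intro sum_mono mult_right_mono)
      fix j assume "j \<in> I"
      then show "(\<Sum>l\<in>I. \<bar>M j l\<bar>) \<le> q" using rows[of j] fin by simp
    qed (use assms in auto)
    also have "\<dots> = q * q * u" by (simp add: u_def sum_distrib_left mult_ac)
    also have "\<dots> \<le> q * q * q" using x1 assms by (intro mult_left_mono) auto
    finally show ?thesis by (simp add: power3_eq_cube)
  qed
  have form: "(\<Sum>j\<in>insert i I. \<Sum>l\<in>insert i I. M j l * (z(i := y)) j * (z(i := y)) l) / 2
      = x * y\<^sup>2 / 2 + (\<Sum>j\<in>I. M i j * z j) * y + (\<Sum>j\<in>I. \<Sum>l\<in>I. M j l * z j * z l) / 2" for z y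
  proof -
    have "(\<Sum>j\<in>insert i I. \<Sum>l\<in>insert i I. M j l * (z(i := y)) j * (z(i := y)) l)
      = (x * y * y + (\<Sum>l\<in>I. M i l * y * z l))
        + (\<Sum>j\<in>I. M j i * z j * y + (\<Sum>l\<in>I. M j l * z j * z l))"
      using fin by (auto simp: x_def intro!: arg_cong2[where f = "(+)"] sum.cong)
    also have "(\<Sum>j\<in>I. M j i * z j * y + (\<Sum>l\<in>I. M j l * z j * z l))
      = (\<Sum>j\<in>I. M i j * z j * y + (\<Sum>l\<in>I. M j l * z j * z l))"
      by (intro sum.cong refl) (simp add: symm)
    finally show ?thesis
      by (simp add: sum.distrib sum_distrib_left sum_distrib_right power2_eq_square mult_ac)
  qed
  have form': "(\<Sum>j\<in>I. M i j * z j)\<^sup>2 * c + (\<Sum>j\<in>I. \<Sum>l\<in>I. M j l * z j * z l)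
      = (\<Sum>j\<in>I. \<Sum>l\<in>I. M' j l * z j * z l)" for z
    by (simp add: M'_def distrib_right distrib_left sum.distrib power2_eq_square sum_product sum_distrib_left
        sum_distrib_right mult_ac)
  have meas: "(\<lambda>z. ennreal (exp ((\<Sum>j\<in>J. \<Sum>l\<in>J. A j l * z j * z l) / 2)))
      \<in> borel_measurable (gaussian_on J)" for J :: "'i set" and A
    by measurable
  have "(\<integral>\<^sup>+ z. ennreal (exp ((\<Sum>j\<in>insert i I. \<Sum>l\<in>insert i I. M j l * z j * z l) / 2)) \<partial>gaussian_on (insert i I))
    = (\<integral>\<^sup>+ z. (\<integral>\<^sup>+ y. ennreal (exp ((\<Sum>j\<in>insert i I. \<Sum>l\<in>insert i I. M j l * (z(i := y)) j * (z(i := y)) l) / 2))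
         \<partial>std_normal_distribution) \<partial>gaussian_on I)"
    using fin by (intro std_normal.product_nn_integral_insert meas)
  also have "\<dots> = (\<integral>\<^sup>+ z. ennreal (exp ((\<Sum>j\<in>I. M i j * z j)\<^sup>2 / (2 * (1 - x))) / sqrt (1 - x))
       * ennreal (exp ((\<Sum>j\<in>I. \<Sum>l\<in>I. M j l * z j * z l) / 2)) \<partial>gaussian_on I)"
    unfolding form exp_add[of "_ + _"] ennreal_mult[OF exp_ge_zero exp_ge_zero]
    by (subst nn_integral_multc) (auto simp: std_normal_quadratic_integral[OF x1(1)])
  also have "\<dots> = (\<integral>\<^sup>+ z. ennreal (1 / sqrt (1 - x)) * ennreal (exp ((\<Sum>j\<in>I. \<Sum>l\<in>I. M' j l * z j * z l) / 2)) \<partial>gaussian_on I)"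
  proof (rule nn_integral_cong)
    fix z
    have "(\<Sum>j\<in>I. M i j * z j)\<^sup>2 / (2 * (1 - x)) + (\<Sum>j\<in>I. \<Sum>l\<in>I. M j l * z j * z l) / 2
        = (\<Sum>j\<in>I. \<Sum>l\<in>I. M' j l * z j * z l) / 2"
      unfolding form'[symmetric] using x1 by (simp add: c_def field_simps)
    then show "ennreal (exp ((\<Sum>j\<in>I. M i j * z j)\<^sup>2 / (2 * (1 - x))) / sqrt (1 - x))
         * ennreal (exp ((\<Sum>j\<in>I. \<Sum>l\<in>I. M j l * z j * z l) / 2))
       = ennreal (1 / sqrt (1 - x)) * ennreal (exp ((\<Sum>j\<in>I. \<Sum>l\<in>I. M' j l * z j * z l) / 2))"
      using x1 by (simp add: ennreal_mult[symmetric] exp_add[symmetric])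
  qed
  also have "\<dots> = ennreal (1 / sqrt (1 - x)) * (\<integral>\<^sup>+ z. ennreal (exp ((\<Sum>j\<in>I. \<Sum>l\<in>I. M' j l * z j * z l) / 2)) \<partial>gaussian_on I)"
    by (rule nn_integral_cmult[OF meas])
  also have "\<dots> \<le> ennreal (1 / sqrt (1 - x))
      * ennreal (exp ((\<Sum>j\<in>I. M' j j) / 2 + (\<Sum>j\<in>I. \<Sum>l\<in>I. (M' j l)\<^sup>2) / 4 + 3 * card I * q ^ 3))"
  proof (intro mult_left_mono insert.IH)
    fix j l assume "j \<in> I" "l \<in> I"
    then show "M' j l = M' l j" using symm[of j l] by (simp add: M'_def)
  next
    fix j assume j: "j \<in> I"
    \<comment> \<open>The rank-one term adds at most \<open>\<bar>M i j\<bar> * (c * u)\<close>,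
      hence at most \<open>\<bar>M i j\<bar>\<close>, to row \<open>j\<close>. By symmetry that is
      the size of the entry which row \<open>j\<close> loses with column \<open>i\<close>.\<close>
    have "(\<Sum>l\<in>I. \<bar>M' j l\<bar>) \<le> (\<Sum>l\<in>I. \<bar>M j l\<bar> + c * \<bar>M i j\<bar> * \<bar>M i l\<bar>)"
      unfolding M'_def using c
      by (intro sum_mono order_trans[OF abs_triangle_ineq]) (auto simp: abs_mult)
    also have "\<dots> = (\<Sum>l\<in>I. \<bar>M j l\<bar>) + \<bar>M i j\<bar> * (c * u)"
      by (simp add: sum.distrib u_def sum_distrib_left mult_ac)
    also have "\<dots> \<le> (\<Sum>l\<in>I. \<bar>M j l\<bar>) + \<bar>M i j\<bar> * (c * (q - \<bar>x\<bar>))"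
      using xu c by (intro add_left_mono mult_left_mono) auto
    also have "\<dots> \<le> (\<Sum>l\<in>I. \<bar>M j l\<bar>) + \<bar>M i j\<bar> * 1"
      using c by (intro add_left_mono mult_left_mono) auto
    also have "\<dots> = (\<Sum>l\<in>insert i I. \<bar>M j l\<bar>)" using fin symm[of i j] j by simp
    finally show "(\<Sum>l\<in>I. \<bar>M' j l\<bar>) \<le> q" using rows[of j] j by simp
  qed auto
  also have "\<dots> \<le> ennreal (exp ((\<Sum>j\<in>insert i I. M j j) / 2
      + (\<Sum>j\<in>insert i I. \<Sum>l\<in>insert i I. (M j l)\<^sup>2) / 4 + 3 * card (insert i I) * q ^ 3))"
  proof -
    have sq: "1 / sqrt (1 - x) = exp (- ln (1 - x) / 2)"
      using x1 by (simp add: exp_minus ln_sqrt[symmetric] field_simps)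
    have t1: "(\<Sum>j\<in>I. M' j j) = (\<Sum>j\<in>I. M j j) + S2 / (1 - x)"
      by (simp add: M'_def sum.distrib S2_def c_def power2_eq_square sum_divide_distrib)
    have t2: "(\<Sum>j\<in>I. \<Sum>l\<in>I. (M' j l)\<^sup>2)
        = (\<Sum>j\<in>I. \<Sum>l\<in>I. (M j l)\<^sup>2) + (2 * S3 / (1 - x) + S2\<^sup>2 / (1 - x)\<^sup>2)"
    proof -
      have "(\<Sum>j\<in>I. \<Sum>l\<in>I. (M' j l)\<^sup>2)
        = (\<Sum>j\<in>I. \<Sum>l\<in>I. (M j l)\<^sup>2 + 2 * c * (M j l * M i j * M i l) + c\<^sup>2 * ((M i j)\<^sup>2 * (M i l)\<^sup>2))"
        by (intro sum.cong refl) (simp add: M'_def power2_eq_square algebra_simps)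
      also have "\<dots> = (\<Sum>j\<in>I. \<Sum>l\<in>I. (M j l)\<^sup>2) + 2 * c * S3 + c\<^sup>2 * S2\<^sup>2"
        by (simp add: sum.distrib sum_distrib_left[symmetric] S3_def S2_def power2_eq_square[of "sum _ _"]
            sum_product)
      finally show ?thesis by (simp add: c_def power_divide)
    qed
    have t3: "(\<Sum>j\<in>insert i I. \<Sum>l\<in>insert i I. (M j l)\<^sup>2) = x\<^sup>2 + 2 * S2 + (\<Sum>j\<in>I. \<Sum>l\<in>I. (M j l)\<^sup>2)"
    proof -
      have "(\<Sum>j\<in>I. (M j i)\<^sup>2) = S2"
        unfolding S2_def by (intro sum.cong refl) (metis symm insertCI)
      then show ?thesis using fin by (simp add: sum.distrib x_def S2_def)
    qed
    have t4: "(\<Sum>j\<in>insert i I. M j j) = x + (\<Sum>j\<in>I. M j j)"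
      using fin by (simp add: x_def)
    have "- ln (1 - x) / 2 + (S2 / (1 - x)) / 2 + (2 * S3 / (1 - x) + S2\<^sup>2 / (1 - x)\<^sup>2) / 4
      \<le> x / 2 + (x\<^sup>2 + 2 * S2) / 4 + 3 * q ^ 3"
      by (rule gaussian_quadratic_step[OF xu assms(5) u0 \<open>0 \<le> S2\<close> S2u S3])
    then show ?thesis
      unfolding sq t1 t2 t3 t4 using fin
      by (simp add: ennreal_mult[symmetric] exp_add[symmetric] add_divide_distrib algebra_simps)
  qed
  finally show ?case .
qed

subsection \<open>The Mehler kernel and equicorrelated densities\<close>

text \<open>The density of a pair of standard normal variables with correlation \<open>s\<close>,
  relative to two independent ones; equivalently the kernel of the Ornstein-Uhlenbeck
  semigroup.\<close>

definition mehler :: "real \<Rightarrow> real \<Rightarrow> real \<Rightarrow> real" where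
  "mehler s z x = exp ((2 * s * z * x - s\<^sup>2 * (z\<^sup>2 + x\<^sup>2)) / (2 * (1 - s\<^sup>2))) / sqrt (1 - s\<^sup>2)"

lemma mehler_nonneg [simp]: "s\<^sup>2 < 1 \<Longrightarrow> 0 \<le> mehler s z x"
  by (simp add: mehler_def)

lemma mehler_commute: "mehler s z x = mehler s x z"
  by (simp add: mehler_def algebra_simps)

lemma mehler_zero [simp]: "mehler 0 z x = 1"
  by (simp add: mehler_def)

lemma measurable_mehler [measurable]:
  assumes [measurable]: "f \<in> borel_measurable M" "g \<in> borel_measurable M"
  shows "(\<lambda>x. mehler s (f x) (g x)) \<in> borel_measurable M"
  unfolding mehler_def by measurable

text \<open>The semigroup property: in a Gaussian Markov chain from \<open>z\<close> over
  \<open>x\<close> to \<open>w\<close> with correlations \<open>s\<close> and \<open>t\<close>, the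
  ends have correlation \<open>s * t\<close>. The computation is carried out in
  \<open>a = 1 - s^2\<close> and \<open>b = 1 - t^2\<close>, so that all denominators are products
  of positive variables; \<open>D\<close> is \<open>1 - (s * t)^2\<close>.\<close>

lemma mehler_convolution:
  assumes "s\<^sup>2 < 1" "t\<^sup>2 < 1"
  shows "(\<integral>\<^sup>+ x. ennreal (mehler s z x * mehler t w x) \<partial>std_normal_distribution)
    = ennreal (mehler (s * t) z w)"
proof -
  define a b where "a = 1 - s\<^sup>2" and "b = 1 - t\<^sup>2"
  have a: "a > 0" and b: "b > 0" and s2: "s\<^sup>2 = 1 - a" and t2: "t\<^sup>2 = 1 - b"
    using assms by (auto simp: a_def b_def)
  define D where "D = a + b - a * b"
  have "s\<^sup>2 * t\<^sup>2 < 1"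
    using assms mult_left_mono[of "t\<^sup>2" 1 "s\<^sup>2"] by simp
  then have D: "D > 0" and D': "1 - (s * t)\<^sup>2 = D"
    unfolding power_mult_distrib s2 t2 D_def by (auto simp: algebra_simps)
  define \<alpha> where "\<alpha> = - ((1 - a) / a) - (1 - b) / b"
  define \<beta> where "\<beta> = s * z / a + t * w / b"
  define K where "K = - ((1 - a) * z\<^sup>2 / (2 * a)) - (1 - b) * w\<^sup>2 / (2 * b)"
  have \<alpha>: "1 - \<alpha> = D / (a * b)"
    using a b by (simp add: \<alpha>_def D_def field_simps)
  have \<alpha>1: "\<alpha> < 1" using \<alpha> divide_pos_pos[OF D mult_pos_pos[OF a b]] by linarith
  have prod: "mehler s z x * mehler t w x = exp K / (sqrt a * sqrt b) * exp (\<alpha> * x\<^sup>2 / 2 + \<beta> * x)" for x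
  proof -
    have "(2 * s * z * x - s\<^sup>2 * (z\<^sup>2 + x\<^sup>2)) / (2 * (1 - s\<^sup>2)) + (2 * t * w * x - t\<^sup>2 * (w\<^sup>2 + x\<^sup>2)) / (2 * (1 - t\<^sup>2))
        = K + (\<alpha> * x\<^sup>2 / 2 + \<beta> * x)"
      unfolding s2 t2 K_def \<alpha>_def \<beta>_def using a b by (simp add: field_simps)
    then show ?thesis
      by (simp add: mehler_def a_def[symmetric] b_def[symmetric] exp_add[symmetric] del: diff_diff_eq)
  qed
  have "(\<integral>\<^sup>+ x. ennreal (mehler s z x * mehler t w x) \<partial>std_normal_distribution)
    = ennreal (exp K / (sqrt a * sqrt b)) * (\<integral>\<^sup>+ x. ennreal (exp (\<alpha> * x\<^sup>2 / 2 + \<beta> * x)) \<partial>std_normal_distribution)"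
    unfolding prod using a b by (subst nn_integral_cmult[symmetric]) (auto simp: ennreal_mult[symmetric])
  also have "\<dots> = ennreal (exp K / (sqrt a * sqrt b) * (exp (\<beta>\<^sup>2 / (2 * (1 - \<alpha>))) / sqrt (1 - \<alpha>)))"
    using \<alpha>1 a b by (subst std_normal_quadratic_integral) (auto simp: ennreal_mult[symmetric])
  also have "exp K / (sqrt a * sqrt b) * (exp (\<beta>\<^sup>2 / (2 * (1 - \<alpha>))) / sqrt (1 - \<alpha>)) = mehler (s * t) z w"
  proof -
    have "K + \<beta>\<^sup>2 / (2 * (1 - \<alpha>)) = (2 * (s * t) * z * w - (s * t)\<^sup>2 * (z\<^sup>2 + w\<^sup>2)) / (2 * (1 - (s * t)\<^sup>2))"
    proof -
      have "\<beta>\<^sup>2 / (2 * (1 - \<alpha>)) = (b * (s * z) + a * (t * w))\<^sup>2 / (2 * (D * (a * b)))"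
        unfolding \<alpha> \<beta>_def using a b D by (simp add: field_simps power2_eq_square)
      also have "(b * (s * z) + a * (t * w))\<^sup>2 = b\<^sup>2 * (s\<^sup>2 * z\<^sup>2) + 2 * a * b * (s * t * z * w) + a\<^sup>2 * (t\<^sup>2 * w\<^sup>2)"
        by (simp add: power2_eq_square algebra_simps)
      finally have *: "\<beta>\<^sup>2 / (2 * (1 - \<alpha>)) = (b\<^sup>2 * ((1 - a) * z\<^sup>2) + 2 * a * b * (s * t * z * w) + a\<^sup>2 * ((1 - b) * w\<^sup>2)) / (2 * (D * (a * b)))"
        unfolding s2 t2 .
      have D2: "1 - (1 - a) * (1 - b) = D" by (simp add: D_def algebra_simps)
      have K': "K = - (b * D * (1 - a) * z\<^sup>2 + a * D * (1 - b) * w\<^sup>2) / (2 * (D * (a * b)))"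
        using a b D by (simp add: K_def field_simps)
      have num: "- (b * D * (1 - a) * z\<^sup>2 + a * D * (1 - b) * w\<^sup>2) + (b\<^sup>2 * ((1 - a) * z\<^sup>2) + 2 * a * b * (s * t * z * w) + a\<^sup>2 * ((1 - b) * w\<^sup>2))
          = a * b * (2 * (s * t) * z * w - (1 - a) * (1 - b) * (z\<^sup>2 + w\<^sup>2))"
        by (simp add: D_def algebra_simps power2_eq_square)
      have "K + \<beta>\<^sup>2 / (2 * (1 - \<alpha>)) = a * b * (2 * (s * t) * z * w - (1 - a) * (1 - b) * (z\<^sup>2 + w\<^sup>2)) / (2 * (D * (a * b)))"
        unfolding * K' num[symmetric] by (simp add: add_divide_distrib)
      also have "\<dots> = (2 * (s * t) * z * w - (s * t)\<^sup>2 * (z\<^sup>2 + w\<^sup>2)) / (2 * (1 - (s * t)\<^sup>2))"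
        unfolding power_mult_distrib s2 t2 D2 using a b D by simp
      finally show ?thesis .
    qed
    moreover have "sqrt a * sqrt b * sqrt (1 - \<alpha>) = sqrt (1 - (s * t)\<^sup>2)"
      unfolding \<alpha> D' real_sqrt_mult[symmetric] using a b by simp
    ultimately show ?thesis
      by (simp add: mehler_def exp_add[symmetric] divide_simps)
  qed
  finally show ?thesis .
qed

section \<open>Densities of equicorrelated Gaussian vectors\<close>

definition equi_slope :: "nat \<Rightarrow> real \<Rightarrow> real" where
  "equi_slope m r = r / ((1 - r) * (1 + (real m - 1) * r))"

definition equi_norm :: "nat \<Rightarrow> real \<Rightarrow> real" where
  "equi_norm m r = (1 - r) ^ (m - 1) * (1 + (real m - 1) * r)"

text \<open>The likelihood ratio of the centered Gaussian with equicorrelation parameter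
  \<open>r\<close> against the standard one: \<open>equi_norm\<close> is the determinant of the
  covariance, whose inverse is the identity divided by \<open>1 - r\<close> minus
  \<open>equi_slope\<close> times the all-ones matrix.\<close>

definition equi_ratio :: "nat \<Rightarrow> real \<Rightarrow> (nat \<Rightarrow> real) \<Rightarrow> real" where
  "equi_ratio m r x = exp ((equi_slope m r * (\<Sum>k<m. x k)\<^sup>2 - r / (1 - r) * (\<Sum>k<m. (x k)\<^sup>2)) / 2)
     / sqrt (equi_norm m r)"

lemma equi_norm_pos: "1 \<le> m \<Longrightarrow> 0 \<le> r \<Longrightarrow> r < 1 \<Longrightarrow> 0 < equi_norm m r"
  unfolding equi_norm_def by (intro mult_pos_pos add_pos_nonneg) auto

lemma equi_ratio_nonneg: "1 \<le> m \<Longrightarrow> 0 \<le> r \<Longrightarrow> r < 1 \<Longrightarrow> 0 \<le> equi_ratio m r x"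
  using equi_norm_pos[of m r] by (simp add: equi_ratio_def)

lemma equi_ratio_cong: "(\<And>k. k < m \<Longrightarrow> x k = y k) \<Longrightarrow> equi_ratio m r x = equi_ratio m r y"
  unfolding equi_ratio_def by simp

lemma measurable_equi_ratio [measurable]:
  assumes [measurable]: "\<And>k. k < m \<Longrightarrow> (\<lambda>x. f x k) \<in> borel_measurable M"
  shows "(\<lambda>x. equi_ratio m r (f x)) \<in> borel_measurable M"
  unfolding equi_ratio_def by measurable

text \<open>An equicorrelated vector is \<open>s * z\<close> with one common Gaussian
  \<open>z\<close>, plus independent noise of variance \<open>1 - s^2\<close> in each coordinate.
  Given \<open>z\<close> the coordinates are independent with Mehler densities, and averaging over
  \<open>z\<close> gives the joint density.\<close>

lemma equi_ratio_mehler: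
  assumes "1 \<le> m" "0 \<le> s" "s < 1"
  shows "(\<integral>\<^sup>+ z. ennreal (\<Prod>k<m. mehler s z (x k)) \<partial>std_normal_distribution)
    = ennreal (equi_ratio m (s\<^sup>2) x)"
proof -
  define r where "r = s\<^sup>2"
  define a where "a = 1 - r"
  have s1: "s\<^sup>2 < 1" using assms by (simp add: power_less_one_iff abs_square_less_1)
  then have a: "a > 0" by (simp add: a_def r_def)
  have r: "r = 1 - a" "0 \<le> r" by (simp_all add: a_def r_def)
  define e where "e = 1 + (real m - 1) * r"
  have e: "e > 0" using assms r unfolding e_def by (intro add_pos_nonneg) auto
  define S T where "S = (\<Sum>k<m. x k)" and "T = (\<Sum>k<m. (x k)\<^sup>2)"
  define \<alpha> where "\<alpha> = - (m * r / a)"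
  have \<alpha>: "1 - \<alpha> = e / a" using a by (simp add: \<alpha>_def e_def field_simps r(1))
  have \<alpha>1: "\<alpha> < 1" using \<alpha> divide_pos_pos[OF e a] by linarith
  have prod: "(\<Prod>k<m. mehler s z (x k)) = exp (- (r * T / (2 * a))) / sqrt a ^ m * exp (\<alpha> * z\<^sup>2 / 2 + s * S / a * z)" for z
  proof -
    have "(\<Prod>k<m. mehler s z (x k)) = exp (\<Sum>k<m. (2 * s * z * x k - r * (z\<^sup>2 + (x k)\<^sup>2)) / (2 * a)) / sqrt a ^ m"
      unfolding mehler_def r_def[symmetric] a_def[symmetric]
      by (simp add: prod_dividef exp_sum)
    also have "(\<Sum>k<m. (2 * s * z * x k - r * (z\<^sup>2 + (x k)\<^sup>2)) / (2 * a))
        = (2 * s * z * S - r * (m * z\<^sup>2 + T)) / (2 * a)"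
      unfolding S_def T_def
      by (simp add: sum_divide_distrib[symmetric] sum_subtractf sum_distrib_left[symmetric] sum.distrib
          mult.assoc)
    also have "\<dots> = - (r * T / (2 * a)) + (\<alpha> * z\<^sup>2 / 2 + s * S / a * z)"
      using a by (simp add: \<alpha>_def field_simps)
    finally show ?thesis by (simp only: exp_add) simp
  qed
  have "(\<integral>\<^sup>+ z. ennreal (\<Prod>k<m. mehler s z (x k)) \<partial>std_normal_distribution)
    = ennreal (exp (- (r * T / (2 * a))) / sqrt a ^ m) * (\<integral>\<^sup>+ z. ennreal (exp (\<alpha> * z\<^sup>2 / 2 + s * S / a * z)) \<partial>std_normal_distribution)"
    unfolding prod using a by (subst nn_integral_cmult[symmetric]) (auto simp: ennreal_mult[symmetric])
  also have "\<dots> = ennreal (exp (- (r * T / (2 * a))) / sqrt a ^ m * (exp ((s * S / a)\<^sup>2 / (2 * (1 - \<alpha>))) / sqrt (1 - \<alpha>)))"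
    using \<alpha>1 a by (subst std_normal_quadratic_integral) (auto simp: ennreal_mult[symmetric])
  also have "exp (- (r * T / (2 * a))) / sqrt a ^ m * (exp ((s * S / a)\<^sup>2 / (2 * (1 - \<alpha>))) / sqrt (1 - \<alpha>))
      = equi_ratio m r x"
  proof -
    have "- (r * T / (2 * a)) + (s * S / a)\<^sup>2 / (2 * (1 - \<alpha>)) = (equi_slope m r * S\<^sup>2 - r / (1 - r) * T) / 2"
      unfolding \<alpha> equi_slope_def e_def[symmetric] a_def[symmetric] power_divide power_mult_distrib r_def[symmetric]
      using a e by (simp add: field_simps power2_eq_square)
    moreover have "sqrt a ^ m * sqrt (1 - \<alpha>) = sqrt (equi_norm m r)"
    proof -
      have "a ^ m * (e / a) = a ^ (m - 1) * e"
        using a assms by (cases m) auto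
      then show ?thesis
        unfolding \<alpha> equi_norm_def a_def[symmetric] e_def[symmetric]
        by (metis real_sqrt_mult real_sqrt_power)
    qed
    ultimately show ?thesis
      unfolding equi_ratio_def S_def[symmetric] T_def[symmetric] 
      by (metis (no_types, lifting) exp_add mult.commute times_divide_times_eq)
  qed
  finally show ?thesis by (simp add: r_def)
qed

lemma equi_ratio_integral:
  assumes "1 \<le> m" "0 \<le> r" "r < 1"
  shows "(\<integral>\<^sup>+ x. ennreal (equi_ratio m r x) \<partial>gaussian_on {..<m}) = 1"
proof -
  define s where "s = sqrt r"
  have s: "0 \<le> s" "s < 1" "s\<^sup>2 = r" using assms by (auto simp: s_def)
  have s1: "s\<^sup>2 < 1" using s assms by simp
  have fin: "sigma_finite_measure (gaussian_on {..<m})"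
    by (intro std_normal.sigma_finite) simp
  interpret P: pair_sigma_finite std_normal_distribution "gaussian_on {..<m}"
    by (intro pair_sigma_finite.intro fin std_normal.sigma_finite_measures)
  \<comment> \<open>The semigroup property with second correlation 0, since \<open>mehler 0\<close>
    is constantly 1.\<close>
  have one: "(\<integral>\<^sup>+ x. ennreal (mehler s z x) \<partial>std_normal_distribution) = 1" for z
    using mehler_convolution[of s 0 z 0] s1 by simp
  have "(\<integral>\<^sup>+ x. ennreal (equi_ratio m r x) \<partial>gaussian_on {..<m})
      = (\<integral>\<^sup>+ x. (\<integral>\<^sup>+ z. ennreal (\<Prod>k<m. mehler s z (x k)) \<partial>std_normal_distribution) \<partial>gaussian_on {..<m})"
    using equi_ratio_mehler[OF assms(1) s(1,2)] s(3) by simp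
  also have "\<dots> = (\<integral>\<^sup>+ z. (\<integral>\<^sup>+ x. ennreal (\<Prod>k<m. mehler s z (x k)) \<partial>gaussian_on {..<m}) \<partial>std_normal_distribution)"
    by (intro P.Fubini') measurable
  also have "\<dots> = (\<integral>\<^sup>+ z. 1 \<partial>(std_normal_distribution))"
  proof (intro nn_integral_cong)
    fix z :: real
    have "(\<integral>\<^sup>+ x. ennreal (\<Prod>k<m. mehler s z (x k)) \<partial>gaussian_on {..<m})
        = (\<integral>\<^sup>+ x. (\<Prod>k<m. ennreal (mehler s z (x k))) \<partial>gaussian_on {..<m})"
      using s1 by (simp add: prod_ennreal)
    also have "\<dots> = (\<Prod>k<m. (\<integral>\<^sup>+ x. ennreal (mehler s z x) \<partial>std_normal_distribution))"
      by (intro std_normal.product_nn_integral_prod) auto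
    finally show "(\<integral>\<^sup>+ x. ennreal (\<Prod>k<m. mehler s z (x k)) \<partial>gaussian_on {..<m}) = 1"
      by (simp add: one)
  qed
  also have "\<dots> = 1"
    using prob_space.emeasure_space_1[OF prob_space_std_normal] by simp
  finally show ?thesis .
qed

text \<open>Both factors are mixtures over hidden Gaussians on the edges, \<open>Z\<close> for the
  first and \<open>W\<close> for the second. The coordinate \<open>X (k, \<theta> k e)\<close> is
  tied to \<open>Z (\<theta> k e)\<close> and to \<open>W e\<close>, each with correlation
  \<open>sqrt \<rho>\<close>; integrating it out links these two with correlation \<rho>.
  Integrating out \<open>W\<close> then leaves an equicorrelated density in \<open>Z\<close> with
  parameter \<open>\<rho> * \<rho>\<close>. An integral over \<open>m * card E\<close> coordinates
  has become one over \<open>card E\<close>.\<close>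

lemma equi_second_moment:
  fixes \<theta> \<psi> :: "nat \<Rightarrow> 'e \<Rightarrow> 'e"
  assumes m: "1 \<le> m" and \<rho>: "0 \<le> \<rho>" "\<rho> < 1" and E: "finite E"
    and \<theta>: "\<And>k. k < m \<Longrightarrow> bij_betw (\<theta> k) E E"
    and \<psi>: "\<And>k e. k < m \<Longrightarrow> e \<in> E \<Longrightarrow> \<psi> k (\<theta> k e) = e"
  shows "(\<integral>\<^sup>+ X. ennreal ((\<Prod>e\<in>E. equi_ratio m \<rho> (\<lambda>k. X (k, e))) * (\<Prod>e\<in>E. equi_ratio m \<rho> (\<lambda>k. X (k, \<theta> k e))))
      \<partial>gaussian_on ({..<m} \<times> E))
    = (\<integral>\<^sup>+ Z. ennreal (\<Prod>e\<in>E. equi_ratio m (\<rho>\<^sup>2) (\<lambda>k. Z (\<theta> k e))) \<partial>gaussian_on E)"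
proof -
  define s where "s = sqrt \<rho>"
  have s: "0 \<le> s" "s < 1" "s\<^sup>2 = \<rho>" using \<rho> by (auto simp: s_def)
  have s1: "s\<^sup>2 < 1" using s \<rho> by simp
  have \<theta>E: "\<theta> k e \<in> E" if "k < m" "e \<in> E" for k e using \<theta>[OF that(1)] that(2) by (auto dest: bij_betwE)
  have \<psi>E: "\<psi> k e \<in> E" if "k < m" "e \<in> E" for k e
    using \<theta>[OF that(1)] that \<psi> by (metis bij_betw_imp_surj_on imageE)
  let ?K = "{..<m} \<times> E"
  have finK: "finite ?K" using E by simp
  have sig: "sigma_finite_measure (gaussian_on E)" "sigma_finite_measure (gaussian_on ?K)"
    using E by (auto intro!: std_normal.sigma_finite)
  interpret P: pair_sigma_finite "gaussian_on E" "gaussian_on ?K"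
    by (intro pair_sigma_finite.intro sig)
  interpret PE: pair_sigma_finite "gaussian_on E" "gaussian_on E"
    by (intro pair_sigma_finite.intro sig)
  have expand: "(\<integral>\<^sup>+ Z. (\<Prod>e\<in>E. \<Prod>k<m. ennreal (mehler r (Z e) (y e k))) \<partial>gaussian_on E)
      = (\<Prod>e\<in>E. ennreal (equi_ratio m (r\<^sup>2) (y e)))"
    if "0 \<le> r" "r < 1" for r and y :: "'e \<Rightarrow> nat \<Rightarrow> real"
  proof -
    have r1: "r\<^sup>2 < 1" using that by (simp add: abs_square_less_1)
    have "(\<integral>\<^sup>+ Z. (\<Prod>e\<in>E. \<Prod>k<m. ennreal (mehler r (Z e) (y e k))) \<partial>gaussian_on E)
        = (\<Prod>e\<in>E. (\<integral>\<^sup>+ z. (\<Prod>k<m. ennreal (mehler r z (y e k))) \<partial>std_normal_distribution))"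
      by (intro std_normal.product_nn_integral_prod E) measurable
    also have "\<dots> = (\<Prod>e\<in>E. ennreal (equi_ratio m (r\<^sup>2) (y e)))"
      using r1 by (intro prod.cong refl) (simp add: prod_ennreal equi_ratio_mehler[OF m that])
    finally show ?thesis .
  qed
  have prodE: "ennreal (\<Prod>e\<in>E. equi_ratio m r (y e)) = (\<Prod>e\<in>E. ennreal (equi_ratio m r (y e)))"
    if "0 \<le> r" "r < 1" for r and y :: "'e \<Rightarrow> nat \<Rightarrow> real"
    using that m by (simp add: prod_ennreal equi_ratio_nonneg)
  let ?F = "\<lambda>Z X. (\<Prod>e\<in>E. \<Prod>k<m. ennreal (mehler s (Z e) (X (k, e))))"
  let ?G = "\<lambda>Z X. (\<Prod>e\<in>E. \<Prod>k<m. ennreal (mehler s (Z e) (X (k, \<theta> k e))))"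
  have measF [measurable]: "(\<lambda>(Z, X). ?F Z X) \<in> borel_measurable (gaussian_on E \<Otimes>\<^sub>M gaussian_on ?K)"
    by (simp add: case_prod_unfold) measurable
  have measG [measurable]: "(\<lambda>(Z, X). ?G Z X) \<in> borel_measurable (gaussian_on E \<Otimes>\<^sub>M gaussian_on ?K)"
    by (simp add: case_prod_unfold) (measurable, use \<theta>E in auto)
  have "(\<integral>\<^sup>+ X. ennreal ((\<Prod>e\<in>E. equi_ratio m \<rho> (\<lambda>k. X (k, e))) * (\<Prod>e\<in>E. equi_ratio m \<rho> (\<lambda>k. X (k, \<theta> k e))))
      \<partial>gaussian_on ?K)
    = (\<integral>\<^sup>+ X. (\<integral>\<^sup>+ Z. ?F Z X \<partial>gaussian_on E) * (\<integral>\<^sup>+ W. ?G W X \<partial>gaussian_on E) \<partial>gaussian_on ?K)"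
  proof (rule nn_integral_cong)
    fix X :: "nat \<times> 'e \<Rightarrow> real"
    show "ennreal ((\<Prod>e\<in>E. equi_ratio m \<rho> (\<lambda>k. X (k, e))) * (\<Prod>e\<in>E. equi_ratio m \<rho> (\<lambda>k. X (k, \<theta> k e))))
      = (\<integral>\<^sup>+ Z. ?F Z X \<partial>gaussian_on E) * (\<integral>\<^sup>+ W. ?G W X \<partial>gaussian_on E)"
      using expand[OF s(1,2), of "\<lambda>e k. X (k, e)"] expand[OF s(1,2), of "\<lambda>e k. X (k, \<theta> k e)"]
      by (subst ennreal_mult) (auto simp: s(3) prodE[OF \<rho>] intro!: prod_nonneg equi_ratio_nonneg m \<rho>)
  qed
  also have "\<dots> = (\<integral>\<^sup>+ X. (\<integral>\<^sup>+ Z. (\<integral>\<^sup>+ W. ?F Z X * ?G W X \<partial>gaussian_on E) \<partial>gaussian_on E) \<partial>gaussian_on ?K)"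
  proof (rule nn_integral_cong)
    fix X :: "nat \<times> 'e \<Rightarrow> real" assume "X \<in> space (gaussian_on ?K)"
    show "(\<integral>\<^sup>+ Z. ?F Z X \<partial>gaussian_on E) * (\<integral>\<^sup>+ W. ?G W X \<partial>gaussian_on E)
        = (\<integral>\<^sup>+ Z. (\<integral>\<^sup>+ W. ?F Z X * ?G W X \<partial>gaussian_on E) \<partial>gaussian_on E)"
      by (subst nn_integral_cmult, measurable)+ (subst nn_integral_multc, measurable)
  qed
  also have "\<dots> = (\<integral>\<^sup>+ Z. (\<integral>\<^sup>+ X. (\<integral>\<^sup>+ W. ?F Z X * ?G W X \<partial>gaussian_on E) \<partial>gaussian_on ?K) \<partial>gaussian_on E)"
    by (rule P.Fubini') (measurable, use \<theta>E in auto)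
  also have "\<dots> = (\<integral>\<^sup>+ Z. (\<integral>\<^sup>+ W. (\<integral>\<^sup>+ X. ?F Z X * ?G W X \<partial>gaussian_on ?K) \<partial>gaussian_on E) \<partial>gaussian_on E)"
    by (intro nn_integral_cong P.Fubini') (measurable, use \<theta>E in auto)
  also have "\<dots> = (\<integral>\<^sup>+ Z. (\<integral>\<^sup>+ W. (\<Prod>e\<in>E. \<Prod>k<m. ennreal (mehler \<rho> (W e) (Z (\<theta> k e)))) \<partial>gaussian_on E) \<partial>gaussian_on E)"
  proof (intro nn_integral_cong)
    fix Z W :: "'e \<Rightarrow> real"
    \<comment> \<open>Reindexed through the inverses \<open>\<psi> k\<close>, so that each
      coordinate of \<open>X\<close> meets exactly one factor of \<open>?F\<close> and one of
      \<open>?G\<close>.\<close>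
    have G: "?G W X = (\<Prod>e\<in>E. \<Prod>k<m. ennreal (mehler s (W (\<psi> k e)) (X (k, e))))" for X
    proof -
      have "?G W X = (\<Prod>k<m. \<Prod>e\<in>E. ennreal (mehler s (W (\<psi> k (\<theta> k e))) (X (k, \<theta> k e))))"
        by (subst prod.swap) (simp add: \<psi>)
      also have "\<dots> = (\<Prod>k<m. \<Prod>e\<in>E. ennreal (mehler s (W (\<psi> k e)) (X (k, e))))"
        by (intro prod.cong refl prod.reindex_bij_betw[OF \<theta>, where g = "\<lambda>e. ennreal (mehler s (W (\<psi> _ e)) (X (_, e)))"]) auto
      finally show ?thesis by (simp add: prod.swap[of _ "{..<m}"])
    qed
    have "(\<integral>\<^sup>+ X. ?F Z X * ?G W X \<partial>gaussian_on ?K)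
        = (\<integral>\<^sup>+ X. (\<Prod>p\<in>?K. ennreal (mehler s (Z (snd p)) (X p) * mehler s (W (\<psi> (fst p) (snd p))) (X p))) \<partial>gaussian_on ?K)"
      unfolding G using s1
      by (intro nn_integral_cong)
        (simp add: prod.distrib[symmetric] ennreal_mult[symmetric] prod.swap[of _ "{..<m}"] prod.cartesian_product case_prod_unfold)
    also have "\<dots> = (\<Prod>p\<in>?K. (\<integral>\<^sup>+ x. ennreal (mehler s (Z (snd p)) x * mehler s (W (\<psi> (fst p) (snd p))) x) \<partial>std_normal_distribution))"
      by (intro std_normal.product_nn_integral_prod finK) measurable
    also have "\<dots> = (\<Prod>p\<in>?K. ennreal (mehler \<rho> (Z (snd p)) (W (\<psi> (fst p) (snd p)))))"
      using s s1 by (simp add: mehler_convolution power2_eq_square[symmetric])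
    also have "\<dots> = (\<Prod>k<m. \<Prod>e\<in>E. ennreal (mehler \<rho> (Z e) (W (\<psi> k e))))"
      by (simp add: prod.cartesian_product case_prod_unfold)
    also have "\<dots> = (\<Prod>k<m. \<Prod>e\<in>E. ennreal (mehler \<rho> (Z (\<theta> k e)) (W (\<psi> k (\<theta> k e)))))"
      by (intro prod.cong refl prod.reindex_bij_betw[OF \<theta>, where g = "\<lambda>e. ennreal (mehler \<rho> (Z e) (W (\<psi> _ e)))", symmetric]) auto
    also have "\<dots> = (\<Prod>e\<in>E. \<Prod>k<m. ennreal (mehler \<rho> (W e) (Z (\<theta> k e))))"
      by (subst prod.swap) (simp add: \<psi> mehler_commute)
    finally show "(\<integral>\<^sup>+ X. ?F Z X * ?G W X \<partial>gaussian_on ?K) = (\<Prod>e\<in>E. \<Prod>k<m. ennreal (mehler \<rho> (W e) (Z (\<theta> k e))))" .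
  qed
  also have "\<dots> = (\<integral>\<^sup>+ Z. ennreal (\<Prod>e\<in>E. equi_ratio m (\<rho>\<^sup>2) (\<lambda>k. Z (\<theta> k e))) \<partial>gaussian_on E)"
    using \<rho> by (subst expand) (auto simp: prodE abs_square_less_1)
  finally show ?thesis .
qed

subsection \<open>Densities of the planted law\<close>

text \<open>Product measures are determined by boxes, and on a box the integral of the product
  factors.\<close>

lemma PiM_density:
  fixes f :: "'a \<Rightarrow> ennreal" and I :: "'i set"
  assumes I: "finite I" and N: "sigma_finite_measure N" "sigma_finite_measure (density N f)"
    and f [measurable]: "f \<in> borel_measurable N"
  shows "PiM I (\<lambda>_. density N f) = density (PiM I (\<lambda>_. N)) (\<lambda>x. \<Prod>i\<in>I. f (x i))"
proof -
  interpret L: product_sigma_finite "\<lambda>_ :: 'i. N"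
    by (intro product_sigma_finite.intro N)
  interpret D: product_sigma_finite "\<lambda>_ :: 'i. density N f"
    by (intro product_sigma_finite.intro N)
  show ?thesis
  proof (rule sym, rule D.PiM_eqI[OF I])
    show "sets (density (PiM I (\<lambda>_. N)) (\<lambda>x. \<Prod>i\<in>I. f (x i))) = sets (PiM I (\<lambda>_. density N f))"
      by (simp cong: sets_PiM_cong)
    fix A assume "\<And>i. i \<in> I \<Longrightarrow> A i \<in> sets (density N f)"
    then have A [measurable]: "\<And>i. i \<in> I \<Longrightarrow> A i \<in> sets N" by simp
    have [measurable]: "Pi\<^sub>E I A \<in> sets (PiM I (\<lambda>_. N))"
      using A I by (intro sets_PiM_I_finite) auto
    have "emeasure (density (PiM I (\<lambda>_. N)) (\<lambda>x. \<Prod>i\<in>I. f (x i))) (Pi\<^sub>E I A)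
        = (\<integral>\<^sup>+ x. (\<Prod>i\<in>I. f (x i)) * indicator (Pi\<^sub>E I A) x \<partial>PiM I (\<lambda>_. N))"
      by (subst emeasure_density) auto
    also have "\<dots> = (\<integral>\<^sup>+ x. (\<Prod>i\<in>I. f (x i) * indicator (A i) (x i)) \<partial>PiM I (\<lambda>_. N))"
    proof (rule nn_integral_cong)
      fix x assume "x \<in> space (PiM I (\<lambda>_. N))"
      then have "indicator (Pi\<^sub>E I A) x = (\<Prod>i\<in>I. indicator (A i) (x i) :: ennreal)"
        using I by (auto simp: space_PiM PiE_def Pi_def indicator_def prod_eq_1_iff intro!: prod_zero[symmetric])
      then show "(\<Prod>i\<in>I. f (x i)) * indicator (Pi\<^sub>E I A) x = (\<Prod>i\<in>I. f (x i) * indicator (A i) (x i))"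
        by (simp add: prod.distrib)
    qed
    also have "\<dots> = (\<Prod>i\<in>I. (\<integral>\<^sup>+ y. f y * indicator (A i) y \<partial>N))"
      by (intro L.product_nn_integral_prod I) measurable
    also have "\<dots> = (\<Prod>i\<in>I. emeasure (density N f) (A i))"
      by (intro prod.cong refl) (simp add: emeasure_density)
    finally show "emeasure (density (PiM I (\<lambda>_. N)) (\<lambda>x. \<Prod>i\<in>I. f (x i))) (Pi\<^sub>E I A)
        = (\<Prod>i\<in>I. emeasure (density N f) (A i))" .
  qed
qed

lemma gaussian_on_density:
  assumes "finite I"
  shows "gaussian_on I = density (PiM I (\<lambda>_. lborel)) (\<lambda>x. \<Prod>i\<in>I. ennreal (std_normal_density (x i)))"
  by (intro PiM_density assms lborel.sigma_finite_measure_axioms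
      prob_space_imp_sigma_finite prob_space_std_normal) auto

section \<open>Determinant and inverse of the equicorrelation matrix\<close>

lemma equicorrelation_index:
  "i < m \<Longrightarrow> j < m \<Longrightarrow> equicorrelation m \<rho> $$ (i, j) = (if i = j then 1 else \<rho>)"
  by (simp add: equicorrelation_def)

lemma equicorrelation_carrier: "equicorrelation m \<rho> \<in> carrier_mat m m"
  by (simp add: equicorrelation_def)

lemma index_mult_mat_sum:
  assumes "A \<in> carrier_mat n n" "B \<in> carrier_mat n n" "i < n" "j < n"
  shows "(A * B) $$ (i, j) = (\<Sum>k\<in>{0..<n}. A $$ (i, k) * B $$ (k, j))"
  using assms by (auto simp: scalar_prod_def)

(* With P the identity whose first column is replaced by ones, equicorrelation * P = P * T
   for an upper triangular T. *)
lemma det_equicorrelation: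
  assumes "1 \<le> m"
  shows "Determinant.det (equicorrelation m \<rho>) = equi_norm m \<rho>"
proof -
  define P where "P = Matrix.mat m m (\<lambda>(i, j). if j = 0 \<or> i = j then 1 else (0 :: real))"
  define T where "T = Matrix.mat m m (\<lambda>(i, j).
     if j = 0 then (if i = 0 then 1 + (real m - 1) * \<rho> else 0)
     else if i = j then 1 - \<rho> else if i = 0 then \<rho> else 0)"
  have carrier: "P \<in> carrier_mat m m" "T \<in> carrier_mat m m" by (simp_all add: P_def T_def)
  have row: "(\<Sum>k\<in>{0..<m}. equicorrelation m \<rho> $$ (i, k) * (if j = 0 \<or> k = j then 1 else 0))
      = (if j = 0 then 1 + (real m - 1) * \<rho> else if i = j then 1 else \<rho>)" if "i < m" "j < m" for i j
  proof -
    have "(\<Sum>k\<in>{0..<m}. equicorrelation m \<rho> $$ (i, k)) = (\<Sum>k\<in>{0..<m}. \<rho> + (if k = i then 1 - \<rho> else 0))"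
      using that by (intro sum.cong refl) (auto simp: equicorrelation_index)
    also have "\<dots> = 1 + (real m - 1) * \<rho>"
      using that by (simp add: sum.distrib algebra_simps)
    finally show ?thesis
      using that by (auto simp: if_distrib[of "\<lambda>x. _ * x"] equicorrelation_index cong: if_cong)
  qed
  have col: "(\<Sum>k\<in>{0..<m}. (if k = 0 \<or> i = k then 1 else 0) * T $$ (k, j))
      = (if j = 0 then 1 + (real m - 1) * \<rho> else if i = j then 1 else \<rho>)" if "i < m" "j < m" for i j
  proof -
    have "(\<Sum>k\<in>{0..<m}. (if k = 0 \<or> i = k then 1 else 0) * T $$ (k, j))
        = (\<Sum>k\<in>insert 0 {i}. T $$ (k, j))"
      using that by (intro sum.mono_neutral_cong_right) auto
    then show ?thesis using that by (cases "i = 0") (auto simp: T_def)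
  qed
  have eq: "equicorrelation m \<rho> * P = P * T"
  proof (rule eq_matI)
    fix i j assume "i < dim_row (P * T)" "j < dim_col (P * T)"
    then have ij: "i < m" "j < m" by (simp_all add: P_def T_def)
    have "(equicorrelation m \<rho> * P) $$ (i, j) = (\<Sum>k\<in>{0..<m}. equicorrelation m \<rho> $$ (i, k) * P $$ (k, j))"
      by (rule index_mult_mat_sum[OF equicorrelation_carrier carrier(1) ij])
    also have "\<dots> = (\<Sum>k\<in>{0..<m}. equicorrelation m \<rho> $$ (i, k) * (if j = 0 \<or> k = j then 1 else 0))"
      using ij by (intro sum.cong refl) (simp add: P_def)
    also have "\<dots> = (\<Sum>k\<in>{0..<m}. (if k = 0 \<or> i = k then 1 else 0) * T $$ (k, j))"
      using row[OF ij] col[OF ij] by simp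
    also have "\<dots> = (\<Sum>k\<in>{0..<m}. P $$ (i, k) * T $$ (k, j))"
      using ij by (intro sum.cong refl) (simp add: P_def)
    also have "\<dots> = (P * T) $$ (i, j)"
      by (rule index_mult_mat_sum[OF carrier ij, symmetric])
    finally show "(equicorrelation m \<rho> * P) $$ (i, j) = (P * T) $$ (i, j)" .
  qed (use carrier equicorrelation_carrier[of m \<rho>] in auto)
  have "Determinant.det P = (\<Prod>i\<in>{0..<m}. P $$ (i, i))"
    using carrier by (subst det_lower_triangular[of m]) (auto simp: P_def prod_list_diag_prod)
  then have detP: "Determinant.det P = 1" by (simp add: P_def)
  have "Determinant.det T = (\<Prod>i\<in>{0..<m}. T $$ (i, i))"
    using carrier by (subst det_upper_triangular[of _ m]) (auto simp: T_def prod_list_diag_prod upper_triangular_def)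
  also have "\<dots> = T $$ (0, 0) * (\<Prod>i\<in>{0..<m} - {0}. T $$ (i, i))"
    using assms by (intro prod.remove) auto
  also have "(\<Prod>i\<in>{0..<m} - {0}. T $$ (i, i)) = (\<Prod>i\<in>{0..<m} - {0}. 1 - \<rho>)"
    by (intro prod.cong) (auto simp: T_def)
  also have "T $$ (0, 0) * (\<Prod>i\<in>{0..<m} - {0}. 1 - \<rho>) = equi_norm m \<rho>"
    using assms by (simp add: T_def equi_norm_def)
  finally have detT: "Determinant.det T = equi_norm m \<rho>" .
  have "Determinant.det (equicorrelation m \<rho>) * Determinant.det P = Determinant.det P * Determinant.det T"
    using eq carrier by (metis det_mult equicorrelation_carrier)
  then show ?thesis by (simp add: detP detT)
qed

text \<open>The result of \<open>mat_inverse\<close> comes from Gauss-Jordan elimination and is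
  identified by uniqueness instead of being computed. The matrix \<open>B\<close> is a right inverse
  by direct calculation, the nonzero determinant guarantees some left inverse \<open>C\<close>, and
  then \<open>C = C * (A * B) = B\<close>.\<close>

lemma mat_inverse_equicorrelation:
  assumes "1 \<le> m" "0 \<le> \<rho>" "\<rho> < 1"
  shows "mat_inverse (equicorrelation m \<rho>)
    = Some (Matrix.mat m m (\<lambda>(i, j). (if i = j then 1 / (1 - \<rho>) else 0) - equi_slope m \<rho>))"
proof -
  let ?A = "equicorrelation m \<rho>"
  define B where "B = Matrix.mat m m (\<lambda>(i, j). (if i = j then 1 / (1 - \<rho>) else 0) - equi_slope m \<rho>)"
  have B: "B \<in> carrier_mat m m" by (simp add: B_def)
  define d where "d = 1 + (real m - 1) * \<rho>"
  have d: "0 < d" unfolding d_def using assms by (intro add_pos_nonneg) auto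
  have AB: "?A * B = 1\<^sub>m m"
  proof (rule eq_matI)
    fix i j assume "i < dim_row (1\<^sub>m m :: real mat)" "j < dim_col (1\<^sub>m m :: real mat)"
    then have ij: "i < m" "j < m" by simp_all
    have "(?A * B) $$ (i, j) = (\<Sum>k\<in>{0..<m}. ?A $$ (i, k) * B $$ (k, j))"
      by (rule index_mult_mat_sum[OF equicorrelation_carrier B ij])
    also have "\<dots> = (\<Sum>k\<in>{0..<m}. ((if k = i then 1 - \<rho> else 0) + \<rho>) * ((if k = j then 1 / (1 - \<rho>) else 0) - equi_slope m \<rho>))"
      using ij by (intro sum.cong refl) (auto simp: equicorrelation_index B_def)
    also have "\<dots> = (\<Sum>k\<in>{0..<m}. (if k = i then (if i = j then 1 else 0) - (1 - \<rho>) * equi_slope m \<rho> else 0)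
        + (if k = j then \<rho> / (1 - \<rho>) else 0) - \<rho> * equi_slope m \<rho>)"
    proof (intro sum.cong refl)
      fix k
      have "((if k = i then a else 0) + \<rho>) * ((if k = j then 1 / a else 0) - s)
        = (if k = i then (if i = j then 1 else 0) - a * s else 0) + (if k = j then \<rho> / a else 0) - \<rho> * s"
        if "a \<noteq> 0" for a s
        using that by (cases "k = i"; cases "k = j"; cases "i = j") (simp_all add: algebra_simps add_divide_distrib)
      from this[of "1 - \<rho>"] show "((if k = i then 1 - \<rho> else 0) + \<rho>) * ((if k = j then 1 / (1 - \<rho>) else 0) - equi_slope m \<rho>)
        = (if k = i then (if i = j then 1 else 0) - (1 - \<rho>) * equi_slope m \<rho> else 0)
          + (if k = j then \<rho> / (1 - \<rho>) else 0) - \<rho> * equi_slope m \<rho>"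
        using assms by simp
    qed
    also have "\<dots> = (if i = j then 1 else 0) - (1 - \<rho>) * equi_slope m \<rho> + \<rho> / (1 - \<rho>) - m * (\<rho> * equi_slope m \<rho>)"
      using ij by (simp add: sum.distrib sum_subtractf)
    also have "\<dots> = (if i = j then 1 else 0) + (\<rho> / (1 - \<rho>) - d * equi_slope m \<rho>)"
      by (simp add: d_def algebra_simps)
    also have "\<rho> / (1 - \<rho>) - d * equi_slope m \<rho> = 0"
      using d assms by (simp add: equi_slope_def d_def[symmetric])
    finally show "(?A * B) $$ (i, j) = 1\<^sub>m m $$ (i, j)" using ij by simp
  qed (use B equicorrelation_carrier[of m \<rho>] in auto)
  have "Determinant.det ?A \<noteq> 0"
    using det_equicorrelation[OF assms(1), of \<rho>] equi_norm_pos[OF assms] by simp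
  then have "?A \<in> Units (ring_mat TYPE(real) m ())"
    by (rule det_non_zero_imp_unit[OF equicorrelation_carrier])
  then obtain C where C: "mat_inverse ?A = Some C"
    using mat_inverse(1)[OF equicorrelation_carrier, where b = "()"] by (cases "mat_inverse ?A") auto
  then have C': "C * ?A = 1\<^sub>m m" "C \<in> carrier_mat m m"
    using mat_inverse(2)[OF equicorrelation_carrier] by blast+
  have "C = C * (?A * B)" using C' AB by simp
  also have "\<dots> = C * ?A * B"
    using assoc_mult_mat[OF C'(2) equicorrelation_carrier B] by simp
  also have "\<dots> = B" using C' B by simp
  finally show ?thesis using C by (simp add: B_def)
qed

lemma centered_gaussian_equicorrelation:
  assumes "1 \<le> m" "0 \<le> \<rho>" "\<rho> < 1"
  shows "centered_gaussian m (equicorrelation m \<rho>) = density (gaussian_on {..<m}) (\<lambda>x. ennreal (equi_ratio m \<rho> x))"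
proof -
  let ?f = "\<lambda>x. let v = Matrix.vec m x in
        ennreal (exp (- scalar_prod v (the (mat_inverse (equicorrelation m \<rho>)) *\<^sub>v v) / 2)
                 / sqrt ((2 * pi) ^ m * Determinant.det (equicorrelation m \<rho>)))"
  have f: "?f x = (\<Prod>i<m. ennreal (std_normal_density (x i))) * ennreal (equi_ratio m \<rho> x)" for x
  proof -
    define S T where "S = (\<Sum>k<m. x k)" and "T = (\<Sum>k<m. (x k)\<^sup>2)"
    let ?v = "Matrix.vec m x"
    have "scalar_prod ?v (the (mat_inverse (equicorrelation m \<rho>)) *\<^sub>v ?v)
       = (\<Sum>i<m. x i * (\<Sum>j<m. ((if i = j then 1 / (1 - \<rho>) else 0) - equi_slope m \<rho>) * x j))"
      unfolding mat_inverse_equicorrelation[OF assms]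
      by (simp add: scalar_prod_def lessThan_atLeast0)
    also have "\<dots> = (\<Sum>i<m. x i * (x i / (1 - \<rho>) - equi_slope m \<rho> * S))"
      by (intro sum.cong refl)
        (simp add: left_diff_distrib sum_subtractf S_def sum_distrib_left[symmetric] if_distrib[of "\<lambda>y. y * _"] cong: if_cong)
    also have "\<dots> = T / (1 - \<rho>) - equi_slope m \<rho> * S\<^sup>2"
      by (simp add: right_diff_distrib sum_subtractf T_def S_def power2_eq_square sum_divide_distrib
          sum_distrib_right sum_distrib_left mult_ac)
    finally have quad: "scalar_prod ?v (the (mat_inverse (equicorrelation m \<rho>)) *\<^sub>v ?v)
        = T / (1 - \<rho>) - equi_slope m \<rho> * S\<^sup>2" .
    have std: "(\<Prod>i<m. std_normal_density (x i)) = exp (- (T / 2)) / sqrt ((2 * pi) ^ m)"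
      unfolding std_normal_density_def real_sqrt_power
      by (simp add: prod_dividef exp_sum[symmetric] T_def sum_divide_distrib[symmetric] sum_negf)
    have "exp (- (T / (1 - \<rho>) - equi_slope m \<rho> * S\<^sup>2) / 2) / sqrt ((2 * pi) ^ m * equi_norm m \<rho>)
        = (exp (- (T / 2)) / sqrt ((2 * pi) ^ m)) * equi_ratio m \<rho> x"
    proof -
      have "- (T / (1 - \<rho>) - equi_slope m \<rho> * S\<^sup>2) / 2 = - (T / 2) + (equi_slope m \<rho> * S\<^sup>2 - \<rho> / (1 - \<rho>) * T) / 2"
        using assms by (simp add: field_simps)
      then have "exp (- (T / (1 - \<rho>) - equi_slope m \<rho> * S\<^sup>2) / 2)
          = exp (- (T / 2)) * exp ((equi_slope m \<rho> * S\<^sup>2 - \<rho> / (1 - \<rho>) * T) / 2)"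
        by (simp only: exp_add)
      then show ?thesis
        unfolding equi_ratio_def S_def[symmetric] T_def[symmetric]
        by (simp only: real_sqrt_mult times_divide_times_eq)
    qed
    moreover have "(\<Prod>i<m. ennreal (std_normal_density (x i))) = ennreal (exp (- (T / 2)) / sqrt ((2 * pi) ^ m))"
      unfolding std[symmetric] by (simp add: prod_ennreal)
    moreover have "ennreal (exp (- (T / 2)) / sqrt ((2 * pi) ^ m)) * ennreal (equi_ratio m \<rho> x)
        = ennreal ((exp (- (T / 2)) / sqrt ((2 * pi) ^ m)) * equi_ratio m \<rho> x)"
      using equi_ratio_nonneg[OF assms] by (intro ennreal_mult[symmetric]) auto
    ultimately show ?thesis
      unfolding Let_def quad det_equicorrelation[OF assms(1)] by (simp only:)
  qed
  have "centered_gaussian m (equicorrelation m \<rho>) = density (PiM {..<m} (\<lambda>_. lborel))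
      (\<lambda>x. (\<Prod>i<m. ennreal (std_normal_density (x i))) * ennreal (equi_ratio m \<rho> x))"
    unfolding centered_gaussian_def f ..
  also have "\<dots> = density (density (PiM {..<m} (\<lambda>_. lborel)) (\<lambda>x. \<Prod>i<m. ennreal (std_normal_density (x i))))
      (\<lambda>x. ennreal (equi_ratio m \<rho> x))"
    by (rule density_density_eq[symmetric]) measurable
  also have "\<dots> = density (gaussian_on {..<m}) (\<lambda>x. ennreal (equi_ratio m \<rho> x))"
    by (simp only: gaussian_on_density[OF finite_lessThan])
  finally show ?thesis .
qed

section \<open>Vertex permutations acting on edges and on the data\<close>

declare One_nat_def [simp del]

lemma finite_edges [simp]: "finite (edges n)"
  by (simp add: nsets_def)

lemma permutes_image_edges:
  assumes "\<tau> permutes {1..n}" "e \<in> edges n"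
  shows "\<tau> ` e \<in> edges n"
proof -
  have "\<tau> ` e \<subseteq> \<tau> ` {1..n}" using assms(2) by (intro image_mono) (auto simp: nsets_def)
  then show ?thesis
    using assms(2) by (simp add: permutes_image[OF assms(1)] nsets_def card_image[OF permutes_inj_on[OF assms(1)]])
qed

lemma inv_image_image:
  assumes "\<tau> permutes A"
  shows "inv_into UNIV \<tau> ` \<tau> ` e = e" "\<tau> ` inv_into UNIV \<tau> ` e = e"
  using permutes_inverses[OF assms] by (auto simp: image_image)

lemma bij_betw_image_edges:
  assumes "\<tau> permutes {1..n}"
  shows "bij_betw ((`) \<tau>) (edges n) (edges n)"
  using assms permutes_inv[OF assms]
  by (intro bij_betw_byWitness[where f' = "(`) (inv_into UNIV \<tau>)"])
    (auto simp: inv_image_image permutes_image_edges)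

lemma sets_null_law: "sets (null_law m n) = sets (data_space m n)"
  unfolding null_law_def data_space_def by (intro sets_PiM_cong) auto

lemma null_law_gaussian: "null_law m n = gaussian_on ({..<m} \<times> edges n)"
  by (simp add: null_law_def)

lemma prob_space_null_law: "prob_space (null_law m n)"
  unfolding null_law_def by (intro prob_space_PiM prob_space_std_normal)

text \<open>Aligns the data: under the planted law given \<pi>, the permuted data have the law that
  belongs to the tuple of identities.\<close>

definition permuted :: "nat \<Rightarrow> nat \<Rightarrow> (nat \<Rightarrow> nat \<Rightarrow> nat) \<Rightarrow> (nat \<times> nat set \<Rightarrow> real) \<Rightarrow> (nat \<times> nat set \<Rightarrow> real)" where
  "permuted m n \<pi> X = (\<lambda>(k, e)\<in>{..<m} \<times> edges n. X (k, \<pi> k ` e))"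

lemma permuted_apply: "k < m \<Longrightarrow> e \<in> edges n \<Longrightarrow> permuted m n \<pi> X (k, e) = X (k, \<pi> k ` e)"
  by (simp add: permuted_def)

text \<open>The edges are permuted within each copy, so this only reindexes independent coordinates
  with the same law.\<close>

lemma permuted_null_law:
  assumes "\<And>k. k < m \<Longrightarrow> \<pi> k permutes {1..n}"
  shows "distr (null_law m n) (null_law m n) (permuted m n \<pi>) = null_law m n"
proof -
  let ?I = "{..<m} \<times> edges n"
  have "inj_on (\<lambda>(k, e). (k, \<pi> k ` e)) ?I"
    using bij_betw_image_edges[OF assms] by (auto simp: inj_on_def bij_betw_def)
  moreover have "(\<lambda>(k, e). (k, \<pi> k ` e)) \<in> ?I \<rightarrow> ?I"
    using permutes_image_edges[OF assms] by auto
  ultimately have "distr (gaussian_on ?I) (gaussian_on ?I) (\<lambda>\<omega>. \<lambda>p\<in>?I. \<omega> ((\<lambda>(k, e). (k, \<pi> k ` e)) p)) = gaussian_on ?I"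
    by (rule distr_PiM_reindex[OF prob_space_std_normal])
  moreover have "(\<lambda>\<omega>. \<lambda>p\<in>?I. \<omega> ((\<lambda>(k, e). (k, \<pi> k ` e)) p)) = permuted m n \<pi>"
    by (auto simp: permuted_def fun_eq_iff)
  ultimately show ?thesis by (simp add: null_law_gaussian)
qed

lemma measurable_permuted [measurable]:
  assumes "\<And>k. k < m \<Longrightarrow> \<pi> k permutes {1..n}"
  shows "permuted m n \<pi> \<in> null_law m n \<rightarrow>\<^sub>M null_law m n"
  unfolding permuted_def null_law_def
proof (rule measurable_restrict)
  fix p assume "p \<in> {..<m} \<times> edges n"
  then have "(fst p, \<pi> (fst p) ` snd p) \<in> {..<m} \<times> edges n"
    using permutes_image_edges[OF assms] by auto
  then show "(\<lambda>x. case p of (k, e) \<Rightarrow> x (k, \<pi> k ` e)) \<in> gaussian_on ({..<m} \<times> edges n) \<rightarrow>\<^sub>M std_normal_distribution"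
    unfolding case_prod_unfold by (rule measurable_component_singleton)
qed

lemma sets_centered_gaussian [measurable_cong]: "sets (centered_gaussian d \<Sigma>) = sets (PiM {..<d} (\<lambda>_. borel))"
  unfolding centered_gaussian_def sets_density by (intro sets_PiM_cong) auto

text \<open>Stated for arbitrary \<pi>, because the kernel in \<open>planted_law\<close> has to be a
  probability measure at every point of the function type and not only at tuples of
  permutations.\<close>

lemma measurable_reassemble:
  "(\<lambda>Y. \<lambda>(k, e)\<in>{..<m} \<times> edges n. Y (inv_into UNIV (\<pi> k) ` e) k)
     \<in> PiM (edges n) (\<lambda>_. centered_gaussian m \<Sigma>) \<rightarrow>\<^sub>M data_space m n"
  unfolding data_space_def
proof (rule measurable_restrict)
  fix p assume "p \<in> {..<m} \<times> edges n"
  then obtain k e where p: "p = (k, e)" and k: "k < m" by auto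
  have "(\<lambda>Y. Y (inv_into UNIV (\<pi> k) ` e) k) \<in> borel_measurable (PiM (edges n) (\<lambda>_. centered_gaussian m \<Sigma>))"
  proof (cases "inv_into UNIV (\<pi> k) ` e \<in> edges n")
    case True
    have "(\<lambda>y. y k) \<in> borel_measurable (centered_gaussian m \<Sigma>)"
      unfolding measurable_cong_sets[OF sets_centered_gaussian refl]
      using k by (intro measurable_component_singleton) auto
    then show ?thesis using True
      by (intro measurable_compose[OF measurable_component_singleton[OF True]])
  next
    \<comment> \<open>Outside \<open>edges n\<close> the function \<open>Y\<close> takes its default
      value \<open>undefined\<close>, so the coordinate is constant.\<close>
    case False
    then have "Y (inv_into UNIV (\<pi> k) ` e) k = undefined k"
      if "Y \<in> space (PiM (edges n) (\<lambda>_. centered_gaussian m \<Sigma>))" for Y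
      using that by (auto simp: space_PiM PiE_def extensional_def)
    then show ?thesis by (subst measurable_cong[where g = "\<lambda>_. undefined k"]) auto
  qed
  then show "(\<lambda>Y. case p of (k, e) \<Rightarrow> Y (inv_into UNIV (\<pi> k) ` e) k)
      \<in> borel_measurable (PiM (edges n) (\<lambda>_. centered_gaussian m \<Sigma>))"
    by (simp add: p)
qed

lemma prob_space_equicorrelated:
  assumes "1 \<le> m" "0 \<le> \<rho>" "\<rho> < 1"
  shows "prob_space (centered_gaussian m (equicorrelation m \<rho>))"
  unfolding centered_gaussian_equicorrelation[OF assms]
  by (rule prob_spaceI) (simp add: emeasure_density equi_ratio_integral[OF assms] cong: nn_integral_cong)

lemma prob_space_planted_law_given:
  assumes "1 \<le> m" "0 \<le> \<rho>" "\<rho> < 1"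
  shows "prob_space (planted_law_given m n \<rho> \<pi>)"
  unfolding planted_law_given_def
  by (intro prob_space.prob_space_distr prob_space_PiM prob_space_equicorrelated assms measurable_reassemble)

lemma sets_planted_law_given: "sets (planted_law_given m n \<rho> \<pi>) = sets (data_space m n)"
  by (simp add: planted_law_given_def)

definition likelihood :: "nat \<Rightarrow> nat \<Rightarrow> real \<Rightarrow> (nat \<Rightarrow> nat \<Rightarrow> nat) \<Rightarrow> (nat \<times> nat set \<Rightarrow> real) \<Rightarrow> real" where
  "likelihood m n \<rho> \<pi> X = (\<Prod>e\<in>edges n. equi_ratio m \<rho> (\<lambda>k. X (k, \<pi> k ` e)))"

lemma likelihood_nonneg: "1 \<le> m \<Longrightarrow> 0 \<le> \<rho> \<Longrightarrow> \<rho> < 1 \<Longrightarrow> 0 \<le> likelihood m n \<rho> \<pi> X"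
  unfolding likelihood_def by (intro prod_nonneg equi_ratio_nonneg) auto

lemma measurable_likelihood [measurable]:
  assumes "\<And>k. k < m \<Longrightarrow> \<pi> k permutes {1..n}"
  shows "likelihood m n \<rho> \<pi> \<in> borel_measurable (null_law m n)"
  unfolding likelihood_def null_law_def
  by (intro borel_measurable_prod measurable_equi_ratio)
    (use permutes_image_edges[OF assms] in \<open>auto intro!: measurable_component_singleton\<close>)

text \<open>It suffices to compare boxes. The preimage of a box is a product over the edges of
  boxes, whose sides are those of the given box permuted by \<pi>; the edge bijections then only
  reorder the factors.\<close>

lemma reassemble_gaussian:
  assumes \<pi>: "\<And>k. k < m \<Longrightarrow> \<pi> k permutes {1..n}"
  shows "distr (PiM (edges n) (\<lambda>_. gaussian_on {..<m})) (null_law m n)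
      (\<lambda>Y. \<lambda>(k, e)\<in>{..<m} \<times> edges n. Y (inv_into UNIV (\<pi> k) ` e) k) = null_law m n"
    (is "distr ?G _ ?\<Phi> = _")
  unfolding null_law_def
proof (rule std_normal.PiM_eqI)
  interpret G: product_sigma_finite "\<lambda>_ :: nat set. gaussian_on {..<m}"
    by (intro product_sigma_finite.intro std_normal.sigma_finite) simp
  have inv_edges: "inv_into UNIV (\<pi> k) ` e \<in> edges n" if "k < m" "e \<in> edges n" for k e
    using permutes_image_edges[OF permutes_inv[OF \<pi>[OF that(1)]] that(2)] .
  have meas: "?\<Phi> \<in> ?G \<rightarrow>\<^sub>M gaussian_on ({..<m} \<times> edges n)"
  proof (rule measurable_restrict)
    fix p assume "p \<in> {..<m} \<times> edges n"
    then obtain k e where p: "p = (k, e)" and ke: "k < m" "e \<in> edges n" by auto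
    have "(\<lambda>Y. Y (inv_into UNIV (\<pi> k) ` e) k) \<in> ?G \<rightarrow>\<^sub>M std_normal_distribution"
      using ke by (intro measurable_compose[OF measurable_component_singleton[OF inv_edges]]
          measurable_component_singleton) auto
    then show "(\<lambda>Y. case p of (k, e) \<Rightarrow> Y (inv_into UNIV (\<pi> k) ` e) k) \<in> ?G \<rightarrow>\<^sub>M std_normal_distribution"
      by (simp add: p)
  qed
  fix A :: "nat \<times> nat set \<Rightarrow> real set"
  assume A: "\<And>p. p \<in> {..<m} \<times> edges n \<Longrightarrow> A p \<in> sets std_normal_distribution"
  have "Pi\<^sub>E ({..<m} \<times> edges n) A \<in> sets (gaussian_on ({..<m} \<times> edges n))"
    using A by (intro sets_PiM_I_finite) auto
  then have "emeasure (distr ?G (gaussian_on ({..<m} \<times> edges n)) ?\<Phi>) (Pi\<^sub>E ({..<m} \<times> edges n) A)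
      = emeasure ?G (?\<Phi> -` Pi\<^sub>E ({..<m} \<times> edges n) A \<inter> space ?G)"
    by (rule emeasure_distr[OF meas])
  also have "?\<Phi> -` Pi\<^sub>E ({..<m} \<times> edges n) A \<inter> space ?G
      = (\<Pi>\<^sub>E e\<in>edges n. \<Pi>\<^sub>E k\<in>{..<m}. A (k, \<pi> k ` e))"
  proof (intro equalityI subsetI)
    fix Y assume Y: "Y \<in> ?\<Phi> -` Pi\<^sub>E ({..<m} \<times> edges n) A \<inter> space ?G"
    have "Y e k \<in> A (k, \<pi> k ` e)" if "k < m" "e \<in> edges n" for k e
    proof -
      have "(k, \<pi> k ` e) \<in> {..<m} \<times> edges n"
        using permutes_image_edges[OF \<pi>[OF that(1)] that(2)] that by simp
      then have "?\<Phi> Y (k, \<pi> k ` e) \<in> A (k, \<pi> k ` e)" 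
        using PiE_mem[of "?\<Phi> Y" "{..<m} \<times> edges n" A "(k, \<pi> k ` e)"] Y by (simp only: vimage_eq Int_iff)
      moreover have "?\<Phi> Y (k, \<pi> k ` e) = Y (inv_into UNIV (\<pi> k) ` \<pi> k ` e) k"
        using that permutes_image_edges[OF \<pi>[OF that(1)] that(2)] by simp
      ultimately show ?thesis by (simp only: inv_image_image(1)[OF \<pi>[OF that(1)]])
    qed
    moreover have "Y \<in> space ?G" using Y by simp
    then have "Y \<in> extensional (edges n)" "\<And>e. e \<in> edges n \<Longrightarrow> Y e \<in> extensional {..<m}"
      unfolding space_PiM PiE_def Pi_def by blast+
    ultimately show "Y \<in> (\<Pi>\<^sub>E e\<in>edges n. \<Pi>\<^sub>E k\<in>{..<m}. A (k, \<pi> k ` e))"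
      unfolding PiE_def Pi_def by blast
  next
    fix Y assume Y: "Y \<in> (\<Pi>\<^sub>E e\<in>edges n. \<Pi>\<^sub>E k\<in>{..<m}. A (k, \<pi> k ` e))"
    have "Y (inv_into UNIV (\<pi> k) ` e) k \<in> A (k, e)" if "k < m" "e \<in> edges n" for k e
      using PiE_mem[OF PiE_mem[OF Y inv_edges[OF that]], of k] that
      unfolding inv_image_image(2)[OF \<pi>[OF that(1)]] by simp
    then have "?\<Phi> Y \<in> Pi\<^sub>E ({..<m} \<times> edges n) A" by auto
    moreover have "Y \<in> space ?G"
      using Y unfolding space_PiM PiE_def Pi_def by auto
    ultimately show "Y \<in> ?\<Phi> -` Pi\<^sub>E ({..<m} \<times> edges n) A \<inter> space ?G" by simp
  qed
  also have "emeasure ?G (\<Pi>\<^sub>E e\<in>edges n. \<Pi>\<^sub>E k\<in>{..<m}. A (k, \<pi> k ` e))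
      = (\<Prod>e\<in>edges n. emeasure (gaussian_on {..<m}) (\<Pi>\<^sub>E k\<in>{..<m}. A (k, \<pi> k ` e)))"
    using A permutes_image_edges[OF \<pi>]
    by (intro G.emeasure_PiM sets_PiM_I_finite) auto
  also have "\<dots> = (\<Prod>e\<in>edges n. \<Prod>k<m. emeasure std_normal_distribution (A (k, \<pi> k ` e)))"
    using A permutes_image_edges[OF \<pi>]
    by (intro prod.cong refl std_normal.emeasure_PiM) auto
  also have "\<dots> = (\<Prod>k<m. \<Prod>e\<in>edges n. emeasure std_normal_distribution (A (k, \<pi> k ` e)))"
    by (rule prod.swap)
  also have "\<dots> = (\<Prod>k<m. \<Prod>e\<in>edges n. emeasure std_normal_distribution (A (k, e)))"
    by (intro prod.cong refl prod.reindex_bij_betw[OF bij_betw_image_edges[OF \<pi>],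
          where g = "\<lambda>e. emeasure std_normal_distribution (A (_, e))"]) auto
  also have "\<dots> = (\<Prod>p\<in>{..<m} \<times> edges n. emeasure std_normal_distribution (A p))"
    by (simp add: prod.cartesian_product case_prod_unfold)
  finally show "emeasure (distr ?G (gaussian_on ({..<m} \<times> edges n)) ?\<Phi>) (Pi\<^sub>E ({..<m} \<times> edges n) A)
      = (\<Prod>p\<in>{..<m} \<times> edges n. emeasure std_normal_distribution (A p))" .
qed (simp_all only: sets_distr finite_cartesian_product finite_lessThan finite_edges)

text \<open>Coordinate \<open>k\<close> of \<open>Y e\<close> reappears in the data at the image of
  \<open>e\<close> under \<open>\<pi> k\<close>, so the density of the Gaussian array is a function
  of the reassembled data and can be moved through the map. The reference measure is then identified
  by \<open>reassemble_gaussian\<close>.\<close>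

lemma planted_law_given_density:
  assumes m: "1 \<le> m" and \<rho>: "0 \<le> \<rho>" "\<rho> < 1"
    and \<pi>: "\<And>k. k < m \<Longrightarrow> \<pi> k permutes {1..n}"
  shows "planted_law_given m n \<rho> \<pi> = density (null_law m n) (\<lambda>X. ennreal (likelihood m n \<rho> \<pi> X))"
proof -
  let ?\<Phi> = "\<lambda>Y :: nat set \<Rightarrow> nat \<Rightarrow> real. \<lambda>(k, e)\<in>{..<m} \<times> edges n. Y (inv_into UNIV (\<pi> k) ` e) k"
  let ?G = "PiM (edges n) (\<lambda>_. gaussian_on {..<m})"
  have sig: "sigma_finite_measure (gaussian_on {..<m})" by (rule std_normal.sigma_finite) simp
  have "sigma_finite_measure (centered_gaussian m (equicorrelation m \<rho>))"
    by (intro prob_space_imp_sigma_finite prob_space_equicorrelated m \<rho>)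
  then have dens: "PiM (edges n) (\<lambda>_. centered_gaussian m (equicorrelation m \<rho>))
      = density ?G (\<lambda>Y. \<Prod>e\<in>edges n. ennreal (equi_ratio m \<rho> (Y e)))"
    unfolding centered_gaussian_equicorrelation[OF m \<rho>]
    by (intro PiM_density sig) auto
  have \<Phi>: "?\<Phi> \<in> ?G \<rightarrow>\<^sub>M null_law m n"
    using measurable_reassemble[where m = m and n = n and \<pi> = \<pi> and \<Sigma> = "equicorrelation m \<rho>"]
    unfolding dens by (simp add: measurable_cong_sets[OF refl sets_null_law])
  have L: "(\<Prod>e\<in>edges n. ennreal (equi_ratio m \<rho> (Y e))) = ennreal (likelihood m n \<rho> \<pi> (?\<Phi> Y))" for Y
    unfolding likelihood_def
    using permutes_image_edges[OF \<pi>] inv_image_image[OF \<pi>] equi_ratio_nonneg[OF m \<rho>]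
    by (subst prod_ennreal[symmetric]) (auto intro!: prod.cong arg_cong[where f = ennreal] equi_ratio_cong)
  have "planted_law_given m n \<rho> \<pi> = distr (density ?G (\<lambda>Y. ennreal (likelihood m n \<rho> \<pi> (?\<Phi> Y)))) (null_law m n) ?\<Phi>"
    unfolding planted_law_given_def dens L by (rule distr_cong) (auto simp: sets_null_law)
  also have "\<dots> = density (distr ?G (null_law m n) ?\<Phi>) (\<lambda>X. ennreal (likelihood m n \<rho> \<pi> X))"
    by (rule density_distr[symmetric, OF _ \<Phi>]) (use \<pi> in measurable)
  also have "\<dots> = density (null_law m n) (\<lambda>X. ennreal (likelihood m n \<rho> \<pi> X))"
    by (simp add: reassemble_gaussian[OF \<pi>])
  finally show ?thesis .
qed

section \<open>The uniform law on latent tuples\<close>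

definition latents :: "nat \<Rightarrow> nat \<Rightarrow> (nat \<Rightarrow> nat \<Rightarrow> nat) set" where
  "latents m n = PiE_dflt {..<m} id (\<lambda>k. if k = 0 then {id} else {\<tau>. \<tau> permutes {1..n}})"

lemma latents_permutes: "\<pi> \<in> latents m n \<Longrightarrow> k < m \<Longrightarrow> \<pi> k permutes {1..n}"
  by (auto simp: latents_def PiE_dflt_def permutes_id split: if_splits)

lemma finite_latents [simp]: "finite (latents m n)"
  unfolding latents_def by (intro finite_PiE_dflt) (auto simp: finite_permutations)

lemma id_in_latents: "(\<lambda>_. id) \<in> latents m n"
  by (auto simp: latents_def PiE_dflt_def permutes_id)

lemma card_latents_pos: "0 < card (latents m n)"
  using id_in_latents by (auto simp: card_gt_0_iff)

text \<open>The identity in copy 0 is a uniform choice from a singleton, so all factors are uniform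
  and their product is uniform on a product set. Expectations over latent tuples become finite
  averages.\<close>

lemma latent_pmf_latents: "latent_pmf m n = pmf_of_set (latents m n)"
proof -
  let ?B = "\<lambda>k :: nat. if k = 0 then {id} else {\<tau>. \<tau> permutes {1..n}}"
  have eq: "(\<lambda>k :: nat. if k = 0 then return_pmf id else pmf_of_set {\<tau>. \<tau> permutes {1..n}}) = (\<lambda>k. pmf_of_set (?B k))"
    by (auto simp: fun_eq_iff pmf_of_set_singleton)
  have nonempty: "?B k \<noteq> {}" for k
  proof (cases "k = 0")
    case False
    have "(id :: nat \<Rightarrow> nat) \<in> {\<tau>. \<tau> permutes {1..n}}" by (simp add: permutes_id)
    then show ?thesis using False by (metis empty_iff)
  qed simp
  have "finite (?B k)" for k by (simp add: finite_permutations)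
  then show ?thesis
    unfolding latent_pmf_def latents_def eq by (rule Pi_pmf_of_set[OF finite_lessThan _ nonempty])
qed

lemma
  assumes "1 \<le> m" "0 \<le> \<rho>" "\<rho> < 1"
  shows sets_planted_law: "sets (planted_law m n \<rho>) = sets (data_space m n)"
    and prob_space_planted_law: "prob_space (planted_law m n \<rho>)"
    and emeasure_planted_law: "A \<in> sets (data_space m n) \<Longrightarrow>
      emeasure (planted_law m n \<rho>) A = (\<Sum>\<pi>\<in>latents m n. emeasure (planted_law_given m n \<rho> \<pi>) A) / card (latents m n)"
proof -
  \<comment> \<open>The source is discrete, so measurability in \<pi> is automatic; what has to be
    known is that every \<pi> yields a probability measure.\<close>
  have K: "planted_law_given m n \<rho> \<in> measure_pmf (latent_pmf m n) \<rightarrow>\<^sub>M prob_algebra (data_space m n)"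
    by (simp add: space_prob_algebra sets_planted_law_given prob_space_planted_law_given[OF assms])
  have P: "measure_pmf (latent_pmf m n) \<in> space (prob_algebra (count_space UNIV))"
    by (simp add: space_prob_algebra measure_pmf.prob_space_axioms)
  have K': "planted_law_given m n \<rho> \<in> measure_pmf (latent_pmf m n) \<rightarrow>\<^sub>M subprob_algebra (data_space m n)"
    using K by (rule measurable_prob_algebraD)
  show sets: "sets (planted_law m n \<rho>) = sets (data_space m n)"
    unfolding planted_law_def by (rule sets_bind) (auto simp: sets_planted_law_given)
  show em: "emeasure (planted_law m n \<rho>) A = (\<Sum>\<pi>\<in>latents m n. emeasure (planted_law_given m n \<rho> \<pi>) A) / card (latents m n)"
    if "A \<in> sets (data_space m n)" for A
    unfolding planted_law_def
    using that id_in_latents[of m n]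
    by (subst emeasure_bind[OF _ K']) (auto simp: latent_pmf_latents intro!: nn_integral_pmf_of_set)
  show "prob_space (planted_law m n \<rho>)"
    unfolding planted_law_def
    using prob_space_planted_law_given[OF assms]
    by (intro measure_pmf.prob_space_bind[OF _ K']) auto
qed

subsection \<open>Bounds on the second moment for a fixed relative tuple\<close>

text \<open>The entries of the identity minus the inverse covariance, that is, of the quadratic form
  in the exponent of \<open>equi_ratio\<close>. The diagonal entry equals
  \<open>equi_slope m r - r / (1 - r)\<close>; the form chosen here shows that for
  \<open>r \<ge> 0\<close> it is nonpositive and of second order in \<open>r\<close>.\<close>

definition equi_coeff :: "nat \<Rightarrow> real \<Rightarrow> nat \<Rightarrow> nat \<Rightarrow> real" where
  "equi_coeff m r k l = (if k = l then - ((real m - 1) * r * equi_slope m r) else equi_slope m r)"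

lemma equi_coeff_simps [simp]:
  "equi_coeff m r k k = - ((real m - 1) * r * equi_slope m r)"
  "k \<noteq> l \<Longrightarrow> equi_coeff m r k l = equi_slope m r"
  by (simp_all add: equi_coeff_def)

lemma sum_equi_coeff_split:
  "(\<Sum>k<m. \<Sum>l<m. f k l) = (\<Sum>k<m. f k k) + (\<Sum>k<m. \<Sum>l\<in>{..<m} - {k}. f k l)"
  for f :: "nat \<Rightarrow> nat \<Rightarrow> real"
  unfolding sum.distrib[symmetric] by (intro sum.cong refl sum.remove) auto

lemma equi_ratio_exp:
  assumes "1 \<le> m" "0 \<le> r" "r < 1"
  shows "equi_ratio m r x = exp (- ln (equi_norm m r) / 2 + (\<Sum>k<m. \<Sum>l<m. equi_coeff m r k l * x k * x l) / 2)"
proof -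
  define d where "d = 1 + (real m - 1) * r"
  have d: "d > 0" unfolding d_def using assms by (intro add_pos_nonneg) auto
  have coeff: "equi_coeff m r k l = equi_slope m r - (if k = l then r / (1 - r) else 0)" for k l
  proof -
    have "equi_slope m r - r / (1 - r) = - ((real m - 1) * r * equi_slope m r)"
      using d assms by (simp add: equi_slope_def d_def[symmetric] divide_simps) (simp add: d_def algebra_simps)
    then show ?thesis by (simp add: equi_coeff_def)
  qed
  have square: "(\<Sum>k<m. x k)\<^sup>2 = (\<Sum>k<m. \<Sum>l<m. x k * x l)"
    unfolding power2_eq_square by (rule sum_product)
  have "(\<Sum>k<m. \<Sum>l<m. equi_coeff m r k l * x k * x l)
      = (\<Sum>k<m. \<Sum>l<m. equi_slope m r * (x k * x l) - (if k = l then r / (1 - r) * (x k)\<^sup>2 else 0))"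
    by (intro sum.cong refl, subst coeff) (simp add: algebra_simps power2_eq_square)
  also have "\<dots> = equi_slope m r * (\<Sum>k<m. x k)\<^sup>2 - r / (1 - r) * (\<Sum>k<m. (x k)\<^sup>2)"
    by (simp add: sum_subtractf sum_distrib_left square)
  finally have *: "(\<Sum>k<m. \<Sum>l<m. equi_coeff m r k l * x k * x l)
      = equi_slope m r * (\<Sum>k<m. x k)\<^sup>2 - r / (1 - r) * (\<Sum>k<m. (x k)\<^sup>2)" .
  have "1 / sqrt (equi_norm m r) = exp (- ln (equi_norm m r) / 2)"
    using equi_norm_pos[OF assms] by (simp add: exp_minus ln_sqrt[symmetric] field_simps)
  then show ?thesis
    unfolding * exp_add equi_ratio_def by (simp only: \<open>1 / _ = _\<close>[symmetric]) simp
qed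

lemma prod_equi_ratio_exp:
  assumes "1 \<le> m" "0 \<le> r" "r < 1"
  shows "(\<Prod>e\<in>E. equi_ratio m r (y e))
    = exp (card E * (- ln (equi_norm m r)) / 2 + (\<Sum>e\<in>E. \<Sum>k<m. \<Sum>l<m. equi_coeff m r k l * y e k * y e l) / 2)"
proof (cases "finite E")
  case True
  then show ?thesis
    by (simp add: equi_ratio_exp[OF assms] exp_sum[symmetric] sum.distrib sum_subtractf sum_divide_distrib)
qed simp

text \<open>The third bound says that the slope is \<open>r\<close> up to second order. It enters
  squared in \<open>equi_norm_cancellation\<close>, where the difference of the second-order terms
  is a multiple of \<open>(equi_slope m r - r)^2\<close>.\<close>

lemma equi_slope_bounds:
  assumes "1 \<le> m" "0 \<le> r" "r \<le> 1 / 2"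
  shows "0 \<le> equi_slope m r" "equi_slope m r \<le> 2 * r" "\<bar>equi_slope m r - r\<bar> \<le> 2 * real m * r\<^sup>2"
proof -
  define d where "d = (1 - r) * (1 + (real m - 1) * r)"
  have m1: "0 \<le> (real m - 1) * r" using assms by (intro mult_nonneg_nonneg) auto
  have "1 / 2 * 1 \<le> d" unfolding d_def using assms m1 by (intro mult_mono) auto
  then have d: "1 / 2 \<le> d" by simp
  have o: "equi_slope m r = r / d" by (simp add: equi_slope_def d_def)
  show "0 \<le> equi_slope m r" unfolding o using assms d by simp
  have "r * 1 \<le> r * (2 * d)" using assms d by (intro mult_left_mono) auto
  then show "equi_slope m r \<le> 2 * r" unfolding o using d by (simp add: field_simps)
  have "1 - d = (real m - 1) * r\<^sup>2 - (real m - 2) * r"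
    by (simp add: d_def algebra_simps power2_eq_square)
  moreover have "\<bar>(real m - 1) * r\<^sup>2 - (real m - 2) * r\<bar> \<le> real m * r"
  proof -
    have "r\<^sup>2 \<le> r" using assms by (simp add: power2_eq_square mult_left_le)
    then have a: "(real m - 1) * r\<^sup>2 \<le> (real m - 1) * r" "0 \<le> (real m - 1) * r\<^sup>2"
      using assms by (auto intro!: mult_left_mono)
    have "\<bar>A - (B - 2 * r)\<bar> \<le> B" if "A \<le> B - r" "0 \<le> A" "r \<le> B" for A B :: real
      using that assms(2) by (simp add: abs_le_iff)
    moreover have "(real m - 1) * r\<^sup>2 \<le> real m * r - r" using a(1) by (simp add: algebra_simps)
    moreover have "r \<le> real m * r" using assms mult_right_mono[of 1 "real m" r] by simp
    moreover have "(real m - 2) * r = real m * r - 2 * r" by (simp add: algebra_simps)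
    ultimately show ?thesis using a(2) by metis
  qed
  ultimately have "\<bar>1 - d\<bar> \<le> real m * r" by simp
  then have "\<bar>r * (1 - d)\<bar> \<le> r * (real m * r)"
    using assms by (simp add: abs_mult mult_left_mono)
  also have "\<dots> \<le> (2 * real m * r\<^sup>2) * d"
  proof -
    have "(2 * real m * r\<^sup>2) * (1 / 2) \<le> (2 * real m * r\<^sup>2) * d" using d by (intro mult_left_mono) auto
    then show ?thesis by (simp add: power2_eq_square mult_ac)
  qed
  finally have "\<bar>r * (1 - d)\<bar> / d \<le> 2 * real m * r\<^sup>2" using d by (simp add: field_simps)
  moreover have "equi_slope m r - r = r * (1 - d) / d" unfolding o using d by (simp add: field_simps)
  ultimately show "\<bar>equi_slope m r - r\<bar> \<le> 2 * real m * r\<^sup>2" using d by (simp add: abs_mult)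
qed

(* The terms of order r^2 cancel; this is what makes the second moment 1 + o(1). *)
lemma equi_norm_cancellation:
  assumes "1 \<le> m" "0 \<le> r" "r \<le> 1 / 2"
  shows "- ln (equi_norm m r) + m * equi_coeff m r 0 0 + (m * equi_coeff m r 0 0)\<^sup>2
    + (equi_slope m r)\<^sup>2 * m * (real m - 1) / 2 \<le> 4 * m ^ 4 * r ^ 3"
proof -
  define s where "s = equi_slope m r"
  have s: "0 \<le> s" "s \<le> 2 * r" "\<bar>s - r\<bar> \<le> 2 * real m * r\<^sup>2"
    using equi_slope_bounds[OF assms] by (simp_all add: s_def)
  define M where "M = real m"
  have M: "1 \<le> M" using assms by (simp add: M_def)
  have m1: "0 \<le> (M - 1) * r" using assms M by (intro mult_nonneg_nonneg) auto
  have "- ln (equi_norm m r) = - (M - 1) * ln (1 - r) - ln (1 + (M - 1) * r)"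
    using assms m1 by (simp add: equi_norm_def ln_mult_pos ln_realpow M_def of_nat_diff add_pos_nonneg left_diff_distrib)
  also have "\<dots> \<le> (M - 1) * (r + r\<^sup>2 / 2 + r ^ 3) - ((M - 1) * r - ((M - 1) * r)\<^sup>2 / 2)"
    using mult_left_mono[OF ln_one_minus_ge_cubic[OF assms(2,3)], of "M - 1"] M
      ln_one_plus_ge_quadratic[OF m1] by (simp add: algebra_simps)
  also have "\<dots> = M * (M - 1) * r\<^sup>2 / 2 + (M - 1) * r ^ 3"
    by (simp add: field_simps power2_eq_square power3_eq_cube)
  finally have "- ln (equi_norm m r) + M * (- ((M - 1) * r * s)) + s\<^sup>2 * M * (M - 1) / 2
      \<le> M * (M - 1) / 2 * (s - r)\<^sup>2 + (M - 1) * r ^ 3"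
    by (simp add: field_simps power2_eq_square)
  also have "\<dots> \<le> M * M / 2 * (2 * M * r\<^sup>2)\<^sup>2 + M * r ^ 3"
  proof (intro add_mono mult_mono)
    show "(s - r)\<^sup>2 \<le> (2 * M * r\<^sup>2)\<^sup>2"
      using s(3) by (simp add: M_def abs_le_square_iff[symmetric])
  qed (use M assms in auto)
  finally have 1: "- ln (equi_norm m r) + M * (- ((M - 1) * r * s)) + s\<^sup>2 * M * (M - 1) / 2
      \<le> 2 * (M ^ 4 * r ^ 4) + M * r ^ 3"
    by (simp add: power2_eq_square power3_eq_cube power4_eq_xxxx algebra_simps)
  have "(M * (- ((M - 1) * r * s)))\<^sup>2 = (M * ((M - 1) * r * s))\<^sup>2" by (simp add: power2_eq_square)
  also have "\<dots> \<le> (M * (M * r * (2 * r)))\<^sup>2"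
    using M assms s by (intro power_mono mult_mono) auto
  also have "\<dots> = 4 * M ^ 4 * r ^ 4"
    by (simp add: power2_eq_square power4_eq_xxxx)
  finally have 2: "(M * (- ((M - 1) * r * s)))\<^sup>2 \<le> 4 * (M ^ 4 * r ^ 4)" by (simp add: mult.assoc)
  have "6 * M ^ 4 * r ^ 4 = 6 * M ^ 4 * r ^ 3 * r" by (simp add: power4_eq_xxxx power3_eq_cube)
  also have "\<dots> \<le> 6 * M ^ 4 * r ^ 3 * (1 / 2)" using assms M by (intro mult_left_mono) auto
  finally have 3: "6 * (M ^ 4 * r ^ 4) \<le> 3 * (M ^ 4 * r ^ 3)" by simp
  have "M \<le> M ^ 4" using M by (intro self_le_power) auto
  then have 4: "M * r ^ 3 \<le> M ^ 4 * r ^ 3" using assms by (intro mult_right_mono) auto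
  have "A + B + C + D \<le> 4 * Q"
    if "A + B + D \<le> 2 * X + Y" "C \<le> 4 * X" "6 * X \<le> 3 * Q" "Y \<le> Q" for A B C D X Y Q :: real
    using that by linarith
  from this[OF 1 2 3 4] show ?thesis
    by (simp only: s_def M_def equi_coeff_simps mult.assoc)
qed

section \<open>Quadratic forms along bijections of the edge set\<close>

lemma sum_matching:
  fixes f g :: "'e \<Rightarrow> real"
  assumes E: "finite E" and \<theta>: "bij_betw \<theta> E E" "\<And>e. e \<in> E \<Longrightarrow> \<psi> (\<theta> e) = e"
    and \<theta>': "bij_betw \<theta>' E E" "\<And>e. e \<in> E \<Longrightarrow> \<psi>' (\<theta>' e) = e"
  shows "(\<Sum>e\<in>E. f (\<theta> e) * g (\<theta>' e)) = (\<Sum>a\<in>E. \<Sum>b\<in>E. of_bool (\<psi> a = \<psi>' b) * f a * g b)"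
proof -
  have "(\<Sum>b\<in>E. of_bool (\<psi> a = \<psi>' b) * f a * g b) = f a * g (\<theta>' (\<psi> a))" if "a \<in> E" for a
  proof -
    have "a \<in> \<theta> ` E" using that bij_betw_imp_surj_on[OF \<theta>(1)] by simp
    then obtain e where e: "e \<in> E" "a = \<theta> e" by (elim imageE)
    have "(\<Sum>b\<in>E. of_bool (\<psi> a = \<psi>' b) * f a * g b) = (\<Sum>b\<in>{\<theta>' e}. f a * g b)"
    proof (intro sum.mono_neutral_cong_right)
      show "\<forall>b\<in>E - {\<theta>' e}. of_bool (\<psi> a = \<psi>' b) * f a * g b = 0"
      proof
        fix b assume b: "b \<in> E - {\<theta>' e}"
        then have "b \<in> \<theta>' ` E" using bij_betw_imp_surj_on[OF \<theta>'(1)] by simp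
        then obtain c where "c \<in> E" "b = \<theta>' c" by (elim imageE)
        then show "of_bool (\<psi> a = \<psi>' b) * f a * g b = 0" using b e \<theta>(2) \<theta>'(2) by auto
      qed
    qed (use E e \<theta> \<theta>' in \<open>auto dest: bij_betwE\<close>)
    then show ?thesis using e \<theta>(2) by simp
  qed
  then have "(\<Sum>a\<in>E. \<Sum>b\<in>E. of_bool (\<psi> a = \<psi>' b) * f a * g b) = (\<Sum>a\<in>E. f a * g (\<theta>' (\<psi> a)))"
    by (intro sum.cong refl) auto
  also have "\<dots> = (\<Sum>e\<in>E. f (\<theta> e) * g (\<theta>' (\<psi> (\<theta> e))))"
    by (rule sum.reindex_bij_betw[OF \<theta>(1), symmetric])
  finally show ?thesis using \<theta>(2) by simp
qed

text \<open>Ordered pairs, as in a double sum over matrix entries: every unordered pair of copies is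
  counted twice.\<close>

definition off_pairs :: "nat \<Rightarrow> (nat \<times> nat) set" where
  "off_pairs m = {(k, l). k < m \<and> l < m \<and> k \<noteq> l}"

lemma off_pairs_Sigma: "off_pairs m = (SIGMA k:{..<m}. {..<m} - {k})"
  by (auto simp: off_pairs_def)

lemma finite_off_pairs [simp]: "finite (off_pairs m)"
  by (simp add: off_pairs_Sigma)

lemma card_off_pairs: "1 \<le> m \<Longrightarrow> real (card (off_pairs m)) = m * (real m - 1)"
  by (simp add: off_pairs_Sigma of_nat_diff)

lemma sum_split_off_pairs:
  "(\<Sum>k<m. \<Sum>l<m. f k l) = (\<Sum>k<m. f k k) + (\<Sum>(k, l)\<in>off_pairs m. f k l)"
  for f :: "nat \<Rightarrow> nat \<Rightarrow> real"
  by (simp add: sum_equi_coeff_split off_pairs_Sigma sum.Sigma)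

lemma sum_square_product:
  "(\<Sum>p\<in>{..<m} \<times> E. \<Sum>q\<in>{..<m} \<times> E. F p q) = (\<Sum>k<m. \<Sum>l<m. \<Sum>a\<in>E. \<Sum>b\<in>E. F (k, a) (l, b))"
  for F :: "nat \<times> 'e \<Rightarrow> nat \<times> 'e \<Rightarrow> real"
proof -
  have "(\<Sum>p\<in>{..<m} \<times> E. \<Sum>q\<in>{..<m} \<times> E. F p q) = (\<Sum>k<m. \<Sum>a\<in>E. \<Sum>l<m. \<Sum>b\<in>E. F (k, a) (l, b))"
    by (simp only: sum.cartesian_product')
  also have "\<dots> = (\<Sum>k<m. \<Sum>l<m. \<Sum>a\<in>E. \<Sum>b\<in>E. F (k, a) (l, b))"
    by (intro sum.cong refl sum.swap)
  finally show ?thesis .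
qed

lemma sum_of_bool_bij:
  assumes "finite E" "bij_betw g E E" "c \<in> E"
  shows "(\<Sum>b\<in>E. of_bool (c = g b)) = (1 :: real)"
proof -
  have "(\<Sum>b\<in>E. of_bool (c = g b)) = (\<Sum>b\<in>E. of_bool (c = b) :: real)"
    by (rule sum.reindex_bij_betw[OF assms(2)])
  also have "\<dots> = (\<Sum>b\<in>{c}. 1)"
    using assms by (intro sum.mono_neutral_cong_right) auto
  finally show ?thesis by simp
qed

lemma sum_of_bool_card:
  assumes "finite E"
  shows "(\<Sum>a\<in>E. of_bool (P a)) = real (card {a\<in>E. P a})"
  using assms by (simp add: Int_def sum.If_cases of_bool_def)

text \<open>The Gaussian estimates see permutations only through bijections of the edge set. In the
  application \<open>\<psi> k\<close> is the action of a relative permutation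
  \<open>\<phi> k\<close> on edges and \<open>\<theta> k\<close> is its inverse; see
  \<open>edge_bijections_latents\<close>.\<close>

locale edge_bijections =
  fixes m :: nat and E :: "'e set" and \<theta> \<psi> :: "nat \<Rightarrow> 'e \<Rightarrow> 'e"
  assumes m: "1 \<le> m" and finE: "finite E"
    and bij_\<theta>: "\<And>k. k < m \<Longrightarrow> bij_betw (\<theta> k) E E"
    and \<psi>\<theta>: "\<And>k e. k < m \<Longrightarrow> e \<in> E \<Longrightarrow> \<psi> k (\<theta> k e) = e"
begin

lemma bij_\<psi>: "k < m \<Longrightarrow> bij_betw (\<psi> k) E E"
proof -
  assume k: "k < m"
  have "\<theta> k ` E = E" "inj_on (\<theta> k) E" using bij_\<theta>[OF k] by (auto simp: bij_betw_def)
  moreover have "\<theta> k (\<psi> k a) = a \<and> \<psi> k a \<in> E" if "a \<in> E" for a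
  proof -
    have "a \<in> \<theta> k ` E" using that \<open>\<theta> k ` E = E\<close> by simp
    then show ?thesis using \<psi>\<theta>[OF k] by (elim imageE) simp
  qed
  ultimately show "bij_betw (\<psi> k) E E"
    using \<psi>\<theta>[OF k] by (intro bij_betw_byWitness[where f' = "\<theta> k"]) auto
qed

lemma \<psi>_eq_iff: "k < m \<Longrightarrow> a \<in> E \<Longrightarrow> b \<in> E \<Longrightarrow> \<psi> k a = \<psi> k b \<longleftrightarrow> a = b"
  using bij_\<psi>[of k] by (auto simp: bij_betw_def inj_on_def)

lemma sum_of_bool_\<psi>: "k < m \<Longrightarrow> l < m \<Longrightarrow> a \<in> E \<Longrightarrow> (\<Sum>b\<in>E. of_bool (\<psi> k a = \<psi> l b)) = (1 :: real)"
  using bij_\<psi>[of k] by (intro sum_of_bool_bij finE bij_\<psi>) (auto dest: bij_betwE)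

text \<open>The sum of the traces of the matching matrices with entries
  \<open>of_bool (\<psi> k a = \<psi> l b)\<close>.\<close>

definition common :: "real" where
  "common = (\<Sum>(k, l)\<in>off_pairs m. real (card {a\<in>E. \<psi> k a = \<psi> l a}))"

definition matches :: "nat \<Rightarrow> nat \<Rightarrow> nat \<Rightarrow> nat \<Rightarrow> ('e \<times> 'e) set" where
  "matches k l k' l' = {(a, b)\<in>E \<times> E. \<psi> k a = \<psi> l b \<and> \<psi> k' a = \<psi> l' b}"

text \<open>The inner products of distinct matching matrices. Each matrix paired with itself gives
  \<open>card E\<close>; these terms enter the cancellation with the normalization, and
  \<open>cross\<close> is what remains.\<close>

definition cross :: "real" where
  "cross = (\<Sum>(k, l)\<in>off_pairs m. \<Sum>(k', l')\<in>off_pairs m - {(k, l)}. real (card (matches k l k' l')))"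

text \<open>The exponent is a quadratic form with matrix \<open>m * d\<close> times the identity
  plus \<open>s\<close> times the sum \<open>G\<close> of all matching matrices. In
  \<open>gaussian_quadratic_mgf_le\<close> the trace of \<open>G\<close> gives \<open>common\<close>
  and its squares give \<open>cross\<close>. The remaining terms are multiples of
  \<open>card E\<close>, and \<open>equi_norm_cancellation\<close> reduces them to order
  \<open>r ^ 3\<close>.\<close>

lemma second_moment_le:
  assumes r: "0 \<le> r" "6 * real m ^ 2 * r \<le> 1"
  shows "(\<integral>\<^sup>+ Z. ennreal (\<Prod>e\<in>E. equi_ratio m r (\<lambda>k. Z (\<theta> k e))) \<partial>gaussian_on E)
    \<le> ennreal (exp (equi_slope m r / 2 * common + (equi_slope m r)\<^sup>2 / 4 * cross
        + 100 * real m ^ 6 * card E * r ^ 3))"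
proof -
  define M where "M = real m"
  have M: "1 \<le> M" using m by (simp add: M_def)
  have "r \<le> M ^ 2 * r" using M r(1) by (simp add: mult_le_cancel_right1 one_le_power)
  then have r2: "r \<le> 1 / 2" "r < 1" using r by (auto simp: M_def)
  define s where "s = equi_slope m r"
  define d where "d = equi_coeff m r 0 0"
  have s: "0 \<le> s" "s \<le> 2 * r" using equi_slope_bounds[OF m r(1) r2(1)] by (auto simp: s_def)
  have w: "equi_coeff m r k l = (if k = l then d else s)" for k l by (simp add: d_def s_def)
  have d_eq: "d = - ((M - 1) * r * s)" by (simp add: d_def M_def s_def)
  have d: "d \<le> 0" "\<bar>d\<bar> \<le> M * r"
  proof -
    show "d \<le> 0" using M r s by (simp add: d_eq)
    have "\<bar>d\<bar> = (M - 1) * r * s" using M r s by (simp add: d_eq abs_mult)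
    also have "\<dots> \<le> M * r * 1" using M r r2 s by (intro mult_mono) auto
    finally show "\<bar>d\<bar> \<le> M * r" by simp
  qed
  define A where "A a b = (\<Sum>k<m. \<Sum>l<m. equi_coeff m r k l * of_bool (\<psi> k a = \<psi> l b))" for a b
  define G where "G a b = (\<Sum>(k, l)\<in>off_pairs m. of_bool (\<psi> k a = \<psi> l b) :: real)" for a b
  have G0: "0 \<le> G a b" for a b unfolding G_def by (auto intro!: sum_nonneg)
  have A: "A a b = of_bool (a = b) * (M * d) + s * G a b" if "a \<in> E" "b \<in> E" for a b
    unfolding A_def sum_split_off_pairs G_def sum_distrib_left
    using that by (intro arg_cong2[where f = "(+)"] sum.cong) (auto simp: off_pairs_def \<psi>_eq_iff M_def d_eq s_def)
  \<comment> \<open>For each pair of copies, the sum over matched edges is a bilinear form with a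
    permutation matrix, by \<open>sum_matching\<close>; adding them up gives a single form in
    \<open>Z\<close>.\<close>
  have form: "(\<Sum>e\<in>E. \<Sum>k<m. \<Sum>l<m. equi_coeff m r k l * Z (\<theta> k e) * Z (\<theta> l e))
      = (\<Sum>a\<in>E. \<Sum>b\<in>E. A a b * Z a * Z b)" for Z :: "'e \<Rightarrow> real"
  proof -
    have "(\<Sum>e\<in>E. \<Sum>k<m. \<Sum>l<m. equi_coeff m r k l * Z (\<theta> k e) * Z (\<theta> l e))
        = (\<Sum>k<m. \<Sum>l<m. \<Sum>e\<in>E. equi_coeff m r k l * (Z (\<theta> k e) * Z (\<theta> l e)))"
      by (subst sum.swap, intro sum.cong refl, subst sum.swap) (simp add: mult.assoc)
    also have "\<dots> = (\<Sum>k<m. \<Sum>l<m. equi_coeff m r k l * (\<Sum>a\<in>E. \<Sum>b\<in>E. of_bool (\<psi> k a = \<psi> l b) * Z a * Z b))"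
      unfolding sum_distrib_left[symmetric]
      by (intro sum.cong refl arg_cong[where f = "(*) _"] sum_matching finE bij_\<theta> \<psi>\<theta>) auto
    also have "\<dots> = (\<Sum>k<m. \<Sum>l<m. \<Sum>a\<in>E. \<Sum>b\<in>E. equi_coeff m r k l * of_bool (\<psi> k a = \<psi> l b) * Z a * Z b)"
      by (simp add: sum_distrib_left mult.assoc)
    also have "\<dots> = (\<Sum>a\<in>E. \<Sum>b\<in>E. \<Sum>k<m. \<Sum>l<m. equi_coeff m r k l * of_bool (\<psi> k a = \<psi> l b) * Z a * Z b)"
      by (simp add: sum.swap[of _ E "{..<m}"])
    finally show ?thesis unfolding A_def sum_distrib_right .
  qed
  have rows: "(\<Sum>b\<in>E. \<bar>A a b\<bar>) \<le> 3 * M ^ 2 * r" if a: "a \<in> E" for a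
  proof -
    have "(\<Sum>b\<in>E. \<bar>A a b\<bar>) \<le> (\<Sum>b\<in>E. of_bool (a = b) * (M * \<bar>d\<bar>) + s * G a b)"
      using A[OF a] s G0 M by (intro sum_mono) (auto simp: abs_mult intro!: order_trans[OF abs_triangle_ineq])
    also have "\<dots> = M * \<bar>d\<bar> + s * (\<Sum>b\<in>E. G a b)"
      using sum_of_bool_bij[OF finE bij_betw_id a]
      by (simp add: sum.distrib sum_distrib_left[symmetric] sum_distrib_right[symmetric])
    also have "(\<Sum>b\<in>E. G a b) = (\<Sum>(k, l)\<in>off_pairs m. 1)"
      unfolding G_def
      by (subst sum.swap, intro sum.cong refl) (auto simp: off_pairs_def sum_of_bool_\<psi> a)
    also have "M * \<bar>d\<bar> + s * (\<Sum>(k, l)\<in>off_pairs m. 1) = M * \<bar>d\<bar> + s * (M * (M - 1))"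
      by (simp add: card_off_pairs m M_def case_prod_unfold)
    also have "\<dots> \<le> M * (M * r) + (2 * r) * (M * M)"
      using M s d by (intro add_mono mult_mono) auto
    finally show ?thesis by (simp add: power2_eq_square)
  qed
  have trace: "(\<Sum>a\<in>E. A a a) = M * d * card E + s * common"
  proof -
    have "(\<Sum>a\<in>E. A a a) = (\<Sum>a\<in>E. M * d + s * G a a)"
      by (intro sum.cong refl) (simp add: A)
    also have "\<dots> = M * d * card E + s * (\<Sum>a\<in>E. G a a)"
      by (simp add: sum.distrib sum_distrib_left)
    also have "(\<Sum>a\<in>E. G a a) = common"
      unfolding G_def common_def
      by (subst sum.swap, intro sum.cong refl) (auto simp: sum_of_bool_card[OF finE])
    finally show ?thesis .
  qed
  have squares: "(\<Sum>a\<in>E. \<Sum>b\<in>E. (A a b)\<^sup>2) \<le> (M * d)\<^sup>2 * card E + s\<^sup>2 * (M * (M - 1) * card E + cross)"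
  proof -
    have "(\<Sum>a\<in>E. \<Sum>b\<in>E. (A a b)\<^sup>2) \<le> (\<Sum>a\<in>E. \<Sum>b\<in>E. of_bool (a = b) * (M * d)\<^sup>2 + s\<^sup>2 * (G a b)\<^sup>2)"
    proof (intro sum_mono)
      fix a b assume "a \<in> E" "b \<in> E"
      \<comment> \<open>The mixed term of the square may be dropped because the diagonal coefficient
        \<open>d\<close> is nonpositive.\<close>
      moreover have "M * d * (s * G a b) \<le> 0"
        using M d s G0[of a b] by (intro mult_nonpos_nonneg mult_nonneg_nonpos) auto
      ultimately show "(A a b)\<^sup>2 \<le> of_bool (a = b) * (M * d)\<^sup>2 + s\<^sup>2 * (G a b)\<^sup>2"
        by (cases "a = b") (auto simp: A power2_sum power_mult_distrib mult.assoc)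
    qed
    also have "\<dots> = (M * d)\<^sup>2 * card E + s\<^sup>2 * (\<Sum>a\<in>E. \<Sum>b\<in>E. (G a b)\<^sup>2)"
      using sum_of_bool_bij[OF finE bij_betw_id]
      by (simp add: sum.distrib sum_distrib_left[symmetric] sum_distrib_right[symmetric])
    also have "(\<Sum>a\<in>E. \<Sum>b\<in>E. (G a b)\<^sup>2)
        = (\<Sum>p\<in>off_pairs m. \<Sum>q\<in>off_pairs m. real (card (matches (fst p) (snd p) (fst q) (snd q))))"
    proof -
      have "(\<Sum>a\<in>E. \<Sum>b\<in>E. (G a b)\<^sup>2)
          = (\<Sum>(a, b)\<in>E \<times> E. \<Sum>p\<in>off_pairs m. \<Sum>q\<in>off_pairs m.
              of_bool (\<psi> (fst p) a = \<psi> (snd p) b \<and> \<psi> (fst q) a = \<psi> (snd q) b))"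
        unfolding G_def power2_eq_square sum_product sum.cartesian_product[symmetric]
        by (simp add: case_prod_unfold of_bool_conj)
      also have "\<dots> = (\<Sum>p\<in>off_pairs m. \<Sum>q\<in>off_pairs m. \<Sum>(a, b)\<in>E \<times> E.
              of_bool (\<psi> (fst p) a = \<psi> (snd p) b \<and> \<psi> (fst q) a = \<psi> (snd q) b))"
        unfolding case_prod_unfold by (subst sum.swap, intro sum.cong refl, subst sum.swap) simp
      also have "\<dots> = (\<Sum>p\<in>off_pairs m. \<Sum>q\<in>off_pairs m. real (card (matches (fst p) (snd p) (fst q) (snd q))))"
        unfolding matches_def case_prod_unfold
        by (simp only: sum_of_bool_card[OF finite_cartesian_product[OF finE finE]] prod.collapse)
      finally show ?thesis .
    qed
    also have "\<dots> = (\<Sum>p\<in>off_pairs m. card E + (\<Sum>q\<in>off_pairs m - {p}. real (card (matches (fst p) (snd p) (fst q) (snd q)))))"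
    proof (intro sum.cong refl)
      fix p assume p: "p \<in> off_pairs m"
      have "real (card (matches (fst p) (snd p) (fst p) (snd p))) = (\<Sum>a\<in>E. \<Sum>b\<in>E. of_bool (\<psi> (fst p) a = \<psi> (snd p) b))"
        unfolding matches_def sum.cartesian_product case_prod_unfold
        by (simp only: sum_of_bool_card[OF finite_cartesian_product[OF finE finE]] prod.collapse conj_absorb)
      also have "\<dots> = card E"
        using p by (simp add: off_pairs_def case_prod_unfold sum_of_bool_\<psi>)
      finally show "(\<Sum>q\<in>off_pairs m. real (card (matches (fst p) (snd p) (fst q) (snd q))))
          = card E + (\<Sum>q\<in>off_pairs m - {p}. real (card (matches (fst p) (snd p) (fst q) (snd q))))"
        using p by (subst sum.remove[OF finite_off_pairs p]) auto
    qed
    also have "\<dots> = M * (M - 1) * card E + cross"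
      unfolding cross_def case_prod_unfold
      by (simp add: sum.distrib card_off_pairs m M_def)
    finally show ?thesis .
  qed
  have "(\<integral>\<^sup>+ Z. ennreal (\<Prod>e\<in>E. equi_ratio m r (\<lambda>k. Z (\<theta> k e))) \<partial>gaussian_on E)
    = (\<integral>\<^sup>+ Z. ennreal (exp (card E * (- ln (equi_norm m r)) / 2)) * ennreal (exp ((\<Sum>a\<in>E. \<Sum>b\<in>E. A a b * Z a * Z b) / 2)) \<partial>gaussian_on E)"
    unfolding prod_equi_ratio_exp[OF m r(1) r2(2)] form exp_add by (simp only: ennreal_mult[OF exp_ge_zero exp_ge_zero])
  also have "\<dots> = ennreal (exp (card E * (- ln (equi_norm m r)) / 2)) * (\<integral>\<^sup>+ Z. ennreal (exp ((\<Sum>a\<in>E. \<Sum>b\<in>E. A a b * Z a * Z b) / 2)) \<partial>gaussian_on E)"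
    by (intro nn_integral_cmult) measurable
  also have "\<dots> \<le> ennreal (exp (card E * (- ln (equi_norm m r)) / 2))
      * ennreal (exp ((\<Sum>a\<in>E. A a a) / 2 + (\<Sum>a\<in>E. \<Sum>b\<in>E. (A a b)\<^sup>2) / 4 + 3 * card E * (3 * M ^ 2 * r) ^ 3))"
  proof (intro mult_left_mono gaussian_quadratic_mgf_le finE rows)
    fix a b assume "a \<in> E" "b \<in> E"
    show "A a b = A b a"
      unfolding A_def
      by (subst sum.swap) (auto intro!: sum.cong simp: equi_coeff_def eq_commute)
  qed (use M r in \<open>auto simp: M_def\<close>)
  also have "\<dots> \<le> ennreal (exp (s / 2 * common + s\<^sup>2 / 4 * cross + 100 * M ^ 6 * card E * r ^ 3))"
  proof -
    define N where "N = real (card E)"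
    define L where "L = - ln (equi_norm m r)"
    have "L + M * d + (M * d)\<^sup>2 + s\<^sup>2 * M * (M - 1) / 2 \<le> 4 * M ^ 4 * r ^ 3"
      using equi_norm_cancellation[OF m r(1) r2(1)] by (simp add: M_def d_def s_def L_def)
    moreover have "(M * d)\<^sup>2 / 2 \<le> (M * d)\<^sup>2" by simp
    ultimately have "L + M * d + (M * d)\<^sup>2 / 2 + s\<^sup>2 * M * (M - 1) / 2 \<le> 4 * M ^ 4 * r ^ 3" by linarith
    moreover have "4 * M ^ 4 * r ^ 3 \<le> 4 * M ^ 6 * r ^ 3"
      using M r by (intro mult_right_mono mult_left_mono power_increasing) auto
    ultimately have "N / 2 * (L + M * d + (M * d)\<^sup>2 / 2 + s\<^sup>2 * M * (M - 1) / 2) \<le> N / 2 * (4 * M ^ 6 * r ^ 3)"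
      by (intro mult_left_mono) (auto simp: N_def)
    also have "\<dots> = 2 * (M ^ 6 * N * r ^ 3)" by simp
    finally have 1: "N / 2 * (L + M * d + (M * d)\<^sup>2 / 2 + s\<^sup>2 * M * (M - 1) / 2) \<le> 2 * (M ^ 6 * N * r ^ 3)" .
    have 2: "0 \<le> M ^ 6 * N * r ^ 3" using M r by (auto simp: N_def)
    \<comment> \<open>The factor 81 is \<open>3 * 3 ^ 3\<close>, from the row bound
      \<open>3 * M ^ 2 * r\<close>. Together with the 2 left by the cancellation it stays below
      100.\<close>
    have 3: "N * L / 2 + ((M * d * N + s * common) / 2
        + ((M * d)\<^sup>2 * N + s\<^sup>2 * (M * (M - 1) * N + cross)) / 4 + 3 * N * (3 * M ^ 2 * r) ^ 3)
        = N / 2 * (L + M * d + (M * d)\<^sup>2 / 2 + s\<^sup>2 * M * (M - 1) / 2)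
          + (s / 2 * common + s\<^sup>2 / 4 * cross) + 81 * (M ^ 6 * N * r ^ 3)"
      by (simp add: field_simps power_mult_distrib power_mult[symmetric])
    have 4: "(\<Sum>a\<in>E. \<Sum>b\<in>E. (A a b)\<^sup>2) / 4 \<le> ((M * d)\<^sup>2 * N + s\<^sup>2 * (M * (M - 1) * N + cross)) / 4"
      using squares by (simp add: N_def)
    have "a + (t + q + e) \<le> g + 100 * Y"
      if "K \<le> 2 * Y" "0 \<le> Y" "a + (t + q' + e) = K + g + 81 * Y" "q \<le> q'" for a t q q' e g Y K :: real
      using that by linarith
    from this[OF 1 2 3 4]
    have "N * L / 2 + ((\<Sum>a\<in>E. A a a) / 2 + (\<Sum>a\<in>E. \<Sum>b\<in>E. (A a b)\<^sup>2) / 4 + 3 * N * (3 * M ^ 2 * r) ^ 3)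
        \<le> s / 2 * common + s\<^sup>2 / 4 * cross + 100 * M ^ 6 * N * r ^ 3"
      unfolding trace N_def[symmetric] by (simp only: mult.assoc)
    then show ?thesis
      by (simp add: ennreal_mult[symmetric] exp_add[symmetric] N_def[symmetric] L_def[symmetric])
  qed
  finally show ?thesis by (simp add: M_def s_def)
qed

end

section \<open>Exponential tilting along the overlap\<close>

context edge_bijections
begin

text \<open>\<open>R k l\<close> is the set of edges on which copies \<open>k\<close> and
  \<open>l\<close> are compared. Halving the sum over ordered pairs counts each unordered pair once
  when \<open>R\<close> is symmetric.\<close>

definition overlap :: "(nat \<Rightarrow> nat \<Rightarrow> 'e set) \<Rightarrow> (nat \<times> 'e \<Rightarrow> real) \<Rightarrow> real" where
  "overlap R X = (\<Sum>(k, l)\<in>off_pairs m. \<Sum>a\<in>R k l. X (k, a) * X (l, a)) / 2"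

text \<open>The sum is padded with indicators to run over all pairs of coordinates, so that it can
  be added entry by entry to the forms \<open>form_identity\<close> and \<open>form_matched\<close>
  of the likelihood ratios.\<close>

lemma overlap_eq:
  assumes R: "\<And>k l. R k l \<subseteq> E"
  shows "2 * overlap R X = (\<Sum>k<m. \<Sum>l<m. \<Sum>a\<in>E. \<Sum>b\<in>E. of_bool (k \<noteq> l \<and> a = b \<and> a \<in> R k l) * X (k, a) * X (l, b))"
proof -
  have "(\<Sum>a\<in>E. \<Sum>b\<in>E. of_bool (a = b \<and> a \<in> R k l) * X (k, a) * X (l, b)) = (\<Sum>a\<in>R k l. X (k, a) * X (l, a))" for k l
  proof -
    have "(\<Sum>b\<in>E. of_bool (a = b \<and> a \<in> R k l) * X (k, a) * X (l, b)) = of_bool (a \<in> R k l) * (X (k, a) * X (l, a))"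
      if "a \<in> E" for a
    proof -
      have "(\<Sum>b\<in>E. of_bool (a = b \<and> a \<in> R k l) * X (k, a) * X (l, b))
          = (\<Sum>b\<in>{a}. of_bool (a \<in> R k l) * (X (k, a) * X (l, b)))"
        using that finE by (intro sum.mono_neutral_cong_right) auto
      then show ?thesis by simp
    qed
    then have "(\<Sum>a\<in>E. \<Sum>b\<in>E. of_bool (a = b \<and> a \<in> R k l) * X (k, a) * X (l, b))
        = (\<Sum>a\<in>E. of_bool (a \<in> R k l) * (X (k, a) * X (l, a)))"
      by (intro sum.cong refl) auto
    also have "\<dots> = (\<Sum>a\<in>R k l. X (k, a) * X (l, a))"
      using R[of k l] finE by (intro sum.mono_neutral_cong_right) auto
    finally show ?thesis .
  qed
  then have "2 * overlap R X = (\<Sum>(k, l)\<in>off_pairs m. \<Sum>a\<in>E. \<Sum>b\<in>E. of_bool (a = b \<and> a \<in> R k l) * X (k, a) * X (l, b))"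
    by (simp add: overlap_def)
  also have "\<dots> = (\<Sum>(k, l)\<in>off_pairs m. \<Sum>a\<in>E. \<Sum>b\<in>E. of_bool (k \<noteq> l \<and> a = b \<and> a \<in> R k l) * X (k, a) * X (l, b))"
    by (intro sum.cong refl) (auto simp: off_pairs_def)
  finally show ?thesis by (simp add: sum_split_off_pairs)
qed

lemma finite_index: "finite ({..<m} \<times> E)"
  using finE by simp

lemma card_index: "real (card ({..<m} \<times> E)) = real m * real (card E)"
  by (simp add: card_cartesian_product)

lemma form_identity:
  "(\<Sum>e\<in>E. \<Sum>k<m. \<Sum>l<m. equi_coeff m r k l * X (k, e) * X (l, e))
    = (\<Sum>k<m. \<Sum>l<m. \<Sum>a\<in>E. \<Sum>b\<in>E. equi_coeff m r k l * of_bool (a = b) * X (k, a) * X (l, b))"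
proof -
  have *: "(\<Sum>e\<in>E. X (k, e) * X (l, e)) = (\<Sum>a\<in>E. \<Sum>b\<in>E. of_bool (a = b) * X (k, a) * X (l, b))" for k l
    using sum_matching[OF finE bij_betw_id _ bij_betw_id, of "\<lambda>x. x" "\<lambda>x. x" "\<lambda>a. X (k, a)" "\<lambda>b. X (l, b)"]
    by simp
  have "(\<Sum>e\<in>E. \<Sum>k<m. \<Sum>l<m. equi_coeff m r k l * X (k, e) * X (l, e))
      = (\<Sum>k<m. \<Sum>l<m. equi_coeff m r k l * (\<Sum>e\<in>E. X (k, e) * X (l, e)))"
    unfolding sum_distrib_left by (subst sum.swap, intro sum.cong refl, subst sum.swap) (simp add: mult.assoc)
  also have "\<dots> = (\<Sum>k<m. \<Sum>l<m. \<Sum>a\<in>E. \<Sum>b\<in>E. equi_coeff m r k l * of_bool (a = b) * X (k, a) * X (l, b))"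
    unfolding * by (simp only: sum_distrib_left mult.assoc)
  finally show ?thesis .
qed

lemma form_matched:
  "(\<Sum>e\<in>E. \<Sum>k<m. \<Sum>l<m. equi_coeff m r k l * X (k, \<theta> k e) * X (l, \<theta> l e))
    = (\<Sum>k<m. \<Sum>l<m. \<Sum>a\<in>E. \<Sum>b\<in>E. equi_coeff m r k l * of_bool (\<psi> k a = \<psi> l b) * X (k, a) * X (l, b))"
proof -
  have "(\<Sum>e\<in>E. \<Sum>k<m. \<Sum>l<m. equi_coeff m r k l * X (k, \<theta> k e) * X (l, \<theta> l e))
      = (\<Sum>k<m. \<Sum>l<m. equi_coeff m r k l * (\<Sum>e\<in>E. X (k, \<theta> k e) * X (l, \<theta> l e)))"
    unfolding sum_distrib_left by (subst sum.swap, intro sum.cong refl, subst sum.swap) (simp add: mult.assoc)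
  also have "\<dots> = (\<Sum>k<m. \<Sum>l<m. equi_coeff m r k l * (\<Sum>a\<in>E. \<Sum>b\<in>E. of_bool (\<psi> k a = \<psi> l b) * X (k, a) * X (l, b)))"
    by (intro sum.cong refl arg_cong[where f = "(*) _"]
        sum_matching[where f = "\<lambda>a. X (_, a)" and g = "\<lambda>b. X (_, b)"] finE bij_\<theta> \<psi>\<theta>) auto
  finally show ?thesis by (simp only: sum_distrib_left mult.assoc)
qed

lemma sum_of_bool_common:
  "(\<Sum>a\<in>E. \<Sum>b\<in>E. of_bool (a = b) * f a b) = (\<Sum>a\<in>E. f a a)" for f :: "'e \<Rightarrow> 'e \<Rightarrow> real"
proof (intro sum.cong refl)
  fix a assume "a \<in> E"
  then have "(\<Sum>b\<in>E. of_bool (a = b) * f a b) = (\<Sum>b\<in>{a}. f a b)"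
    using finE by (intro sum.mono_neutral_cong_right) auto
  then show "(\<Sum>b\<in>E. of_bool (a = b) * f a b) = f a a" by simp
qed

text \<open>For an edge in \<open>R k l\<close> the identity matching and the matching by \<psi> hit
  the same matrix entry, which would be \<open>2 * s\<close>. The tilt by
  \<open>- s * overlap\<close> lowers it to \<open>s\<close>, and its square from
  \<open>4 * s^2\<close> to \<open>s^2\<close>; this is the gain of \<open>3 * card (R k l)\<close>.
  Other common edges contribute the surplus 2 of \<open>(1 + 1)^2\<close> over
  \<open>1 + 1\<close>.\<close>

lemma truncated_moment_le:
  assumes r: "0 \<le> r" "12 * real m * r \<le> 1"
    and R: "\<And>k l. R k l \<subseteq> E" "\<And>k l. R k l = R l k"
    and R\<psi>: "\<And>k l a. k < m \<Longrightarrow> l < m \<Longrightarrow> a \<in> R k l \<Longrightarrow> \<psi> k a = \<psi> l a"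
  shows "(\<integral>\<^sup>+ X. ennreal ((\<Prod>e\<in>E. equi_ratio m r (\<lambda>k. X (k, e))) * (\<Prod>e\<in>E. equi_ratio m r (\<lambda>k. X (k, \<theta> k e)))
        * exp (- (equi_slope m r * overlap R X))) \<partial>gaussian_on ({..<m} \<times> E))
    \<le> ennreal (exp ((equi_slope m r)\<^sup>2 / 4 * (2 * common - 3 * (\<Sum>(k, l)\<in>off_pairs m. real (card (R k l))))
        + 1000 * real m ^ 4 * card E * r ^ 3))"
proof -
  define M where "M = real m"
  have M: "1 \<le> M" using m by (simp add: M_def)
  have "r \<le> M * r" using M r(1) by (simp add: mult_le_cancel_right1)
  then have r2: "r \<le> 1 / 2" "r < 1" using r by (auto simp: M_def)
  define s where "s = equi_slope m r"
  define d where "d = equi_coeff m r 0 0"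
  define TR where "TR = (\<Sum>(k, l)\<in>off_pairs m. real (card (R k l)))"
  define N where "N = real (card E)"
  have s: "0 \<le> s" "s \<le> 2 * r" using equi_slope_bounds[OF m r(1) r2(1)] by (auto simp: s_def)
  have d: "\<bar>d\<bar> \<le> M * r"
  proof -
    have "\<bar>d\<bar> = (M - 1) * r * s" using M r s by (simp add: d_def s_def M_def abs_mult)
    also have "\<dots> \<le> M * r * 1" using M r r2 s by (intro mult_mono) auto
    finally show "\<bar>d\<bar> \<le> M * r" by simp
  qed
  define B where "B k l a b = equi_coeff m r k l * (of_bool (a = b) + of_bool (\<psi> k a = \<psi> l b))
     - s * of_bool (k \<noteq> l \<and> a = b \<and> a \<in> R k l)" for k l a b
  define A where "A p q = B (fst p) (fst q) (snd p) (snd q)" for p q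
  have B_diag: "B k k a b = of_bool (a = b) * (2 * d)" if "k < m" "a \<in> E" "b \<in> E" for k a b
    using that \<psi>_eq_iff[OF that] by (cases "a = b") (simp_all add: B_def d_def)
  have B_off: "B k l a b = s * (of_bool (a = b) + of_bool (\<psi> k a = \<psi> l b) - of_bool (a = b \<and> a \<in> R k l))"
    if "k \<noteq> l" for k l a b
    using that by (simp add: B_def s_def algebra_simps)
  have form: "(\<Sum>e\<in>E. \<Sum>k<m. \<Sum>l<m. equi_coeff m r k l * X (k, e) * X (l, e))
      + (\<Sum>e\<in>E. \<Sum>k<m. \<Sum>l<m. equi_coeff m r k l * X (k, \<theta> k e) * X (l, \<theta> l e)) - s * (2 * overlap R X)
      = (\<Sum>p\<in>{..<m} \<times> E. \<Sum>q\<in>{..<m} \<times> E. A p q * X p * X q)" for X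
    unfolding form_identity form_matched overlap_eq[of R, OF R(1)] sum_square_product sum_distrib_left
      sum.distrib[symmetric] sum_subtractf[symmetric] A_def B_def
    by (intro sum.cong refl) (simp add: algebra_simps)
  have rows: "(\<Sum>q\<in>{..<m} \<times> E. \<bar>A p q\<bar>) \<le> 6 * M * r" if p: "p \<in> {..<m} \<times> E" for p
  proof -
    obtain k a where p': "p = (k, a)" "k < m" "a \<in> E" using p by auto
    have "(\<Sum>q\<in>{..<m} \<times> E. \<bar>A p q\<bar>) = (\<Sum>l<m. \<Sum>b\<in>E. \<bar>B k l a b\<bar>)"
      by (simp only: sum.cartesian_product' A_def p' fst_conv snd_conv)
    also have "\<dots> \<le> (\<Sum>l<m. \<Sum>b\<in>E. (if l = k then \<bar>d\<bar> else s) * (of_bool (a = b) + of_bool (\<psi> k a = \<psi> l b)))"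
    proof (intro sum_mono)
      fix l b assume "l \<in> {..<m}" "b \<in> E"
      show "\<bar>B k l a b\<bar> \<le> (if l = k then \<bar>d\<bar> else s) * (of_bool (a = b) + of_bool (\<psi> k a = \<psi> l b))"
      proof (cases "l = k")
        case True
        then show ?thesis using p' \<open>b \<in> E\<close> by (auto simp: B_diag abs_mult)
      next
        case False
        then have "k \<noteq> l" by simp
        show ?thesis unfolding B_off[OF \<open>k \<noteq> l\<close>] using s False
          by (auto simp: abs_mult intro!: mult_left_mono)
      qed
    qed
    also have "\<dots> = (\<Sum>l<m. (if l = k then \<bar>d\<bar> else s) * 2)"
      unfolding sum_distrib_left[symmetric] sum.distrib
      using p' sum_of_bool_bij[OF finE bij_betw_id p'(3)]
      by (intro sum.cong refl) (simp add: sum_of_bool_\<psi>)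
    also have "\<dots> \<le> (\<Sum>l<m. (if l = k then 2 * \<bar>d\<bar> else 0) + 2 * s)"
      using s by (intro sum_mono) auto
    also have "\<dots> = 2 * \<bar>d\<bar> + M * (2 * s)"
      using p' by (simp add: sum.distrib M_def)
    also have "\<dots> \<le> 2 * (M * r) + M * (2 * (2 * r))"
      using d s M by (intro add_mono mult_left_mono) auto
    finally show ?thesis by simp
  qed
  have trace: "(\<Sum>p\<in>{..<m} \<times> E. A p p) = 2 * d * M * N"
  proof -
    have "(\<Sum>p\<in>{..<m} \<times> E. A p p) = (\<Sum>k<m. \<Sum>a\<in>E. B k k a a)"
      by (simp only: sum.cartesian_product' A_def fst_conv snd_conv)
    also have "\<dots> = (\<Sum>k<m. \<Sum>a\<in>E. 2 * d)" by (intro sum.cong refl) (simp add: B_diag)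
    finally show ?thesis by (simp add: M_def N_def)
  qed
  have squares: "(\<Sum>p\<in>{..<m} \<times> E. \<Sum>q\<in>{..<m} \<times> E. (A p q)\<^sup>2)
      = 4 * d\<^sup>2 * M * N + s\<^sup>2 * (2 * M * (M - 1) * N + 2 * common - 3 * TR)"
  proof -
    have diag: "(\<Sum>a\<in>E. \<Sum>b\<in>E. (B k k a b)\<^sup>2) = 4 * d\<^sup>2 * N" if "k < m" for k
    proof -
      have "(\<Sum>a\<in>E. \<Sum>b\<in>E. (B k k a b)\<^sup>2) = (\<Sum>a\<in>E. \<Sum>b\<in>E. of_bool (a = b) * (2 * d)\<^sup>2)"
        using that by (intro sum.cong refl) (auto simp: B_diag)
      then show ?thesis by (simp add: sum_of_bool_common N_def power_mult_distrib)
    qed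
    have off: "(\<Sum>a\<in>E. \<Sum>b\<in>E. (B k l a b)\<^sup>2) = s\<^sup>2 * (2 * N + 2 * card {a\<in>E. \<psi> k a = \<psi> l a} - 3 * card (R k l))"
      if kl: "(k, l) \<in> off_pairs m" for k l
    proof -
      have k: "k < m" "l < m" "k \<noteq> l" using kl by (auto simp: off_pairs_def)
      have "(B k l a b)\<^sup>2 = s\<^sup>2 * (of_bool (a = b) + of_bool (\<psi> k a = \<psi> l b)
          + (of_bool (a = b) * (2 * of_bool (\<psi> k a = \<psi> l a) - 3 * of_bool (a \<in> R k l))))" for a b
        unfolding B_off[OF k(3)] power_mult_distrib
        using R\<psi>[OF k(1,2), of a] by (cases "a \<in> R k l"; cases "a = b") (auto simp: power2_eq_square)
      then have "(\<Sum>a\<in>E. \<Sum>b\<in>E. (B k l a b)\<^sup>2) = s\<^sup>2 * ((\<Sum>a\<in>E. \<Sum>b\<in>E. of_bool (a = b))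
          + (\<Sum>a\<in>E. \<Sum>b\<in>E. of_bool (\<psi> k a = \<psi> l b))
          + (\<Sum>a\<in>E. 2 * of_bool (\<psi> k a = \<psi> l a) - 3 * of_bool (a \<in> R k l)))"
        by (simp only: sum_distrib_left[symmetric] sum.distrib sum_of_bool_common)
      also have "(\<Sum>a\<in>E. \<Sum>b\<in>E. of_bool (a = b)) = N"
        using sum_of_bool_common[of "\<lambda>_ _. 1"] by (simp add: N_def)
      also have "(\<Sum>a\<in>E. \<Sum>b\<in>E. of_bool (\<psi> k a = \<psi> l b)) = N"
        using k by (simp add: sum_of_bool_\<psi> N_def)
      also have "(\<Sum>a\<in>E. 2 * of_bool (\<psi> k a = \<psi> l a) - 3 * of_bool (a \<in> R k l))
          = 2 * real (card {a\<in>E. \<psi> k a = \<psi> l a}) - 3 * real (card (R k l))"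
      proof -
        have "{a\<in>E. a \<in> R k l} = R k l" using R(1)[of k l] by auto
        then show ?thesis
          by (simp only: sum_subtractf sum_distrib_left[symmetric] sum_of_bool_card[OF finE])
      qed
      finally show ?thesis by simp
    qed
    have "(\<Sum>p\<in>{..<m} \<times> E. \<Sum>q\<in>{..<m} \<times> E. (A p q)\<^sup>2) = (\<Sum>k<m. \<Sum>l<m. \<Sum>a\<in>E. \<Sum>b\<in>E. (B k l a b)\<^sup>2)"
      by (simp only: sum_square_product A_def fst_conv snd_conv)
    also have "\<dots> = (\<Sum>k<m. 4 * d\<^sup>2 * N) + (\<Sum>(k, l)\<in>off_pairs m. s\<^sup>2 * (2 * N + 2 * card {a\<in>E. \<psi> k a = \<psi> l a} - 3 * card (R k l)))"
      unfolding sum_split_off_pairs by (intro arg_cong2[where f = "(+)"] sum.cong refl) (auto simp: diag off)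
    also have "(\<Sum>(k, l)\<in>off_pairs m. s\<^sup>2 * (2 * N + 2 * card {a\<in>E. \<psi> k a = \<psi> l a} - 3 * card (R k l)))
        = s\<^sup>2 * (2 * M * (M - 1) * N + 2 * common - 3 * TR)"
      unfolding case_prod_unfold sum_distrib_left[symmetric] sum_subtractf sum.distrib common_def TR_def
      by (simp add: card_off_pairs m M_def sum_distrib_left)
    finally show ?thesis by (simp add: M_def)
  qed
  define L where "L = - ln (equi_norm m r)"
  have "(\<integral>\<^sup>+ X. ennreal ((\<Prod>e\<in>E. equi_ratio m r (\<lambda>k. X (k, e))) * (\<Prod>e\<in>E. equi_ratio m r (\<lambda>k. X (k, \<theta> k e)))
        * exp (- (s * overlap R X))) \<partial>gaussian_on ({..<m} \<times> E))
    = (\<integral>\<^sup>+ X. ennreal (exp (N * L)) * ennreal (exp ((\<Sum>p\<in>{..<m} \<times> E. \<Sum>q\<in>{..<m} \<times> E. A p q * X p * X q) / 2)) \<partial>gaussian_on ({..<m} \<times> E))"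
    unfolding prod_equi_ratio_exp[OF m r(1) r2(2)] form[symmetric] exp_add[symmetric] ennreal_mult[OF exp_ge_zero exp_ge_zero, symmetric]
      L_def[symmetric] N_def[symmetric]
    by (intro nn_integral_cong arg_cong[where f = "\<lambda>x. ennreal (exp x)"]) (simp add: field_simps)
  also have "\<dots> = ennreal (exp (N * L)) * (\<integral>\<^sup>+ X. ennreal (exp ((\<Sum>p\<in>{..<m} \<times> E. \<Sum>q\<in>{..<m} \<times> E. A p q * X p * X q) / 2)) \<partial>gaussian_on ({..<m} \<times> E))"
    by (intro nn_integral_cmult) measurable
  also have "\<dots> \<le> ennreal (exp (N * L)) * ennreal (exp ((\<Sum>p\<in>{..<m} \<times> E. A p p) / 2
      + (\<Sum>p\<in>{..<m} \<times> E. \<Sum>q\<in>{..<m} \<times> E. (A p q)\<^sup>2) / 4 + 3 * card ({..<m} \<times> E) * (6 * M * r) ^ 3))"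
  proof (intro mult_left_mono gaussian_quadratic_mgf_le finite_index rows)
    fix p q
    show "A p q = A q p"
      unfolding A_def B_def using R(2)[of "fst p" "fst q"]
      by (auto simp: equi_coeff_def)
  qed (use M r in \<open>auto simp: M_def\<close>)
  also have "\<dots> \<le> ennreal (exp (s\<^sup>2 / 4 * (2 * common - 3 * TR) + 1000 * M ^ 4 * N * r ^ 3))"
  proof -
    have "L + M * d + (M * d)\<^sup>2 + s\<^sup>2 * M * (M - 1) / 2 \<le> 4 * M ^ 4 * r ^ 3"
      using equi_norm_cancellation[OF m r(1) r2(1)] by (simp add: M_def d_def s_def L_def)
    moreover have "d\<^sup>2 * M \<le> d\<^sup>2 * M ^ 2" using M by (intro mult_left_mono self_le_power) auto
    ultimately have "L + M * d + d\<^sup>2 * M + s\<^sup>2 * M * (M - 1) / 2 \<le> 4 * M ^ 4 * r ^ 3"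
      by (simp add: power_mult_distrib mult.commute)
    then have "N * (L + M * d + d\<^sup>2 * M + s\<^sup>2 * M * (M - 1) / 2) \<le> N * (4 * M ^ 4 * r ^ 3)"
      by (intro mult_left_mono) (auto simp: N_def)
    also have "\<dots> = 4 * (M ^ 4 * N * r ^ 3)" by simp
    finally have 1: "N * (L + M * d + d\<^sup>2 * M + s\<^sup>2 * M * (M - 1) / 2) \<le> 4 * (M ^ 4 * N * r ^ 3)" .
    have 2: "0 \<le> M ^ 4 * N * r ^ 3" using M r by (auto simp: N_def)
    \<comment> \<open>The factor 648 is \<open>3 * 6 ^ 3\<close>, from the row bound
      \<open>6 * M * r\<close>; there are \<open>M * N\<close> coordinates, which gives the fourth
      power of \<open>M\<close>.\<close>
    have 3: "N * L + ((2 * d * M * N) / 2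
        + (4 * d\<^sup>2 * M * N + s\<^sup>2 * (2 * M * (M - 1) * N + 2 * common - 3 * TR)) / 4 + 3 * (M * N) * (6 * M * r) ^ 3)
        = N * (L + M * d + d\<^sup>2 * M + s\<^sup>2 * M * (M - 1) / 2)
          + s\<^sup>2 / 4 * (2 * common - 3 * TR) + 648 * (M ^ 4 * N * r ^ 3)"
      by (simp add: field_simps power_mult_distrib power4_eq_xxxx power3_eq_cube)
    have "a \<le> g + 1000 * Y"
      if "K \<le> 4 * Y" "0 \<le> Y" "a = K + g + 648 * Y" for a g Y K :: real
      using that by linarith
    from this[OF 1 2 3]
    have "N * L + ((\<Sum>p\<in>{..<m} \<times> E. A p p) / 2 + (\<Sum>p\<in>{..<m} \<times> E. \<Sum>q\<in>{..<m} \<times> E. (A p q)\<^sup>2) / 4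
          + 3 * card ({..<m} \<times> E) * (6 * M * r) ^ 3)
        \<le> s\<^sup>2 / 4 * (2 * common - 3 * TR) + 1000 * M ^ 4 * N * r ^ 3"
      unfolding trace squares of_nat_mult of_nat_numeral card_index M_def[symmetric] N_def[symmetric] by (simp only: mult.assoc)
    then show ?thesis
      by (simp add: ennreal_mult[symmetric] exp_add[symmetric])
  qed
  finally show ?thesis by (simp add: M_def s_def N_def TR_def)
qed

text \<open>An exponential moment under the planted law for the tuple of identities. On
  \<open>R k l\<close> the entries grow from \<open>s\<close> to \<open>s + \<kappa>\<close>, hence
  their squares by \<open>2 * s * \<kappa> + \<kappa>^2\<close>. To leading order the linear term is
  \<kappa> times the planted mean of the overlap, and the quadratic term measures its
  fluctuation.\<close>

lemma overlap_mgf_le: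
  assumes r: "0 \<le> r" "0 \<le> \<kappa>" "6 * real m * (r + \<kappa>) \<le> 1"
    and R: "\<And>k l. R k l \<subseteq> E" "\<And>k l. R k l = R l k"
  shows "(\<integral>\<^sup>+ X. ennreal ((\<Prod>e\<in>E. equi_ratio m r (\<lambda>k. X (k, e))) * exp (\<kappa> * overlap R X)) \<partial>gaussian_on ({..<m} \<times> E))
    \<le> ennreal (exp ((equi_slope m r * \<kappa> / 2 + \<kappa>\<^sup>2 / 4) * (\<Sum>(k, l)\<in>off_pairs m. real (card (R k l)))
        + 100 * real m ^ 4 * card E * (r + \<kappa>) ^ 3))"
proof -
  define M where "M = real m"
  have M: "1 \<le> M" using m by (simp add: M_def)
  have "r + \<kappa> \<le> M * (r + \<kappa>)" using M r(1,2) by (simp add: mult_le_cancel_right1)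
  then have r2: "r \<le> 1 / 2" "r < 1" using r by (auto simp: M_def)
  define s where "s = equi_slope m r"
  define d where "d = equi_coeff m r 0 0"
  define TR where "TR = (\<Sum>(k, l)\<in>off_pairs m. real (card (R k l)))"
  define N where "N = real (card E)"
  have s: "0 \<le> s" "s \<le> 2 * r" using equi_slope_bounds[OF m r(1) r2(1)] by (auto simp: s_def)
  have d: "\<bar>d\<bar> \<le> M * r"
  proof -
    have "\<bar>d\<bar> = (M - 1) * r * s" using M r s by (simp add: d_def s_def M_def abs_mult)
    also have "\<dots> \<le> M * r * 1" using M r r2 s by (intro mult_mono) auto
    finally show "\<bar>d\<bar> \<le> M * r" by simp
  qed
  define B where "B k l a b = equi_coeff m r k l * of_bool (a = b)
     + \<kappa> * of_bool (k \<noteq> l \<and> a = b \<and> a \<in> R k l)" for k l a b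
  define A where "A p q = B (fst p) (fst q) (snd p) (snd q)" for p q
  have B_diag: "B k k a b = of_bool (a = b) * d" for k a b
    by (cases "a = b") (simp_all add: B_def d_def)
  have B_off: "B k l a b = of_bool (a = b) * (s + \<kappa> * of_bool (a \<in> R k l))"
    if "k \<noteq> l" for k l a b
    using that by (cases "a = b") (simp_all add: B_def s_def algebra_simps)
  have form: "(\<Sum>e\<in>E. \<Sum>k<m. \<Sum>l<m. equi_coeff m r k l * X (k, e) * X (l, e)) + \<kappa> * (2 * overlap R X)
      = (\<Sum>p\<in>{..<m} \<times> E. \<Sum>q\<in>{..<m} \<times> E. A p q * X p * X q)" for X
    unfolding form_identity overlap_eq[of R, OF R(1)] sum_square_product sum_distrib_left
      sum.distrib[symmetric] A_def B_def
    by (intro sum.cong refl) (simp add: algebra_simps)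
  have rows: "(\<Sum>q\<in>{..<m} \<times> E. \<bar>A p q\<bar>) \<le> 3 * M * (r + \<kappa>)" if p: "p \<in> {..<m} \<times> E" for p
  proof -
    obtain k a where p': "p = (k, a)" "k < m" "a \<in> E" using p by auto
    have "(\<Sum>q\<in>{..<m} \<times> E. \<bar>A p q\<bar>) = (\<Sum>l<m. \<Sum>b\<in>E. \<bar>B k l a b\<bar>)"
      by (simp only: sum.cartesian_product' A_def p' fst_conv snd_conv)
    also have "\<dots> \<le> (\<Sum>l<m. \<Sum>b\<in>E. (if l = k then \<bar>d\<bar> else s + \<kappa>) * of_bool (a = b))"
      using s r by (intro sum_mono) (auto simp: B_diag B_off)
    also have "\<dots> = (\<Sum>l<m. if l = k then \<bar>d\<bar> else s + \<kappa>)"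
      unfolding sum_distrib_left[symmetric]
      using sum_of_bool_bij[OF finE bij_betw_id p'(3)] by simp
    also have "\<dots> \<le> (\<Sum>l<m. (if l = k then \<bar>d\<bar> else 0) + (s + \<kappa>))"
      using s r by (intro sum_mono) auto
    also have "\<dots> = \<bar>d\<bar> + M * (s + \<kappa>)"
      using p' by (simp add: sum.distrib M_def)
    also have "\<dots> \<le> M * r + M * (2 * r + \<kappa>)"
      using d s M by (intro add_mono mult_left_mono) auto
    also have "\<dots> \<le> 3 * M * (r + \<kappa>)" using M r by (simp add: algebra_simps)
    finally show ?thesis .
  qed
  have trace: "(\<Sum>p\<in>{..<m} \<times> E. A p p) = d * M * N"
  proof -
    have "(\<Sum>p\<in>{..<m} \<times> E. A p p) = (\<Sum>k<m. \<Sum>a\<in>E. B k k a a)"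
      by (simp only: sum.cartesian_product' A_def fst_conv snd_conv)
    then show ?thesis by (simp add: B_diag M_def N_def)
  qed
  have squares: "(\<Sum>p\<in>{..<m} \<times> E. \<Sum>q\<in>{..<m} \<times> E. (A p q)\<^sup>2)
      = d\<^sup>2 * M * N + (s\<^sup>2 * M * (M - 1) * N + (2 * s * \<kappa> + \<kappa>\<^sup>2) * TR)"
  proof -
    have diag: "(\<Sum>a\<in>E. \<Sum>b\<in>E. (B k k a b)\<^sup>2) = d\<^sup>2 * N" for k
    proof -
      have "(\<Sum>a\<in>E. \<Sum>b\<in>E. (B k k a b)\<^sup>2) = (\<Sum>a\<in>E. \<Sum>b\<in>E. of_bool (a = b) * d\<^sup>2)"
        by (intro sum.cong refl) (auto simp: B_diag)
      then show ?thesis by (simp add: sum_of_bool_common N_def)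
    qed
    have off: "(\<Sum>a\<in>E. \<Sum>b\<in>E. (B k l a b)\<^sup>2) = s\<^sup>2 * N + (2 * s * \<kappa> + \<kappa>\<^sup>2) * card (R k l)"
      if kl: "(k, l) \<in> off_pairs m" for k l
    proof -
      have "k \<noteq> l" using kl by (auto simp: off_pairs_def)
      then have "(B k l a b)\<^sup>2 = of_bool (a = b) * (s\<^sup>2 + (2 * s * \<kappa> + \<kappa>\<^sup>2) * of_bool (a \<in> R k l))" for a b
        by (auto simp: B_off power2_eq_square algebra_simps)
      then have "(\<Sum>a\<in>E. \<Sum>b\<in>E. (B k l a b)\<^sup>2) = (\<Sum>a\<in>E. s\<^sup>2 + (2 * s * \<kappa> + \<kappa>\<^sup>2) * of_bool (a \<in> R k l))"
        by (simp only: sum_of_bool_common)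
      moreover have "{a\<in>E. a \<in> R k l} = R k l" using R(1)[of k l] by auto
      ultimately show ?thesis
        by (simp only: sum.distrib sum_distrib_left[symmetric] sum_of_bool_card[OF finE]) (simp add: N_def)
    qed
    have "(\<Sum>p\<in>{..<m} \<times> E. \<Sum>q\<in>{..<m} \<times> E. (A p q)\<^sup>2) = (\<Sum>k<m. \<Sum>l<m. \<Sum>a\<in>E. \<Sum>b\<in>E. (B k l a b)\<^sup>2)"
      by (simp only: sum_square_product A_def fst_conv snd_conv)
    also have "\<dots> = (\<Sum>k<m. d\<^sup>2 * N) + (\<Sum>(k, l)\<in>off_pairs m. s\<^sup>2 * N + (2 * s * \<kappa> + \<kappa>\<^sup>2) * card (R k l))"
      unfolding sum_split_off_pairs by (intro arg_cong2[where f = "(+)"] sum.cong refl) (auto simp: diag off)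
    also have "(\<Sum>(k, l)\<in>off_pairs m. s\<^sup>2 * N + (2 * s * \<kappa> + \<kappa>\<^sup>2) * card (R k l))
        = s\<^sup>2 * M * (M - 1) * N + (2 * s * \<kappa> + \<kappa>\<^sup>2) * TR"
      unfolding case_prod_unfold sum_distrib_left[symmetric] sum.distrib TR_def
      by (simp add: card_off_pairs m M_def)
    finally show ?thesis by (simp add: M_def)
  qed
  define L where "L = - ln (equi_norm m r)"
  have "(\<integral>\<^sup>+ X. ennreal ((\<Prod>e\<in>E. equi_ratio m r (\<lambda>k. X (k, e))) * exp (\<kappa> * overlap R X)) \<partial>gaussian_on ({..<m} \<times> E))
    = (\<integral>\<^sup>+ X. ennreal (exp (N * L / 2)) * ennreal (exp ((\<Sum>p\<in>{..<m} \<times> E. \<Sum>q\<in>{..<m} \<times> E. A p q * X p * X q) / 2)) \<partial>gaussian_on ({..<m} \<times> E))"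
    unfolding prod_equi_ratio_exp[OF m r(1) r2(2)] form[symmetric] exp_add[symmetric] ennreal_mult[OF exp_ge_zero exp_ge_zero, symmetric]
      L_def[symmetric] N_def[symmetric]
    by (intro nn_integral_cong arg_cong[where f = "\<lambda>x. ennreal (exp x)"]) (simp add: field_simps)
  also have "\<dots> = ennreal (exp (N * L / 2)) * (\<integral>\<^sup>+ X. ennreal (exp ((\<Sum>p\<in>{..<m} \<times> E. \<Sum>q\<in>{..<m} \<times> E. A p q * X p * X q) / 2)) \<partial>gaussian_on ({..<m} \<times> E))"
    by (intro nn_integral_cmult) measurable
  also have "\<dots> \<le> ennreal (exp (N * L / 2)) * ennreal (exp ((\<Sum>p\<in>{..<m} \<times> E. A p p) / 2
      + (\<Sum>p\<in>{..<m} \<times> E. \<Sum>q\<in>{..<m} \<times> E. (A p q)\<^sup>2) / 4 + 3 * card ({..<m} \<times> E) * (3 * M * (r + \<kappa>)) ^ 3))"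
  proof (intro mult_left_mono gaussian_quadratic_mgf_le finite_index rows)
    fix p q
    show "A p q = A q p"
      unfolding A_def B_def using R(2)[of "fst p" "fst q"]
      by (auto simp: equi_coeff_def)
  qed (use M r in \<open>auto simp: M_def\<close>)
  also have "\<dots> \<le> ennreal (exp ((s * \<kappa> / 2 + \<kappa>\<^sup>2 / 4) * TR + 100 * M ^ 4 * N * (r + \<kappa>) ^ 3))"
  proof -
    have "L + M * d + (M * d)\<^sup>2 + s\<^sup>2 * M * (M - 1) / 2 \<le> 4 * M ^ 4 * r ^ 3"
      using equi_norm_cancellation[OF m r(1) r2(1)] by (simp add: M_def d_def s_def L_def)
    moreover have "d\<^sup>2 * M / 2 \<le> (M * d)\<^sup>2"
    proof -
      have "d\<^sup>2 * M / 2 \<le> d\<^sup>2 * M" using M by simp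
      also have "\<dots> \<le> d\<^sup>2 * M ^ 2" using M by (intro mult_left_mono self_le_power) auto
      finally show ?thesis by (simp add: power_mult_distrib mult.commute)
    qed
    moreover have "4 * M ^ 4 * r ^ 3 \<le> 4 * M ^ 4 * (r + \<kappa>) ^ 3"
      using M r by (intro mult_left_mono power_mono) auto
    moreover have "x + y + z \<le> v" if "x + y' + z \<le> u" "y \<le> y'" "u \<le> v" for x y y' z u v :: real
      using that by linarith
    ultimately have "L + M * d + d\<^sup>2 * M / 2 + s\<^sup>2 * M * (M - 1) / 2 \<le> 4 * M ^ 4 * (r + \<kappa>) ^ 3"
      by blast
    then have "N / 2 * (L + M * d + d\<^sup>2 * M / 2 + s\<^sup>2 * M * (M - 1) / 2) \<le> N / 2 * (4 * M ^ 4 * (r + \<kappa>) ^ 3)"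
      by (intro mult_left_mono) (auto simp: N_def)
    also have "\<dots> = 2 * (M ^ 4 * N * (r + \<kappa>) ^ 3)" by simp
    finally have 1: "N / 2 * (L + M * d + d\<^sup>2 * M / 2 + s\<^sup>2 * M * (M - 1) / 2) \<le> 2 * (M ^ 4 * N * (r + \<kappa>) ^ 3)" .
    have 2: "0 \<le> M ^ 4 * N * (r + \<kappa>) ^ 3" using M r by (auto simp: N_def)
    define t where "t = r + \<kappa>"
    have 3: "N * L / 2 + ((d * M * N) / 2
        + (d\<^sup>2 * M * N + (s\<^sup>2 * M * (M - 1) * N + (2 * s * \<kappa> + \<kappa>\<^sup>2) * TR)) / 4 + 3 * (M * N) * (3 * M * t) ^ 3)
        = N / 2 * (L + M * d + d\<^sup>2 * M / 2 + s\<^sup>2 * M * (M - 1) / 2)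
          + (s * \<kappa> / 2 + \<kappa>\<^sup>2 / 4) * TR + 81 * (M ^ 4 * N * t ^ 3)"
      by (simp add: field_simps power_mult_distrib power4_eq_xxxx power3_eq_cube)
    have "a \<le> g + 100 * Y"
      if "K \<le> 2 * Y" "0 \<le> Y" "a = K + g + 81 * Y" for a g Y K :: real
      using that by linarith
    from this[OF 1 2 3[unfolded t_def]]
    have "N * L / 2 + ((\<Sum>p\<in>{..<m} \<times> E. A p p) / 2 + (\<Sum>p\<in>{..<m} \<times> E. \<Sum>q\<in>{..<m} \<times> E. (A p q)\<^sup>2) / 4
          + 3 * card ({..<m} \<times> E) * (3 * M * (r + \<kappa>)) ^ 3)
        \<le> (s * \<kappa> / 2 + \<kappa>\<^sup>2 / 4) * TR + 100 * M ^ 4 * N * (r + \<kappa>) ^ 3"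
      unfolding trace squares of_nat_mult of_nat_numeral card_index M_def[symmetric] N_def[symmetric] by (simp only: mult.assoc)
    then show ?thesis
      by (simp add: ennreal_mult[symmetric] exp_add[symmetric])
  qed
  finally show ?thesis by (simp add: M_def s_def N_def TR_def)
qed

end

subsection \<open>Coincidences of random permutations\<close>

text \<open>Composition with the inverse of one solution \<open>\<tau>0\<close> embeds all solutions
  into the permutations that fix \<open>S\<close> pointwise.\<close>

lemma card_permutations_prescribed_le:
  assumes "finite A" "S \<subseteq> A"
  shows "card {\<tau>. \<tau> permutes A \<and> (\<forall>i\<in>S. \<tau> i = g i)} \<le> fact (card A - card S)"
proof (cases "{\<tau>. \<tau> permutes A \<and> (\<forall>i\<in>S. \<tau> i = g i)} = {}")
  case False
  then obtain \<tau>0 where \<tau>0: "\<tau>0 permutes A" "\<And>i. i \<in> S \<Longrightarrow> \<tau>0 i = g i" by blast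
  let ?T = "{\<tau>. \<tau> permutes A \<and> (\<forall>i\<in>S. \<tau> i = g i)}"
  have "card ?T \<le> card {\<sigma>. \<sigma> permutes (A - S)}"
  proof (rule card_inj_on_le[where f = "\<lambda>\<tau>. inv_into UNIV \<tau>0 \<circ> \<tau>"])
    show "inj_on (\<lambda>\<tau>. inv_into UNIV \<tau>0 \<circ> \<tau>) ?T"
    proof (rule inj_onI)
      fix \<sigma> \<tau> assume "inv_into UNIV \<tau>0 \<circ> \<sigma> = inv_into UNIV \<tau>0 \<circ> \<tau>"
      then have "\<tau>0 \<circ> (inv_into UNIV \<tau>0 \<circ> \<sigma>) = \<tau>0 \<circ> (inv_into UNIV \<tau>0 \<circ> \<tau>)" by simp
      then show "\<sigma> = \<tau>" by (simp add: fun_eq_iff permutes_inverses[OF \<tau>0(1)])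
    qed
    show "(\<lambda>\<tau>. inv_into UNIV \<tau>0 \<circ> \<tau>) ` ?T \<subseteq> {\<sigma>. \<sigma> permutes (A - S)}"
    proof clarify
      fix \<tau> assume \<tau>: "\<tau> permutes A" "\<forall>i\<in>S. \<tau> i = g i"
      have "inv_into UNIV \<tau>0 (\<tau> i) = i" if "i \<in> S" for i
        using \<tau>(2) \<tau>0(2)[OF that] that permutes_inverses(2)[OF \<tau>0(1), of i] by simp
      then show "inv_into UNIV \<tau>0 \<circ> \<tau> permutes (A - S)"
        by (intro permutes_superset[OF permutes_compose[OF \<tau>(1) permutes_inv[OF \<tau>0(1)]]]) auto
    qed
  qed (use assms in \<open>auto simp: finite_permutations\<close>)
  also have "\<dots> = fact (card A - card S)"
    using assms by (subst card_permutations[OF refl]) (auto simp: card_Diff_subset finite_subset)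
  finally show ?thesis .
qed (metis card.empty le0)

text \<open>A union bound over the choice functions, of which there are at most
  \<open>c ^ card S\<close>.\<close>

lemma card_permutations_choice_le:
  assumes "finite A" "S \<subseteq> A" and R: "\<And>i. i \<in> S \<Longrightarrow> finite (R i) \<and> card (R i) \<le> c"
  shows "card {\<tau>. \<tau> permutes A \<and> (\<forall>i\<in>S. \<tau> i \<in> R i)} \<le> c ^ card S * fact (card A - card S)"
proof -
  have S: "finite S" using assms finite_subset by blast
  have fin: "finite (PiE S R)" using S R by (intro finite_PiE) auto
  have "{\<tau>. \<tau> permutes A \<and> (\<forall>i\<in>S. \<tau> i \<in> R i)} \<subseteq> (\<Union>g\<in>PiE S R. {\<tau>. \<tau> permutes A \<and> (\<forall>i\<in>S. \<tau> i = g i)})"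
  proof clarify
    fix \<tau> assume "\<tau> permutes A" "\<forall>i\<in>S. \<tau> i \<in> R i"
    then show "\<tau> \<in> (\<Union>g\<in>PiE S R. {\<tau>. \<tau> permutes A \<and> (\<forall>i\<in>S. \<tau> i = g i)})"
      by (intro UN_I[of "restrict \<tau> S"]) auto
  qed
  moreover have "finite (\<Union>g\<in>PiE S R. {\<tau>. \<tau> permutes A \<and> (\<forall>i\<in>S. \<tau> i = g i)})"
    using fin by (intro finite_UN_I finite_subset[OF _ finite_permutations[OF assms(1)]]) auto
  ultimately have "card {\<tau>. \<tau> permutes A \<and> (\<forall>i\<in>S. \<tau> i \<in> R i)}
      \<le> card (\<Union>g\<in>PiE S R. {\<tau>. \<tau> permutes A \<and> (\<forall>i\<in>S. \<tau> i = g i)})"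
    by (rule card_mono[rotated])
  also have "\<dots> \<le> (\<Sum>g\<in>PiE S R. card {\<tau>. \<tau> permutes A \<and> (\<forall>i\<in>S. \<tau> i = g i)})"
    by (rule card_UN_le[OF fin])
  also have "\<dots> \<le> (\<Sum>g\<in>PiE S R. fact (card A - card S))"
    by (intro sum_mono card_permutations_prescribed_le assms)
  also have "\<dots> = (\<Prod>i\<in>S. card (R i)) * fact (card A - card S)"
    using S by (simp add: card_PiE)
  also have "\<dots> \<le> c ^ card S * fact (card A - card S)"
    using R prod_le_power[of S "\<lambda>i. card (R i)" c "card S"] S
    by (cases "c = 0"; cases "S = {}") (auto intro!: mult_right_mono prod_mono[THEN order_trans])
  finally show ?thesis .
qed

text \<open>The points of \<open>S\<close> lie in distinct 2-cycles with partners outside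
  \<open>S\<close>. In the induction the partner \<open>b\<close> of \<open>s\<close> can take at
  most \<open>card A - card (insert s S)\<close> values, and composing with the transposition of
  \<open>s\<close> and \<open>b\<close> fixes both points. The ground set then loses two points and
  \<open>S\<close> loses one, so the factor and the smaller factorial combine to the claimed
  one.\<close>

lemma card_permutations_paired_le:
  assumes "finite A" "S \<subseteq> A"
  shows "card {\<tau>. \<tau> permutes A \<and> (\<forall>i\<in>S. \<tau> (\<tau> i) = i \<and> \<tau> i \<notin> S)} \<le> fact (card A - card S)"
  using finite_subset[OF assms(2,1)] assms
proof (induction S arbitrary: A rule: finite_induct)
  case empty
  then show ?case by (simp add: card_permutations)
next
  case (insert s S)
  let ?T = "{\<tau>. \<tau> permutes A \<and> (\<forall>i\<in>insert s S. \<tau> (\<tau> i) = i \<and> \<tau> i \<notin> insert s S)}"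
  let ?U = "\<lambda>b. {\<sigma>. \<sigma> permutes (A - {s, b}) \<and> (\<forall>i\<in>S. \<sigma> (\<sigma> i) = i \<and> \<sigma> i \<notin> S)}"
  let ?B = "A - insert s S"
  have finU: "finite (?U b)" for b
    using insert.prems by (intro finite_subset[OF _ finite_permutations[of "A - {s, b}"]]) auto
  have sub: "?T \<subseteq> (\<Union>b\<in>?B. (\<lambda>\<sigma>. \<sigma> \<circ> Transposition.transpose s b) ` ?U b)"
  proof clarify
    fix \<tau> assume \<tau>: "\<tau> permutes A" "\<forall>i\<in>insert s S. \<tau> (\<tau> i) = i \<and> \<tau> i \<notin> insert s S"
    define b where "b = \<tau> s"
    have b: "\<tau> b = s" "b \<notin> insert s S" using \<tau>(2) by (auto simp: b_def)
    have bA: "b \<in> A" "s \<in> A" using insert.prems permutes_in_image[OF \<tau>(1), of s] by (auto simp: b_def)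
    define \<sigma> where "\<sigma> = \<tau> \<circ> Transposition.transpose s b"
    have \<tau>_eq: "\<tau> = \<sigma> \<circ> Transposition.transpose s b" by (simp add: \<sigma>_def comp_assoc)
    have \<sigma>A: "\<sigma> permutes A" unfolding \<sigma>_def
      using bA by (intro permutes_compose[OF _ \<tau>(1)] permutes_swap_id)
    have "\<sigma> s = s" "\<sigma> b = b" using b(1) by (simp_all add: \<sigma>_def b_def)
    then have "\<sigma> x = x" if "x \<in> A - (A - {s, b})" for x using that by blast
    then have \<sigma>: "\<sigma> permutes (A - {s, b})" by (rule permutes_superset[OF \<sigma>A])
    have "\<sigma> (\<sigma> i) = i \<and> \<sigma> i \<notin> S" if i: "i \<in> S" for i
    proof -
      have "i \<noteq> s" "i \<noteq> b" using i insert.hyps b by auto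
      then have \<sigma>i: "\<sigma> i = \<tau> i" by (simp add: \<sigma>_def transpose_def)
      have "\<tau> (\<tau> i) = i" "\<tau> i \<notin> insert s S" using \<tau>(2) i by auto
      moreover have "\<tau> i \<noteq> b" using \<open>i \<noteq> s\<close> permutes_inj[OF \<tau>(1)] by (auto simp: b_def inj_def)
      ultimately have "\<sigma> (\<tau> i) = i" by (auto simp: \<sigma>_def transpose_def)
      then show ?thesis using \<sigma>i \<open>\<tau> i \<notin> insert s S\<close> by simp
    qed
    then show "\<tau> \<in> (\<Union>b\<in>?B. (\<lambda>\<sigma>. \<sigma> \<circ> Transposition.transpose s b) ` ?U b)"
      using \<sigma> \<tau>_eq bA b by (intro UN_I[of b]) auto
  qed
  have finB: "finite ?B" using insert.prems by simp
  have "card ?T \<le> card (\<Union>b\<in>?B. (\<lambda>\<sigma>. \<sigma> \<circ> Transposition.transpose s b) ` ?U b)"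
    using finU finB by (intro card_mono[OF _ sub]) auto
  also have "\<dots> \<le> (\<Sum>b\<in>?B. card ((\<lambda>\<sigma>. \<sigma> \<circ> Transposition.transpose s b) ` ?U b))"
    by (rule card_UN_le[OF finB])
  also have "\<dots> \<le> (\<Sum>b\<in>?B. card (?U b))"
    by (intro sum_mono card_image_le finU)
  also have "\<dots> \<le> (\<Sum>b\<in>?B. fact (card A - card (insert s S) - 1))"
  proof (intro sum_mono)
    fix b assume b: "b \<in> ?B"
    then have "card (?U b) \<le> fact (card (A - {s, b}) - card S)"
      using insert.hyps insert.prems by (intro insert.IH) auto
    also have "card (A - {s, b}) - card S = card A - card (insert s S) - 1"
      using b insert.hyps insert.prems by (subst card_Diff_subset) auto
    finally show "card (?U b) \<le> fact (card A - card (insert s S) - 1)" .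
  qed
  also have "\<dots> = (card A - card (insert s S)) * fact (card A - card (insert s S) - 1)"
    using insert.hyps insert.prems by (subst sum_constant, subst card_Diff_subset) auto
  also have "\<dots> \<le> fact (card A - card (insert s S))"
    by (cases "card A - card (insert s S)") auto
  finally show ?case .
qed

(* x ^ card D is one of the terms of the sum of x ^ card S over the subsets S of D. *)
lemma sum_permutations_power_le:
  fixes x c :: real
  assumes A: "finite A" and x: "0 \<le> x" "0 \<le> c"
    and Q: "\<And>S. S \<subseteq> A \<Longrightarrow> real (card {\<tau>. \<tau> permutes A \<and> (\<forall>i\<in>S. Q \<tau> i)}) \<le> c ^ card S * fact (card A - card S)"
  shows "(\<Sum>\<tau>\<in>{\<tau>. \<tau> permutes A}. x ^ card {i\<in>A. Q \<tau> i}) \<le> fact (card A) * exp (c * x)"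
proof -
  let ?P = "{\<tau>. \<tau> permutes A}"
  have fin: "finite ?P" using A by (simp add: finite_permutations)
  have "(\<Sum>\<tau>\<in>?P. x ^ card {i\<in>A. Q \<tau> i}) \<le> (\<Sum>\<tau>\<in>?P. \<Sum>S\<in>Pow A. x ^ card S * of_bool (\<forall>i\<in>S. Q \<tau> i))"
  proof (intro sum_mono)
    fix \<tau>
    have "x ^ card {i\<in>A. Q \<tau> i} = (\<Sum>S\<in>{{i\<in>A. Q \<tau> i}}. x ^ card S * of_bool (\<forall>i\<in>S. Q \<tau> i))" by simp
    also have "\<dots> \<le> (\<Sum>S\<in>Pow A. x ^ card S * of_bool (\<forall>i\<in>S. Q \<tau> i))"
      using A x by (intro sum_mono2) auto
    finally show "x ^ card {i\<in>A. Q \<tau> i} \<le> (\<Sum>S\<in>Pow A. x ^ card S * of_bool (\<forall>i\<in>S. Q \<tau> i))" .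
  qed
  also have "\<dots> = (\<Sum>S\<in>Pow A. x ^ card S * real (card {\<tau>. \<tau> permutes A \<and> (\<forall>i\<in>S. Q \<tau> i)}))"
  proof (subst sum.swap, intro sum.cong refl)
    fix S
    show "(\<Sum>\<tau>\<in>?P. x ^ card S * of_bool (\<forall>i\<in>S. Q \<tau> i)) = x ^ card S * real (card {\<tau>. \<tau> permutes A \<and> (\<forall>i\<in>S. Q \<tau> i)})"
      unfolding sum_distrib_left[symmetric] sum_of_bool_card[OF fin] by simp
  qed
  also have "\<dots> \<le> (\<Sum>S\<in>Pow A. x ^ card S * (c ^ card S * fact (card A - card S)))"
    using x Q by (intro sum_mono mult_left_mono) auto
  \<comment> \<open>Grouped by size: the number of sets of size \<open>j\<close> times
    \<open>fact (card A - j)\<close> is \<open>fact (card A) / fact j\<close>, which produces the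
    exponential series.\<close>
  also have "\<dots> = (\<Sum>j\<le>card A. \<Sum>S\<in>{S\<in>Pow A. card S = j}. x ^ card S * (c ^ card S * fact (card A - card S)))"
    using A by (intro sum.group[symmetric]) (auto simp: card_mono)
  also have "\<dots> = (\<Sum>j\<le>card A. fact (card A) * ((c * x) ^ j / fact j))"
  proof (intro sum.cong refl)
    fix j assume j: "j \<in> {..card A}"
    have "(\<Sum>S\<in>{S\<in>Pow A. card S = j}. x ^ card S * (c ^ card S * fact (card A - card S)))
        = (\<Sum>S\<in>{S\<in>Pow A. card S = j}. (c * x) ^ j * fact (card A - j))"
      by (intro sum.cong refl) (auto simp: power_mult_distrib)
    also have "\<dots> = real (card A choose j) * ((c * x) ^ j * fact (card A - j))"
      using A n_subsets[OF A, of j] by simp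
    also have "\<dots> = fact (card A) * ((c * x) ^ j / fact j)"
      using j by (simp add: binomial_fact field_simps)
    finally show "(\<Sum>S\<in>{S\<in>Pow A. card S = j}. x ^ card S * (c ^ card S * fact (card A - card S)))
        = fact (card A) * ((c * x) ^ j / fact j)" .
  qed
  also have "\<dots> = fact (card A) * (\<Sum>j<Suc (card A). (c * x) ^ j / fact j)"
    by (simp add: sum_distrib_left lessThan_Suc_atMost)
  also have "\<dots> \<le> fact (card A) * exp (c * x)"
  proof (intro mult_left_mono)
    have "(\<Sum>j<Suc (card A). (c * x) ^ j / fact j) \<le> (\<Sum>j. (c * x) ^ j / fact j)"
      using x summable_exp[of "c * x"] by (intro sum_le_suminf) (auto simp: field_simps)
    then show "(\<Sum>j<Suc (card A). (c * x) ^ j / fact j) \<le> exp (c * x)"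
      by (simp add: exp_def field_simps)
  qed simp
  finally show ?thesis .
qed

section \<open>Resampling one permutation of a latent tuple\<close>

lemma latents_update:
  assumes "\<phi> \<in> latents m n" "0 < u" "u < m" "\<tau> permutes {1..n}"
  shows "\<phi>(u := \<tau>) \<in> latents m n"
  using assms by (auto simp: latents_def PiE_dflt_def)

text \<open>Exchanging the fresh permutation with the old entry \<open>\<phi> u\<close> is an
  involution on pairs, so replacing one nonzero coordinate by an independent uniform permutation
  preserves the uniform law.\<close>

lemma latents_resample:
  fixes h :: "(nat \<Rightarrow> nat \<Rightarrow> nat) \<Rightarrow> real"
  assumes u: "0 < u" "u < m"
  shows "(\<Sum>\<phi>\<in>latents m n. \<Sum>\<tau>\<in>{\<tau>. \<tau> permutes {1..n}}. h (\<phi>(u := \<tau>))) = fact n * (\<Sum>\<phi>\<in>latents m n. h \<phi>)"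
proof -
  let ?P = "{\<tau>. \<tau> permutes {1..n}}"
  let ?swap = "\<lambda>(\<phi>, \<tau>). (\<phi>(u := \<tau>), \<phi> u)"
  have mem: "?swap p \<in> latents m n \<times> ?P" if "p \<in> latents m n \<times> ?P" for p
    using that latents_update[OF _ u] latents_permutes[OF _ u(2)] by auto
  have bij: "bij_betw ?swap (latents m n \<times> ?P) (latents m n \<times> ?P)"
    using mem by (intro bij_betw_byWitness[where f' = ?swap]) (auto simp del: mem_Sigma_iff)
  have "(\<Sum>\<phi>\<in>latents m n. \<Sum>\<tau>\<in>?P. h (\<phi>(u := \<tau>))) = (\<Sum>p\<in>latents m n \<times> ?P. h (fst (?swap p)))"
    by (simp add: sum.cartesian_product case_prod_unfold)
  also have "\<dots> = (\<Sum>p\<in>latents m n \<times> ?P. h (fst p))"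
    by (rule sum.reindex_bij_betw[OF bij, where g = "\<lambda>p. h (fst p)"])
  also have "\<dots> = (\<Sum>\<phi>\<in>latents m n. \<Sum>\<tau>\<in>?P. h \<phi>)"
    by (simp only: sum.cartesian_product' fst_conv)
  also have "\<dots> = fact n * (\<Sum>\<phi>\<in>latents m n. h \<phi>)"
    by (simp add: card_permutations sum_distrib_left)
  finally show ?thesis .
qed

text \<open>A bound on the conditional mean given the other coordinates suffices. The bound
  \<open>B\<close> may depend on \<phi>, which the induction in \<open>repeats_moment\<close>
  exploits.\<close>

lemma latents_resample_le:
  fixes h B :: "(nat \<Rightarrow> nat \<Rightarrow> nat) \<Rightarrow> real"
  assumes u: "0 < u" "u < m"
    and h: "\<And>\<phi>. \<phi> \<in> latents m n \<Longrightarrow> (\<Sum>\<tau>\<in>{\<tau>. \<tau> permutes {1..n}}. h (\<phi>(u := \<tau>))) \<le> fact n * B \<phi>"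
  shows "(\<Sum>\<phi>\<in>latents m n. h \<phi>) \<le> (\<Sum>\<phi>\<in>latents m n. B \<phi>)"
proof -
  have "fact n * (\<Sum>\<phi>\<in>latents m n. h \<phi>) \<le> (\<Sum>\<phi>\<in>latents m n. fact n * B \<phi>)"
    unfolding latents_resample[OF u, symmetric] by (intro sum_mono h)
  then show ?thesis by (simp add: sum_distrib_left[symmetric])
qed

section \<open>Statistics of the agreement between permutations\<close>

definition agree :: "nat \<Rightarrow> nat \<Rightarrow> nat \<Rightarrow> (nat \<Rightarrow> nat \<Rightarrow> nat) \<Rightarrow> nat" where
  "agree n k l \<phi> = card {i\<in>{1..n}. \<phi> k i = \<phi> l i}"

text \<open>For permutations, the number of 2-cycles of the inverse of \<open>\<phi> l\<close>
  composed with \<open>\<phi> k\<close>, each counted at its smaller point; \<open>agree\<close> is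
  the number of fixed points of the same permutation.\<close>

definition swapped :: "nat \<Rightarrow> nat \<Rightarrow> nat \<Rightarrow> (nat \<Rightarrow> nat \<Rightarrow> nat) \<Rightarrow> nat" where
  "swapped n k l \<phi> = card {i\<in>{1..n}. \<exists>j\<in>{1..n}. i < j \<and> \<phi> k i = \<phi> l j \<and> \<phi> k j = \<phi> l i}"

text \<open>For permutations, the number of points where the inverse of \<open>\<phi> l\<close>
  composed with \<open>\<phi> k\<close> agrees with the inverse of \<open>\<phi> l'\<close> composed
  with \<open>\<phi> k'\<close>. Counting pairs instead of points makes the symmetry
  \<open>paired_flip\<close> a mere exchange of coordinates.\<close>

definition paired :: "nat \<Rightarrow> nat \<Rightarrow> nat \<Rightarrow> nat \<Rightarrow> nat \<Rightarrow> (nat \<Rightarrow> nat \<Rightarrow> nat) \<Rightarrow> nat" where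
  "paired n k l k' l' \<phi> = card {(i, j)\<in>{1..n} \<times> {1..n}. \<phi> k i = \<phi> l j \<and> \<phi> k' i = \<phi> l' j}"

lemma agree_commute: "agree n k l = agree n l k"
  by (auto simp: agree_def fun_eq_iff intro!: arg_cong[where f = card])

lemma swapped_commute: "swapped n k l = swapped n l k"
  by (auto simp: swapped_def fun_eq_iff intro!: arg_cong[where f = card])

lemma paired_commute: "paired n k l k' l' = paired n k' l' k l"
  by (auto simp: paired_def fun_eq_iff intro!: arg_cong[where f = card])

lemma paired_flip: "paired n k l k' l' = paired n l k l' k'"
proof (rule ext)
  fix \<phi> :: "nat \<Rightarrow> nat \<Rightarrow> nat"
  have "bij_betw prod.swap {(i, j)\<in>{1..n} \<times> {1..n}. \<phi> k i = \<phi> l j \<and> \<phi> k' i = \<phi> l' j}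
      {(i, j)\<in>{1..n} \<times> {1..n}. \<phi> l i = \<phi> k j \<and> \<phi> l' i = \<phi> k' j}"
    by (rule bij_betw_byWitness[where f' = prod.swap]) auto
  then show "paired n k l k' l' \<phi> = paired n l k l' k' \<phi>"
    unfolding paired_def by (rule bij_betw_same_card)
qed

lemma sum_permutations_agree_le:
  fixes x :: real
  assumes "0 \<le> x"
  shows "(\<Sum>\<tau>\<in>{\<tau>. \<tau> permutes {1..n}}. x ^ card {i\<in>{1..n}. \<tau> i = g i}) \<le> fact n * exp x"
proof -
  have "(\<Sum>\<tau>\<in>{\<tau>. \<tau> permutes {1..n}}. x ^ card {i\<in>{1..n}. \<tau> i = g i}) \<le> fact (card {1..n}) * exp (1 * x)"
  proof (rule sum_permutations_power_le)
    fix S :: "nat set" assume S: "S \<subseteq> {1..n}"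
    show "real (card {\<tau>. \<tau> permutes {1..n} \<and> (\<forall>i\<in>S. \<tau> i = g i)}) \<le> 1 ^ card S * fact (card {1..n} - card S)"
      using of_nat_mono[OF card_permutations_prescribed_le[OF finite_atLeastAtMost S, of g], where 'a = real] by simp
  qed (use assms in auto)
  then show ?thesis by simp
qed

lemma permutes_inv_eq_iff:
  assumes "\<sigma> permutes A"
  shows "inv_into UNIV \<sigma> x = y \<longleftrightarrow> x = \<sigma> y"
  using permutes_inverses[OF assms] by metis

lemma agree_moment:
  fixes x :: real
  assumes x: "0 \<le> x" and kl: "(k, l) \<in> off_pairs m"
  shows "(\<Sum>\<phi>\<in>latents m n. x ^ agree n k l \<phi>) \<le> card (latents m n) * exp x"
proof -
  have *: "(\<Sum>\<phi>\<in>latents m n. x ^ agree n k l \<phi>) \<le> (\<Sum>\<phi>\<in>latents m n. exp x)"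
    if "0 < k" "k < m" "k \<noteq> l" for k l
  proof (rule latents_resample_le[OF that(1,2)])
    fix \<phi> assume "\<phi> \<in> latents m n"
    show "(\<Sum>\<tau>\<in>{\<tau>. \<tau> permutes {1..n}}. x ^ agree n k l (\<phi>(k := \<tau>))) \<le> fact n * exp x"
      using sum_permutations_agree_le[OF x, where g = "\<phi> l"] that(3) by (simp add: agree_def)
  qed
  have "(\<Sum>\<phi>\<in>latents m n. x ^ agree n k l \<phi>) \<le> (\<Sum>\<phi>\<in>latents m n. exp x)"
  \<comment> \<open>The permutation of copy 0 is the identity and cannot be resampled; the other
    index of the pair is then nonzero.\<close>
  proof (cases "k = 0")
    case True
    then show ?thesis unfolding agree_commute[of n k l] using kl by (intro *) (auto simp: off_pairs_def)
  next
    case False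
    then show ?thesis using kl by (intro *) (auto simp: off_pairs_def)
  qed
  then show ?thesis by simp
qed

text \<open>Since index \<open>k\<close> occurs in only one place, the other three permutations can
  be held fixed. A matched \<open>i\<close> then forces \<open>j\<close>, and
  \<open>\<phi> k i\<close> must equal a prescribed value \<open>g i\<close>, so only prescribed
  coincidences of one uniform permutation are counted.\<close>

lemma paired_moment_unique:
  fixes x :: real
  assumes x: "1 \<le> x" and u: "0 < k" "k < m" "l < m" "k' < m" "l' < m" and uniq: "k \<noteq> l" "k \<noteq> k'" "k \<noteq> l'"
  shows "(\<Sum>\<phi>\<in>latents m n. x ^ paired n k l k' l' \<phi>) \<le> (\<Sum>\<phi>\<in>latents m n. exp x)"
proof (rule latents_resample_le[OF u(1,2)])
  fix \<phi> assume \<phi>: "\<phi> \<in> latents m n"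
  define g where "g i = \<phi> l (inv_into UNIV (\<phi> l') (\<phi> k' i))" for i
  have perm: "\<phi> l' permutes {1..n}" using latents_permutes[OF \<phi> u(5)] .
  have "paired n k l k' l' (\<phi>(k := \<tau>)) \<le> card {i\<in>{1..n}. \<tau> i = g i}" for \<tau>
    unfolding paired_def
  proof (rule card_inj_on_le[where f = fst])
    let ?S = "{(i, j)\<in>{1..n} \<times> {1..n}. (\<phi>(k := \<tau>)) k i = (\<phi>(k := \<tau>)) l j \<and> (\<phi>(k := \<tau>)) k' i = (\<phi>(k := \<tau>)) l' j}"
    have S: "\<tau> i = \<phi> l j \<and> j = inv_into UNIV (\<phi> l') (\<phi> k' i)" if "(i, j) \<in> ?S" for i j
      using that uniq permutes_inv_eq_iff[OF perm, of "\<phi> k' i" j] by auto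
    show "inj_on fst ?S"
    proof (rule inj_onI)
      fix p q assume pq: "p \<in> ?S" "q \<in> ?S" "fst p = fst q"
      obtain i j i' j' where eqs: "p = (i, j)" "q = (i', j')" by (cases p, cases q)
      show "p = q" using S[OF pq(1)[unfolded eqs]] S[OF pq(2)[unfolded eqs]] pq(3) by (simp add: eqs)
    qed
    show "fst ` ?S \<subseteq> {i\<in>{1..n}. \<tau> i = g i}"
    proof
      fix i assume "i \<in> fst ` ?S"
      then obtain j where j: "(i, j) \<in> ?S" by auto
      then show "i \<in> {i\<in>{1..n}. \<tau> i = g i}" using S[OF j] by (auto simp: g_def)
    qed
  qed simp
  then have "(\<Sum>\<tau>\<in>{\<tau>. \<tau> permutes {1..n}}. x ^ paired n k l k' l' (\<phi>(k := \<tau>)))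
      \<le> (\<Sum>\<tau>\<in>{\<tau>. \<tau> permutes {1..n}}. x ^ card {i\<in>{1..n}. \<tau> i = g i})"
    using x by (intro sum_mono power_increasing) auto
  also have "\<dots> \<le> fact n * exp x"
    using x by (intro sum_permutations_agree_le) auto
  finally show "(\<Sum>\<tau>\<in>{\<tau>. \<tau> permutes {1..n}}. x ^ paired n k l k' l' (\<phi>(k := \<tau>))) \<le> fact n * exp x" .
qed

(* Unless the two pairs agree up to order, some nonzero index occurs in only one of the four places. *)
lemma paired_moment:
  fixes x :: real
  assumes x: "1 \<le> x" and kl: "(k, l) \<in> off_pairs m" "(k', l') \<in> off_pairs m - {(k, l), (l, k)}"
  shows "(\<Sum>\<phi>\<in>latents m n. x ^ paired n k l k' l' \<phi>) \<le> card (latents m n) * exp x"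
proof -
  have lt: "k < m" "l < m" "k' < m" "l' < m" using kl by (auto simp: off_pairs_def)
  have neq: "k \<noteq> l" "k' \<noteq> l'" "\<not> (k' = k \<and> l' = l)" "\<not> (k' = l \<and> l' = k)"
    using kl by (auto simp: off_pairs_def)
  consider "0 < k" "k \<noteq> l" "k \<noteq> k'" "k \<noteq> l'" | "0 < l" "l \<noteq> k" "l \<noteq> l'" "l \<noteq> k'"
    | "0 < k'" "k' \<noteq> l'" "k' \<noteq> k" "k' \<noteq> l" | "0 < l'" "l' \<noteq> k'" "l' \<noteq> l" "l' \<noteq> k"
    using neq by fastforce
  then have "(\<Sum>\<phi>\<in>latents m n. x ^ paired n k l k' l' \<phi>) \<le> (\<Sum>\<phi>\<in>latents m n. exp x)"
  proof cases
    case 1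
    then show ?thesis using lt by (intro paired_moment_unique x)
  next
    case 2
    then show ?thesis unfolding paired_flip[of n k l k' l'] using lt by (intro paired_moment_unique x)
  next
    case 3
    then show ?thesis unfolding paired_commute[of n k l k' l'] using lt by (intro paired_moment_unique x)
  next
    case 4
    then show ?thesis unfolding paired_commute[of n k l k' l'] paired_flip[of n k' l' k l]
      using lt by (intro paired_moment_unique x)
  qed
  then show ?thesis by simp
qed

text \<open>Here the resampled permutation enters each match twice, so values cannot simply be
  prescribed. Written as \<open>\<phi> l\<close> after a uniform \<open>\<tau>\<close>, its swaps
  with \<open>\<phi> l\<close> become the 2-cycles of \<open>\<tau>\<close>, to which
  \<open>card_permutations_paired_le\<close> applies.\<close>

lemma swapped_moment:
  fixes x :: real
  assumes x: "1 \<le> x" and kl: "(k, l) \<in> off_pairs m"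
  shows "(\<Sum>\<phi>\<in>latents m n. x ^ swapped n k l \<phi>) \<le> card (latents m n) * exp x"
proof -
  let ?P = "{\<tau>. \<tau> permutes {1..n}}"
  have *: "(\<Sum>\<phi>\<in>latents m n. x ^ swapped n k l \<phi>) \<le> (\<Sum>\<phi>\<in>latents m n. exp x)"
    if k: "0 < k" "k < m" "l < m" "k \<noteq> l" for k l
  proof (rule latents_resample_le[OF k(1,2)])
    fix \<phi> assume \<phi>: "\<phi> \<in> latents m n"
    have perm: "\<phi> l permutes {1..n}" using latents_permutes[OF \<phi> k(3)] .
    have bij: "bij_betw ((\<circ>) (\<phi> l)) ?P ?P"
      by (rule bij_betw_byWitness[where f' = "(\<circ>) (inv_into UNIV (\<phi> l))"])
        (auto simp: fun_eq_iff permutes_inverses[OF perm] intro!: permutes_compose perm permutes_inv)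
    have le: "swapped n k l (\<phi>(k := \<phi> l \<circ> \<tau>)) = card {i\<in>{1..n}. \<tau> (\<tau> i) = i \<and> i < \<tau> i}" if "\<tau> permutes {1..n}" for \<tau>
    proof -
      have inj: "\<phi> l a = \<phi> l b \<longleftrightarrow> a = b" for a b using permutes_inj[OF perm] by (auto simp: inj_def)
      have "\<tau> i \<in> {1..n}" if "i \<in> {1..n}" for i
        using permutes_in_image[OF \<open>\<tau> permutes {1..n}\<close>] that by blast
      then show ?thesis
        using k(4) unfolding swapped_def by (auto simp: inj intro!: arg_cong[where f = card])
    qed
    have "(\<Sum>\<tau>\<in>?P. x ^ swapped n k l (\<phi>(k := \<tau>))) = (\<Sum>\<tau>\<in>?P. x ^ swapped n k l (\<phi>(k := \<phi> l \<circ> \<tau>)))"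
      by (rule sum.reindex_bij_betw[OF bij, symmetric])
    also have "\<dots> = (\<Sum>\<tau>\<in>?P. x ^ card {i\<in>{1..n}. \<tau> (\<tau> i) = i \<and> i < \<tau> i})"
      by (intro sum.cong refl) (simp add: le)
    also have "\<dots> \<le> fact (card {1..n}) * exp (1 * x)"
    proof (rule sum_permutations_power_le)
      fix S :: "nat set" assume S: "S \<subseteq> {1..n}"
      have "card {\<tau>. \<tau> permutes {1..n} \<and> (\<forall>i\<in>S. \<tau> (\<tau> i) = i \<and> i < \<tau> i)}
          \<le> card {\<tau>. \<tau> permutes {1..n} \<and> (\<forall>i\<in>S. \<tau> (\<tau> i) = i \<and> \<tau> i \<notin> S)}"
      proof (rule card_mono)
        show "finite {\<tau>. \<tau> permutes {1..n} \<and> (\<forall>i\<in>S. \<tau> (\<tau> i) = i \<and> \<tau> i \<notin> S)}"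
          by (rule finite_subset[OF _ finite_permutations[of "{1..n}"]]) auto
        show "{\<tau>. \<tau> permutes {1..n} \<and> (\<forall>i\<in>S. \<tau> (\<tau> i) = i \<and> i < \<tau> i)}
            \<subseteq> {\<tau>. \<tau> permutes {1..n} \<and> (\<forall>i\<in>S. \<tau> (\<tau> i) = i \<and> \<tau> i \<notin> S)}"
        proof clarify
          fix \<tau> i assume "\<forall>i\<in>S. \<tau> (\<tau> i) = i \<and> i < \<tau> i" "i \<in> S"
          \<comment> \<open>If \<open>\<tau> i\<close> were also in \<open>S\<close>, then
            \<open>i < \<tau> i < \<tau> (\<tau> i) = i\<close>. This is why the 2-cycles are
            counted at their smaller point.\<close>
          then have "\<tau> i \<notin> S" by (metis less_asym)
          then show "\<tau> (\<tau> i) = i \<and> \<tau> i \<notin> S" using \<open>\<forall>i\<in>S. _\<close> \<open>i \<in> S\<close> by blast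
        qed
      qed
      also have "\<dots> \<le> fact (card {1..n} - card S)"
        by (rule card_permutations_paired_le[OF _ S]) simp
      finally have le: "card {\<tau>. \<tau> permutes {1..n} \<and> (\<forall>i\<in>S. \<tau> (\<tau> i) = i \<and> i < \<tau> i)}
          \<le> fact (card {1..n} - card S)" .
      then show "real (card {\<tau>. \<tau> permutes {1..n} \<and> (\<forall>i\<in>S. \<tau> (\<tau> i) = i \<and> i < \<tau> i)})
          \<le> 1 ^ card S * fact (card {1..n} - card S)"
        using of_nat_mono[OF le, where 'a = real] by simp
    qed (use x in auto)
    finally show "(\<Sum>\<tau>\<in>?P. x ^ swapped n k l (\<phi>(k := \<tau>))) \<le> fact n * exp x" by simp
  qed
  have "(\<Sum>\<phi>\<in>latents m n. x ^ swapped n k l \<phi>) \<le> (\<Sum>\<phi>\<in>latents m n. exp x)"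
  proof (cases "k = 0")
    case True
    then show ?thesis unfolding swapped_commute[of n k l] using kl by (intro *) (auto simp: off_pairs_def)
  next
    case False
    then show ?thesis using kl by (intro *) (auto simp: off_pairs_def)
  qed
  then show ?thesis by simp
qed

text \<open>Two choices of the second pair are excluded from \<open>paired\<close>. The same pair
  always gives the count \<open>n\<close> and is absent from \<open>cross\<close> too; for the
  reversed pair every index occurs twice, so resampling one place is impossible and
  \<open>paired_reverse_le\<close> is used instead.\<close>

definition statistics :: "nat \<Rightarrow> nat \<Rightarrow> ((nat \<Rightarrow> nat \<Rightarrow> nat) \<Rightarrow> nat) set" where
  "statistics m n = (\<lambda>(k, l). agree n k l) ` off_pairs m \<union> (\<lambda>(k, l). swapped n k l) ` off_pairs m
     \<union> (\<lambda>((k, l), (k', l')). paired n k l k' l') ` (SIGMA (k, l):off_pairs m. off_pairs m - {(k, l), (l, k)})"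

definition peak :: "nat \<Rightarrow> nat \<Rightarrow> (nat \<Rightarrow> nat \<Rightarrow> nat) \<Rightarrow> nat" where
  "peak m n \<phi> = Max (insert 0 ((\<lambda>f. f \<phi>) ` statistics m n))"

lemma finite_statistics [simp]: "finite (statistics m n)"
  unfolding statistics_def
  by (intro finite_UnI finite_imageI finite_off_pairs
      finite_subset[of "SIGMA (k, l):off_pairs m. off_pairs m - {(k, l), (l, k)}" "off_pairs m \<times> off_pairs m"]) auto

lemma statistics_le_peak: "f \<in> statistics m n \<Longrightarrow> f \<phi> \<le> peak m n \<phi>"
  unfolding peak_def by (intro Max_ge) auto

lemma agree_le_peak: "(k, l) \<in> off_pairs m \<Longrightarrow> agree n k l \<phi> \<le> peak m n \<phi>"
  by (intro statistics_le_peak[unfolded statistics_def] UnI1 rev_image_eqI[of "(k, l)"]) auto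

lemma swapped_le_peak: "(k, l) \<in> off_pairs m \<Longrightarrow> swapped n k l \<phi> \<le> peak m n \<phi>"
  by (intro statistics_le_peak[unfolded statistics_def] UnI1 UnI2[of _ "(\<lambda>(k, l). swapped n k l) ` off_pairs m"]
      rev_image_eqI[of "(k, l)" "off_pairs m" _ "\<lambda>(k, l). swapped n k l"]) auto

text \<open>The matched pairs split by \<open>i = j\<close>, \<open>i < j\<close> and
  \<open>j < i\<close>: the diagonal ones are agreements, and each of the other two parts embeds
  into the swaps, by its smaller coordinate.\<close>

lemma paired_reverse_le:
  assumes "\<phi> \<in> latents m n" "(k, l) \<in> off_pairs m"
  shows "paired n k l l k \<phi> \<le> agree n k l \<phi> + 2 * swapped n k l \<phi>"
proof -
  have kl: "k < m" "l < m" using assms(2) by (auto simp: off_pairs_def)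
  have inj: "\<phi> k a = \<phi> k b \<longleftrightarrow> a = b" "\<phi> l a = \<phi> l b \<longleftrightarrow> a = b" for a b
    by (rule inj_eq[OF permutes_inj[OF latents_permutes[OF assms(1) kl(1)]]],
        rule inj_eq[OF permutes_inj[OF latents_permutes[OF assms(1) kl(2)]]])
  let ?V = "{(i, j)\<in>{1..n} \<times> {1..n}. \<phi> k i = \<phi> l j \<and> \<phi> l i = \<phi> k j}"
  let ?S = "{i\<in>{1..n}. \<exists>j\<in>{1..n}. i < j \<and> \<phi> k i = \<phi> l j \<and> \<phi> k j = \<phi> l i}"
  have "card ?V \<le> card (?V \<inter> {(i, j). i = j} \<union> ?V \<inter> {(i, j). i < j} \<union> ?V \<inter> {(i, j). j < i})"
  proof (rule card_mono)
    have "finite ?V" by (rule finite_subset[of _ "{1..n} \<times> {1..n}"]) auto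
    then show "finite (?V \<inter> {(i, j). i = j} \<union> ?V \<inter> {(i, j). i < j} \<union> ?V \<inter> {(i, j). j < i})"
      by (intro finite_UnI finite_Int disjI1)
  qed auto
  also have "\<dots> \<le> card (?V \<inter> {(i, j). i = j}) + card (?V \<inter> {(i, j). i < j}) + card (?V \<inter> {(i, j). j < i})"
    by (rule order_trans[OF card_Un_le add_right_mono[OF card_Un_le]])
  also have "card (?V \<inter> {(i, j). i = j}) \<le> agree n k l \<phi>"
    unfolding agree_def by (rule card_inj_on_le[where f = fst]) (auto simp: inj_on_def)
  also have "card (?V \<inter> {(i, j). i < j}) \<le> swapped n k l \<phi>"
    unfolding swapped_def
  proof (rule card_inj_on_le[where f = fst])
    show "inj_on fst (?V \<inter> {(i, j). i < j})"
    proof (rule inj_onI)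
      fix p q assume pq: "p \<in> ?V \<inter> {(i, j). i < j}" "q \<in> ?V \<inter> {(i, j). i < j}" "fst p = fst q"
      obtain i j i' j' where eqs: "p = (i, j)" "q = (i', j')" by (cases p, cases q)
      have "\<phi> l j = \<phi> l j'" using pq unfolding eqs by simp
      then show "p = q" using pq(3) inj(2) by (simp add: eqs)
    qed
    show "fst ` (?V \<inter> {(i, j). i < j}) \<subseteq> ?S"
    proof
      fix i assume "i \<in> fst ` (?V \<inter> {(i, j). i < j})"
      then obtain j where "(i, j) \<in> ?V" "i < j" by auto
      then show "i \<in> ?S" by (auto intro!: bexI[of _ j])
    qed
  qed simp
  also have "card (?V \<inter> {(i, j). j < i}) \<le> swapped n k l \<phi>"
    unfolding swapped_def
  proof (rule card_inj_on_le[where f = snd])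
    show "inj_on snd (?V \<inter> {(i, j). j < i})"
    proof (rule inj_onI)
      fix p q assume pq: "p \<in> ?V \<inter> {(i, j). j < i}" "q \<in> ?V \<inter> {(i, j). j < i}" "snd p = snd q"
      obtain i j i' j' where eqs: "p = (i, j)" "q = (i', j')" by (cases p, cases q)
      have "\<phi> l i = \<phi> l i'" using pq unfolding eqs by simp
      then show "p = q" using pq(3) inj(2) by (simp add: eqs)
    qed
    show "snd ` (?V \<inter> {(i, j). j < i}) \<subseteq> ?S"
    proof
      fix j assume "j \<in> snd ` (?V \<inter> {(i, j). j < i})"
      then obtain i where "(i, j) \<in> ?V" "j < i" by auto
      then show "j \<in> ?S" by (auto intro!: bexI[of _ i])
    qed
  qed simp
  finally show ?thesis unfolding paired_def by simp
qed

lemma paired_le_peak: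
  assumes "\<phi> \<in> latents m n" "(k, l) \<in> off_pairs m" "(k', l') \<in> off_pairs m - {(k, l)}"
  shows "paired n k l k' l' \<phi> \<le> 3 * peak m n \<phi>"
proof (cases "(k', l') = (l, k)")
  case True
  then show ?thesis
    using paired_reverse_le[OF assms(1,2)] agree_le_peak[OF assms(2), of n \<phi>] swapped_le_peak[OF assms(2), of n \<phi>] by simp
next
  case False
  then have "paired n k l k' l' \<in> statistics m n"
    using assms unfolding statistics_def
    by (intro UnI2 rev_image_eqI[of "((k, l), (k', l'))"]) auto
  then show ?thesis using statistics_le_peak[of "paired n k l k' l'" m n \<phi>] by simp
qed

lemma card_statistics: "card (statistics m n) \<le> 3 * m ^ 4"
proof -
  have P: "card (off_pairs m) \<le> m ^ 2"
    using card_mono[of "{..<m} \<times> {..<m}" "off_pairs m"] by (auto simp: off_pairs_def power2_eq_square)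
  have m2: "m ^ 2 \<le> m ^ 4" by (cases "m = 0") (auto intro: power_increasing)
  have "card (SIGMA (k, l):off_pairs m. off_pairs m - {(k, l), (l, k)}) \<le> card (off_pairs m \<times> off_pairs m)"
    by (intro card_mono) auto
  also have "\<dots> \<le> m ^ 2 * m ^ 2" unfolding card_cartesian_product by (intro mult_mono P) auto
  finally have S: "card (SIGMA (k, l):off_pairs m. off_pairs m - {(k, l), (l, k)}) \<le> m ^ 4"
    by (simp add: power_add[symmetric])
  have "card (statistics m n) \<le> card ((\<lambda>(k, l). agree n k l) ` off_pairs m)
      + card ((\<lambda>(k, l). swapped n k l) ` off_pairs m)
      + card ((\<lambda>((k, l), (k', l')). paired n k l k' l') ` (SIGMA (k, l):off_pairs m. off_pairs m - {(k, l), (l, k)}))"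
    unfolding statistics_def by (rule order_trans[OF card_Un_le add_right_mono[OF card_Un_le]])
  also have "\<dots> \<le> card (off_pairs m) + card (off_pairs m) + card (SIGMA (k, l):off_pairs m. off_pairs m - {(k, l), (l, k)})"
    by (intro add_mono card_image_le) auto
  finally show ?thesis using P m2 S by linarith
qed

text \<open>The maximum is 0 or one of the statistics, so its power is at most 1 plus the sum of all
  their powers. The number of statistics is bounded in terms of \<open>m\<close> alone.\<close>

lemma peak_moment:
  fixes x :: real
  assumes x: "1 \<le> x"
  shows "(\<Sum>\<phi>\<in>latents m n. x ^ peak m n \<phi>) \<le> (3 * real m ^ 4 + 1) * card (latents m n) * exp x"
proof -
  have pk: "x ^ peak m n \<phi> \<le> 1 + (\<Sum>f\<in>statistics m n. x ^ f \<phi>)" for \<phi>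
  proof -
    have "peak m n \<phi> \<in> insert 0 ((\<lambda>f. f \<phi>) ` statistics m n)"
      unfolding peak_def by (intro Max_in) auto
    then consider "peak m n \<phi> = 0" | f where "f \<in> statistics m n" "peak m n \<phi> = f \<phi>" by auto
    then show ?thesis
    proof cases
      case 1
      then show ?thesis using x by (auto intro!: sum_nonneg)
    next
      case 2
      then have "x ^ f \<phi> \<le> (\<Sum>f\<in>statistics m n. x ^ f \<phi>)"
        using x by (intro member_le_sum) auto
      then show ?thesis using 2 by simp
    qed
  qed
  have stat: "(\<Sum>\<phi>\<in>latents m n. x ^ f \<phi>) \<le> card (latents m n) * exp x" if "f \<in> statistics m n" for f
  proof -
    consider k l where "(k, l) \<in> off_pairs m" "f = agree n k l"
      | k l where "(k, l) \<in> off_pairs m" "f = swapped n k l"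
      | k l k' l' where "(k, l) \<in> off_pairs m" "(k', l') \<in> off_pairs m - {(k, l), (l, k)}" "f = paired n k l k' l'"
      using \<open>f \<in> statistics m n\<close> unfolding statistics_def by (elim UnE imageE SigmaE) (auto split: prod.splits)
    then show ?thesis
    proof cases
      case 1
      then show ?thesis using x agree_moment[of x k l m n] by simp
    next
      case 2
      then show ?thesis using x swapped_moment[of x k l m n] by simp
    next
      case 3
      then show ?thesis using x paired_moment[of x k l m k' l' n] by simp
    qed
  qed
  have "(\<Sum>\<phi>\<in>latents m n. x ^ peak m n \<phi>) \<le> (\<Sum>\<phi>\<in>latents m n. 1 + (\<Sum>f\<in>statistics m n. x ^ f \<phi>))"
    by (intro sum_mono pk)
  also have "\<dots> = card (latents m n) + (\<Sum>f\<in>statistics m n. \<Sum>\<phi>\<in>latents m n. x ^ f \<phi>)"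
    by (simp add: sum.distrib) (rule sum.swap)
  also have "\<dots> \<le> card (latents m n) * exp x + (\<Sum>f\<in>statistics m n. card (latents m n) * exp x)"
  proof (intro add_mono sum_mono stat)
    have "1 \<le> exp x" using x by simp
    then have "real (card (latents m n)) * 1 \<le> real (card (latents m n)) * exp x" by (intro mult_left_mono) auto
    then show "real (card (latents m n)) \<le> card (latents m n) * exp x" by simp
  qed
  also have "\<dots> = (card (statistics m n) + 1) * (card (latents m n) * exp x)"
    by (simp add: algebra_simps)
  also have "\<dots> \<le> (3 * real m ^ 4 + 1) * (card (latents m n) * exp x)"
    using card_statistics[of m n] of_nat_mono[OF card_statistics[of m n], where 'a = real]
    by (intro mult_right_mono) auto
  finally show ?thesis by (simp add: mult.assoc)
qed

section \<open>Repeated values: \<open>m\<close> minus the number of distinct values, summed over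
  the vertices\<close>

definition repeats :: "nat \<Rightarrow> nat \<Rightarrow> (nat \<Rightarrow> nat \<Rightarrow> nat) \<Rightarrow> nat" where
  "repeats m n \<phi> = (\<Sum>k<m. card {i\<in>{1..n}. \<exists>l<k. \<phi> k i = \<phi> l i})"

text \<open>Wherever two copies agree, the later of them repeats an earlier value.\<close>

lemma agree_le_repeats:
  assumes "(k, l) \<in> off_pairs m"
  shows "agree n k l \<phi> \<le> repeats m n \<phi>"
proof -
  have *: "agree n k l \<phi> \<le> repeats m n \<phi>" if "l < k" "k < m" for k l
  proof -
    have "agree n k l \<phi> \<le> card {i\<in>{1..n}. \<exists>l<k. \<phi> k i = \<phi> l i}"
      unfolding agree_def using that by (intro card_mono) auto
    also have "\<dots> \<le> repeats m n \<phi>"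
      unfolding repeats_def using that by (intro member_le_sum) auto
    finally show ?thesis .
  qed
  show ?thesis
    using assms *[of l k] *[of k l] by (cases "l < k") (auto simp: off_pairs_def agree_commute[of n k l])
qed

text \<open>The permutations are exposed in the order of the copies. A repeat in copy
  \<open>j\<close> hits one of at most \<open>m\<close> values already present at its vertex, and
  the counts of earlier copies do not involve \<open>\<phi> j\<close>; hence each copy multiplies
  the mean by at most \<open>exp (m * x)\<close>. At \<open>x = n\<close> this expresses that
  \<open>D\<close> repeats cost a factor \<open>n ^ D\<close>, up to
  \<open>exp (m^2 * n)\<close>.\<close>

lemma repeats_moment:
  fixes x :: real
  assumes x: "0 \<le> x"
  shows "(\<Sum>\<phi>\<in>latents m n. x ^ repeats m n \<phi>) \<le> card (latents m n) * exp (real m * x) ^ m"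
proof -
  let ?D = "\<lambda>k \<phi>. card {i\<in>{1..n}. \<exists>l<k. \<phi> k i = \<phi> l i}"
  have "(\<Sum>\<phi>\<in>latents m n. x ^ (\<Sum>k<j. ?D k \<phi>)) \<le> card (latents m n) * exp (real m * x) ^ j" if "j \<le> m" for j
    using that
  proof (induction j)
    case (Suc j)
    show ?case
    proof (cases "j = 0")
      \<comment> \<open>Copy 0 is not random, but it has no earlier copy and therefore no
        repeats.\<close>
      case True
      have "1 \<le> exp (real m * x)" using x by simp
      then have "real (card (latents m n)) * 1 \<le> real (card (latents m n)) * exp (real m * x)" by (intro mult_left_mono) auto
      then show ?thesis using True by simp
    next
      case False
      then have j: "0 < j" "j < m" using Suc.prems by auto
      have "(\<Sum>\<phi>\<in>latents m n. x ^ (\<Sum>k<Suc j. ?D k \<phi>)) \<le> (\<Sum>\<phi>\<in>latents m n. exp (real m * x) * x ^ (\<Sum>k<j. ?D k \<phi>))"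
      proof (rule latents_resample_le[OF j])
        fix \<phi> assume "\<phi> \<in> latents m n"
        have prev: "(\<Sum>k<j. ?D k (\<phi>(j := \<tau>))) = (\<Sum>k<j. ?D k \<phi>)" for \<tau>
        proof (intro sum.cong refl arg_cong[where f = card] Collect_cong conj_cong)
          fix k i assume "k \<in> {..<j}"
          then show "(\<exists>l<k. (\<phi>(j := \<tau>)) k i = (\<phi>(j := \<tau>)) l i) \<longleftrightarrow> (\<exists>l<k. \<phi> k i = \<phi> l i)"
            by (intro ex_cong1 conj_cong) auto
        qed
        have last: "?D j (\<phi>(j := \<tau>)) = card {i\<in>{1..n}. \<tau> i \<in> (\<lambda>l. \<phi> l i) ` {..<j}}" for \<tau>
          by (intro arg_cong[where f = card]) force
        have "(\<Sum>\<tau>\<in>{\<tau>. \<tau> permutes {1..n}}. x ^ card {i\<in>{1..n}. \<tau> i \<in> (\<lambda>l. \<phi> l i) ` {..<j}})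
            \<le> fact (card {1..n}) * exp (real m * x)"
        proof (rule sum_permutations_power_le)
          fix S :: "nat set" assume S: "S \<subseteq> {1..n}"
          have le: "card {\<tau>. \<tau> permutes {1..n} \<and> (\<forall>i\<in>S. \<tau> i \<in> (\<lambda>l. \<phi> l i) ` {..<j})}
              \<le> m ^ card S * fact (card {1..n} - card S)"
            using j by (intro card_permutations_choice_le S) (auto intro: order_trans[OF card_image_le])
          then show "real (card {\<tau>. \<tau> permutes {1..n} \<and> (\<forall>i\<in>S. \<tau> i \<in> (\<lambda>l. \<phi> l i) ` {..<j})})
              \<le> real m ^ card S * fact (card {1..n} - card S)"
            using of_nat_mono[OF le, where 'a = real] by simp
        qed (use x in auto)
        then have "x ^ (\<Sum>k<j. ?D k \<phi>) * (\<Sum>\<tau>\<in>{\<tau>. \<tau> permutes {1..n}}. x ^ card {i\<in>{1..n}. \<tau> i \<in> (\<lambda>l. \<phi> l i) ` {..<j}})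
            \<le> x ^ (\<Sum>k<j. ?D k \<phi>) * (fact n * exp (real m * x))"
          using x by (intro mult_left_mono) auto
        then show "(\<Sum>\<tau>\<in>{\<tau>. \<tau> permutes {1..n}}. x ^ (\<Sum>k<Suc j. ?D k (\<phi>(j := \<tau>))))
            \<le> fact n * (exp (real m * x) * x ^ (\<Sum>k<j. ?D k \<phi>))"
          unfolding sum.lessThan_Suc power_add prev last sum_distrib_left[symmetric] by (simp add: mult_ac)
      qed
      also have "\<dots> \<le> exp (real m * x) * (card (latents m n) * exp (real m * x) ^ j)"
        unfolding sum_distrib_left[symmetric] using Suc by (intro mult_left_mono) auto
      finally show ?thesis by (simp add: mult_ac)
    qed
  qed simp
  from this[of m] show ?thesis by (simp add: repeats_def)
qed

(* A pair (k, l) of distinct copies agreeing at i is charged to (k, l) if k is not the first copy of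
   its class, and otherwise to (l, l). *)
lemma sum_agree_le_repeats: "(\<Sum>(k, l)\<in>off_pairs m. agree n k l \<phi>) \<le> m * repeats m n \<phi>"
proof -
  have vertex: "card {(k, l)\<in>off_pairs m. \<phi> k i = \<phi> l i} \<le> card {k\<in>{..<m}. \<exists>l<k. \<phi> k i = \<phi> l i} * m" for i
  proof -
    let ?N = "{k\<in>{..<m}. \<exists>l<k. \<phi> k i = \<phi> l i}"
    let ?f = "\<lambda>(k, l). if k \<in> ?N then (k, l) else (l, l)"
    have "card {(k, l)\<in>off_pairs m. \<phi> k i = \<phi> l i} \<le> card (?N \<times> {..<m})"
    proof (rule card_inj_on_le[where f = ?f])
      have first: "k' = k" if "k \<notin> ?N" "k' \<notin> ?N" "k < m" "k' < m" "\<phi> k i = \<phi> k' i" for k k'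
        using that by (cases k k' rule: linorder_cases) auto
      show "inj_on ?f {(k, l)\<in>off_pairs m. \<phi> k i = \<phi> l i}"
      proof (rule inj_onI)
        fix p q assume pq: "p \<in> {(k, l)\<in>off_pairs m. \<phi> k i = \<phi> l i}" "q \<in> {(k, l)\<in>off_pairs m. \<phi> k i = \<phi> l i}"
          and f: "?f p = ?f q"
        obtain k l k' l' where eqs: "p = (k, l)" "q = (k', l')" by (cases p, cases q)
        have kl: "k < m" "k \<noteq> l" "\<phi> k i = \<phi> l i" and kl': "k' < m" "k' \<noteq> l'" "\<phi> k' i = \<phi> l' i"
          using pq by (auto simp: eqs off_pairs_def)
        consider "k \<in> ?N" "k' \<in> ?N" | "k \<in> ?N" "k' \<notin> ?N" | "k \<notin> ?N" "k' \<in> ?N" | "k \<notin> ?N" "k' \<notin> ?N"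
          by blast
        then show "p = q"
        proof cases
          case 4
          have "(l, l) = (l', l')" using f unfolding eqs prod.case if_not_P[OF 4(1)] if_not_P[OF 4(2)] .
          then have "l = l'" by simp
          then show ?thesis using first[OF 4 kl(1) kl'(1)] kl kl' by (simp add: eqs)
        qed (use f kl kl' in \<open>auto simp only: eqs prod.case if_True if_False prod.inject simp_thms\<close>)
      qed
      show "?f ` {(k, l)\<in>off_pairs m. \<phi> k i = \<phi> l i} \<subseteq> ?N \<times> {..<m}"
      proof (rule image_subsetI)
        fix p assume p: "p \<in> {(k, l)\<in>off_pairs m. \<phi> k i = \<phi> l i}"
        obtain k l where eq: "p = (k, l)" by (cases p)
        have kl: "k < m" "l < m" "k \<noteq> l" "\<phi> k i = \<phi> l i" using p by (auto simp: eq off_pairs_def)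
        show "?f p \<in> ?N \<times> {..<m}"
        proof (cases "k \<in> ?N")
          case True
          then show ?thesis using kl by (simp add: eq)
        next
          case False
          have "k < l" using False kl by (cases k l rule: linorder_cases) auto
          then have "l \<in> ?N" using kl by auto
          then have "(l, l) \<in> ?N \<times> {..<m}" using kl by simp
          then show ?thesis unfolding eq prod.case if_not_P[OF False] .
        qed
      qed
    qed simp
    then show ?thesis by (simp add: card_cartesian_product)
  qed
  have card_as_sum: "card {i\<in>A. P i} = (\<Sum>i\<in>A. of_bool (P i))" if "finite A" for A :: "'c set" and P
    using that by (simp add: Int_def sum.If_cases of_bool_def)
  have "(\<Sum>(k, l)\<in>off_pairs m. agree n k l \<phi>) = (\<Sum>p\<in>off_pairs m. \<Sum>i\<in>{1..n}. of_bool (\<phi> (fst p) i = \<phi> (snd p) i))"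
    unfolding agree_def case_prod_unfold by (intro sum.cong refl card_as_sum) simp
  also have "\<dots> = (\<Sum>i\<in>{1..n}. \<Sum>p\<in>off_pairs m. of_bool (\<phi> (fst p) i = \<phi> (snd p) i))"
    by (rule sum.swap)
  also have "\<dots> = (\<Sum>i\<in>{1..n}. card {(k, l)\<in>off_pairs m. \<phi> k i = \<phi> l i})"
    unfolding case_prod_unfold by (intro sum.cong refl) (simp only: card_as_sum[OF finite_off_pairs] prod.collapse)
  also have "\<dots> \<le> (\<Sum>i\<in>{1..n}. card {k\<in>{..<m}. \<exists>l<k. \<phi> k i = \<phi> l i} * m)"
    by (intro sum_mono vertex)
  also have "\<dots> = m * (\<Sum>i\<in>{1..n}. \<Sum>k<m. of_bool (\<exists>l<k. \<phi> k i = \<phi> l i))"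
    by (simp only: card_as_sum[OF finite_lessThan] sum_distrib_left sum_distrib_right mult.commute)
  also have "(\<Sum>i\<in>{1..n}. \<Sum>k<m. of_bool (\<exists>l<k. \<phi> k i = \<phi> l i)) = repeats m n \<phi>"
    unfolding repeats_def by (subst sum.swap) (simp only: card_as_sum[OF finite_atLeastAtMost])
  finally show ?thesis .
qed

subsection \<open>Truncated second moments and total variation\<close>

text \<open>Truncation leaves a density \<open>h\<close> of only a part of \<open>P\<close>. For
  every event, \<open>Q A - P A\<close> is at most the integral of \<open>1 - h\<close> over
  \<open>A\<close>, hence at most that of \<open>\<bar>1 - h\<bar>\<close>. By Cauchy-Schwarz the
  latter is bounded by the root of \<open>1 - 2 E h + E h^2\<close>, which is at most
  \<open>2 \<epsilon> + \<epsilon>'\<close>. Passing to complements gives the opposite sign.\<close>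

lemma total_variation_le_density:
  fixes h :: "'a \<Rightarrow> real"
  assumes P: "prob_space P" and Q: "prob_space Q" and sets: "sets P = sets Q"
    and h [measurable]: "h \<in> borel_measurable Q" and h0: "\<And>x. 0 \<le> h x"
    and dom: "\<And>A. A \<in> sets Q \<Longrightarrow> (\<integral>\<^sup>+ x. ennreal (h x) * indicator A x \<partial>Q) \<le> emeasure P A"
    and mean: "ennreal (1 - \<epsilon>) \<le> (\<integral>\<^sup>+ x. ennreal (h x) \<partial>Q)"
    and square: "(\<integral>\<^sup>+ x. ennreal ((h x)\<^sup>2) \<partial>Q) \<le> ennreal (1 + \<epsilon>')" and \<epsilon>: "0 \<le> \<epsilon>'"
  shows "total_variation P Q \<le> sqrt (2 * \<epsilon> + \<epsilon>')"
proof -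
  interpret P: prob_space P by fact
  interpret Q: prob_space Q by fact
  have space: "space P = space Q" using sets by (rule sets_eq_imp_space_eq)
  have le1: "(\<integral>\<^sup>+ x. ennreal (h x) \<partial>Q) \<le> 1"
  proof -
    have "(\<integral>\<^sup>+ x. ennreal (h x) \<partial>Q) = (\<integral>\<^sup>+ x. ennreal (h x) * indicator (space Q) x \<partial>Q)"
      by (intro nn_integral_cong) simp
    also have "\<dots> \<le> emeasure P (space Q)" by (intro dom) simp
    also have "\<dots> = 1" using P.emeasure_space_1 by (simp add: space)
    finally show ?thesis .
  qed
  have int_h [simp]: "integrable Q h"
    by (rule integrableI_nonneg) (use h0 le1 in \<open>auto intro: le_less_trans\<close>)
  have int_sq [simp]: "integrable Q (\<lambda>x. (h x)\<^sup>2)"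
    by (rule integrableI_nonneg) (use square in \<open>auto intro: le_less_trans\<close>)
  have "ennreal (1 - \<epsilon>) \<le> ennreal (\<integral>x. h x \<partial>Q)"
    using mean nn_integral_eq_integral[OF int_h] h0 by simp
  then have mean': "1 - \<epsilon> \<le> (\<integral>x. h x \<partial>Q)"
    using h0 by (subst (asm) ennreal_le_iff) (auto intro: Bochner_Integration.integral_nonneg)
  have "ennreal (\<integral>x. (h x)\<^sup>2 \<partial>Q) \<le> ennreal (1 + \<epsilon>')"
    using square nn_integral_eq_integral[OF int_sq] by simp
  then have square': "(\<integral>x. (h x)\<^sup>2 \<partial>Q) \<le> 1 + \<epsilon>'"
    using \<epsilon> by (subst (asm) ennreal_le_iff) auto
  define f where "f x = \<bar>1 - h x\<bar>" for x
  have int_f [simp]: "integrable Q f" unfolding f_def by simp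
  have f_sq: "(f x)\<^sup>2 = 1 - 2 * h x + (h x)\<^sup>2" for x
    by (simp add: f_def power2_eq_square algebra_simps)
  have int_fsq [simp]: "integrable Q (\<lambda>x. (f x)\<^sup>2)" unfolding f_sq by simp
  have "(\<integral>x. (f x)\<^sup>2 \<partial>Q) = 1 - 2 * (\<integral>x. h x \<partial>Q) + (\<integral>x. (h x)\<^sup>2 \<partial>Q)"
    unfolding f_sq by (simp add: Q.prob_space)
  then have bound: "(\<integral>x. (f x)\<^sup>2 \<partial>Q) \<le> 2 * \<epsilon> + \<epsilon>'" using mean' square' by simp
  define c where "c = (\<integral>x. f x \<partial>Q)"
  \<comment> \<open>Cauchy-Schwarz, obtained from the nonnegative variance of
    \<open>f\<close>.\<close>
  have "0 \<le> (\<integral>x. (f x - c)\<^sup>2 \<partial>Q)" by (rule Bochner_Integration.integral_nonneg) simp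
  also have "(\<integral>x. (f x - c)\<^sup>2 \<partial>Q) = (\<integral>x. (f x)\<^sup>2 - 2 * c * f x + c\<^sup>2 \<partial>Q)"
    by (intro Bochner_Integration.integral_cong refl) (simp add: power2_eq_square algebra_simps)
  also have "\<dots> = (\<integral>x. (f x)\<^sup>2 \<partial>Q) - 2 * c * (\<integral>x. f x \<partial>Q) + c\<^sup>2"
    by (simp add: Q.prob_space)
  also have "\<dots> = (\<integral>x. (f x)\<^sup>2 \<partial>Q) - c\<^sup>2"
    by (simp add: c_def[symmetric] power2_eq_square)
  finally have "c\<^sup>2 \<le> 2 * \<epsilon> + \<epsilon>'" using bound by simp
  then have c: "c \<le> sqrt (2 * \<epsilon> + \<epsilon>')" by (rule real_le_rsqrt)
  have one_sided: "measure Q A - measure P A \<le> sqrt (2 * \<epsilon> + \<epsilon>')" if A: "A \<in> sets Q" for A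
  proof -
    have int_hA: "integrable Q (\<lambda>x. h x * indicator A x)"
      using A by (intro integrable_mult_indicator[where f = h, simplified mult.commute[of "indicator _ _"] real_scaleR_def]) auto
    have int_A: "integrable Q (\<lambda>x. indicator A x :: real)"
      using A by (intro integrable_real_indicator) (auto simp: Q.emeasure_finite less_top[symmetric])
    have "ennreal (\<integral>x. h x * indicator A x \<partial>Q) = (\<integral>\<^sup>+ x. ennreal (h x * indicator A x) \<partial>Q)"
      using h0 by (intro nn_integral_eq_integral[symmetric] int_hA) auto
    also have "\<dots> = (\<integral>\<^sup>+ x. ennreal (h x) * indicator A x \<partial>Q)"
      by (intro nn_integral_cong) (auto split: split_indicator)
    also have "\<dots> \<le> emeasure P A" by (rule dom[OF A])
    finally have "(\<integral>x. h x * indicator A x \<partial>Q) \<le> measure P A"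
      by (simp add: P.emeasure_eq_measure)
    then have "measure Q A - measure P A \<le> (\<integral>x. indicator A x \<partial>Q) - (\<integral>x. h x * indicator A x \<partial>Q)"
      using A by simp
    also have "\<dots> = (\<integral>x. indicator A x - h x * indicator A x \<partial>Q)"
      by (rule Bochner_Integration.integral_diff[symmetric, OF int_A int_hA])
    also have "\<dots> \<le> (\<integral>x. f x \<partial>Q)"
      by (intro integral_mono Bochner_Integration.integrable_diff int_A int_hA int_f)
        (auto simp: f_def split: split_indicator)
    finally show ?thesis using c by (simp add: c_def)
  qed
  have "\<bar>measure P A - measure Q A\<bar> \<le> sqrt (2 * \<epsilon> + \<epsilon>')" if A: "A \<in> sets P" for A
  proof -
    have A': "A \<in> sets Q" "space Q - A \<in> sets Q" using A sets by auto
    have "measure Q (space Q - A) - measure P (space Q - A) = measure P A - measure Q A"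
      using P.prob_compl[OF A] Q.prob_compl[OF A'(1)] by (simp add: space)
    then show ?thesis using one_sided[OF A'(1)] one_sided[OF A'(2)] by linarith
  qed
  then show ?thesis
    unfolding total_variation_def by (intro cSUP_least) (use sets.top in auto)
qed

section \<open>Reduction of pairs of latent tuples to one relative tuple\<close>

definition joint_ratio :: "nat \<Rightarrow> nat \<Rightarrow> real \<Rightarrow> (nat \<times> nat set \<Rightarrow> real) \<Rightarrow> real" where
  "joint_ratio m n \<rho> X = (\<Prod>e\<in>edges n. equi_ratio m \<rho> (\<lambda>k. X (k, e)))"

text \<open>Once the data are aligned by \<pi>, the likelihood at \<pi>' reads copy \<open>k\<close>
  along the inverse of \<open>\<pi> k\<close> composed with \<open>\<pi>' k\<close>, which is the
  inverse of \<open>relative \<pi> \<pi>' k\<close>. With the inverse placed here, the maps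
  \<open>\<psi> k\<close> of the moment bounds are the actions of \<open>\<phi> k\<close>
  itself.\<close>

definition shifted_ratio :: "nat \<Rightarrow> nat \<Rightarrow> real \<Rightarrow> (nat \<Rightarrow> nat \<Rightarrow> nat) \<Rightarrow> (nat \<times> nat set \<Rightarrow> real) \<Rightarrow> real" where
  "shifted_ratio m n \<rho> \<phi> X = (\<Prod>e\<in>edges n. equi_ratio m \<rho> (\<lambda>k. X (k, inv_into UNIV (\<phi> k) ` e)))"

lemma joint_ratio_nonneg: "1 \<le> m \<Longrightarrow> 0 \<le> \<rho> \<Longrightarrow> \<rho> < 1 \<Longrightarrow> 0 \<le> joint_ratio m n \<rho> X"
  unfolding joint_ratio_def by (intro prod_nonneg equi_ratio_nonneg) auto

lemma shifted_ratio_nonneg: "1 \<le> m \<Longrightarrow> 0 \<le> \<rho> \<Longrightarrow> \<rho> < 1 \<Longrightarrow> 0 \<le> shifted_ratio m n \<rho> \<phi> X"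
  unfolding shifted_ratio_def by (intro prod_nonneg equi_ratio_nonneg) auto

lemma joint_ratio_likelihood: "joint_ratio m n \<rho> = likelihood m n \<rho> (\<lambda>_. id)"
  by (simp add: joint_ratio_def likelihood_def fun_eq_iff)

lemma shifted_ratio_likelihood: "shifted_ratio m n \<rho> \<phi> = likelihood m n \<rho> (\<lambda>k. inv_into UNIV (\<phi> k))"
  by (simp add: shifted_ratio_def likelihood_def fun_eq_iff)

lemma measurable_joint_ratio [measurable]: "joint_ratio m n \<rho> \<in> borel_measurable (null_law m n)"
  unfolding joint_ratio_likelihood by (intro measurable_likelihood permutes_id)

lemma measurable_shifted_ratio [measurable]:
  "\<phi> \<in> latents m n \<Longrightarrow> shifted_ratio m n \<rho> \<phi> \<in> borel_measurable (null_law m n)"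
  unfolding shifted_ratio_likelihood by (intro measurable_likelihood permutes_inv latents_permutes)

lemma latents_iff:
  "\<phi> \<in> latents m n \<longleftrightarrow> (\<forall>k<m. \<phi> k permutes {1..n}) \<and> (\<forall>k. k = 0 \<or> m \<le> k \<longrightarrow> \<phi> k = id)"
proof
  assume "\<phi> \<in> latents m n"
  then have mem: "k < m \<Longrightarrow> \<phi> k \<in> (if k = 0 then {id} else {\<tau>. \<tau> permutes {1..n}})" "\<not> k < m \<Longrightarrow> \<phi> k = id" for k
    unfolding latents_def PiE_dflt_def mem_Collect_eq lessThan_iff by blast+
  have "\<phi> k permutes {1..n}" if "k < m" for k
    using mem(1)[OF that] by (cases "k = 0") (simp_all add: permutes_id)
  moreover have "\<phi> k = id" if "k = 0 \<or> m \<le> k" for k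
    using mem[of k] that by (cases "k < m") auto
  ultimately show "(\<forall>k<m. \<phi> k permutes {1..n}) \<and> (\<forall>k. k = 0 \<or> m \<le> k \<longrightarrow> \<phi> k = id)" by blast
next
  assume "(\<forall>k<m. \<phi> k permutes {1..n}) \<and> (\<forall>k. k = 0 \<or> m \<le> k \<longrightarrow> \<phi> k = id)"
  then show "\<phi> \<in> latents m n" unfolding latents_def PiE_dflt_def by simp
qed

definition relative :: "(nat \<Rightarrow> nat \<Rightarrow> nat) \<Rightarrow> (nat \<Rightarrow> nat \<Rightarrow> nat) \<Rightarrow> (nat \<Rightarrow> nat \<Rightarrow> nat)" where
  "relative \<pi> \<pi>' = (\<lambda>k. inv_into UNIV (\<pi>' k) \<circ> \<pi> k)"

text \<open>For fixed \<pi> the second tuple is recovered from the relative one, so a uniform second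
  tuple has a uniform relative tuple.\<close>

lemma bij_betw_relative:
  assumes \<pi>: "\<pi> \<in> latents m n"
  shows "bij_betw (relative \<pi>) (latents m n) (latents m n)"
proof -
  have perm: "\<phi> k permutes {1..n}" if "\<phi> \<in> latents m n" for \<phi> k
    using that by (cases "k < m") (auto simp: latents_iff not_less permutes_id)
  have mem: "relative \<pi> \<phi> \<in> latents m n" if \<phi>: "\<phi> \<in> latents m n" for \<phi>
    using \<phi> \<pi> unfolding latents_iff relative_def by (auto intro: permutes_compose permutes_inv)
  define unrel where "unrel \<phi> = (\<lambda>k. \<pi> k \<circ> inv_into UNIV (\<phi> k))" for \<phi> :: "nat \<Rightarrow> nat \<Rightarrow> nat"
  have mem': "unrel \<phi> \<in> latents m n" if \<phi>: "\<phi> \<in> latents m n" for \<phi>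
    using \<phi> \<pi> unfolding latents_iff unrel_def by (auto intro: permutes_compose permutes_inv)
  have inv1: "unrel (relative \<pi> \<phi>) = \<phi>" if "\<phi> \<in> latents m n" for \<phi>
  proof (rule ext)
    fix k
    have "inv_into UNIV (inv_into UNIV (\<phi> k) \<circ> \<pi> k) = inv_into UNIV (\<pi> k) \<circ> \<phi> k"
      using o_inv_distrib[OF bij_imp_bij_inv[OF permutes_bij[OF perm[OF that]]] permutes_bij[OF perm[OF \<pi>]]]
        inv_inv_eq[OF permutes_bij[OF perm[OF that]]] by simp
    then show "unrel (relative \<pi> \<phi>) k = \<phi> k"
      by (simp add: unrel_def relative_def fun_eq_iff permutes_inverses[OF perm[OF \<pi>]])
  qed
  have inv2: "relative \<pi> (unrel \<phi>) = \<phi>" if "\<phi> \<in> latents m n" for \<phi>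
  proof (rule ext)
    fix k
    have "inv_into UNIV (\<pi> k \<circ> inv_into UNIV (\<phi> k)) = \<phi> k \<circ> inv_into UNIV (\<pi> k)"
      using o_inv_distrib[OF permutes_bij[OF perm[OF \<pi>]] bij_imp_bij_inv[OF permutes_bij[OF perm[OF that]]]]
        inv_inv_eq[OF permutes_bij[OF perm[OF that]]] by simp
    then show "relative \<pi> (unrel \<phi>) k = \<phi> k"
      by (simp add: unrel_def relative_def fun_eq_iff permutes_inverses[OF perm[OF \<pi>]])
  qed
  show ?thesis
    using mem mem' inv1 inv2 by (intro bij_betw_byWitness[where f' = unrel]) auto
qed

lemma likelihood_permuted:
  assumes "\<pi> \<in> latents m n" "\<pi>' \<in> latents m n"
  shows "likelihood m n \<rho> \<pi> X = joint_ratio m n \<rho> (permuted m n \<pi> X)"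
    and "likelihood m n \<rho> \<pi>' X = shifted_ratio m n \<rho> (relative \<pi> \<pi>') (permuted m n \<pi> X)"
proof -
  show "likelihood m n \<rho> \<pi> X = joint_ratio m n \<rho> (permuted m n \<pi> X)"
    unfolding likelihood_def joint_ratio_def
    by (intro prod.cong refl equi_ratio_cong) (simp add: permuted_apply)
  show "likelihood m n \<rho> \<pi>' X = shifted_ratio m n \<rho> (relative \<pi> \<pi>') (permuted m n \<pi> X)"
    unfolding likelihood_def shifted_ratio_def
  proof (intro prod.cong refl equi_ratio_cong)
    fix e k assume e: "e \<in> edges n" and k: "k < m"
    have \<pi>: "\<pi> k permutes {1..n}" and \<pi>': "\<pi>' k permutes {1..n}"
      using assms k by (auto intro: latents_permutes)
    have "inv_into UNIV (relative \<pi> \<pi>' k) = inv_into UNIV (\<pi> k) \<circ> \<pi>' k"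
      unfolding relative_def
      using o_inv_distrib[OF bij_imp_bij_inv[OF permutes_bij[OF \<pi>']] permutes_bij[OF \<pi>]]
        inv_inv_eq[OF permutes_bij[OF \<pi>']] by simp
    then have inv: "inv_into UNIV (relative \<pi> \<pi>' k) ` e = inv_into UNIV (\<pi> k) ` \<pi>' k ` e"
      by (simp add: image_comp)
    have "inv_into UNIV (\<pi> k) ` \<pi>' k ` e \<in> edges n"
      by (intro permutes_image_edges[OF permutes_inv[OF \<pi>]] permutes_image_edges[OF \<pi>'] e)
    then show "X (k, \<pi>' k ` e) = permuted m n \<pi> X (k, inv_into UNIV (relative \<pi> \<pi>' k) ` e)"
      unfolding inv using k by (simp only: permuted_apply inv_image_image[OF \<pi>])
  qed
qed

text \<open>The truncation acts on aligned data, so each latent tuple \<pi> carries its own event,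
  namely that \<open>permuted m n \<pi> X\<close> lies in \<open>G\<close>. As the null law is
  invariant under alignment, every \<pi> contributes the same to the mean, and the inner sum of the
  second moment over \<pi>' depends only on relative tuples. Hence a single average over \<phi>
  remains.\<close>

lemma total_variation_planted_le:
  fixes \<epsilon> \<epsilon>' :: real
  assumes m: "1 \<le> m" and \<rho>: "0 \<le> \<rho>" "\<rho> < 1"
    and G [measurable]: "G \<in> sets (null_law m n)"
    and mean: "ennreal (1 - \<epsilon>) \<le> (\<integral>\<^sup>+ X. ennreal (joint_ratio m n \<rho> X) * indicator G X \<partial>null_law m n)"
    and square: "(\<Sum>\<phi>\<in>latents m n. \<integral>\<^sup>+ X. ennreal (joint_ratio m n \<rho> X * shifted_ratio m n \<rho> \<phi> X) * indicator G X \<partial>null_law m n)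
       \<le> ennreal (card (latents m n) * (1 + \<epsilon>'))"
    and \<epsilon>: "0 \<le> \<epsilon>'"
  shows "total_variation (planted_law m n \<rho>) (null_law m n) \<le> sqrt (2 * \<epsilon> + \<epsilon>')"
proof -
  let ?Q = "null_law m n" and ?L = "latents m n"
  define N where "N = real (card ?L)"
  have N: "N > 0" using card_latents_pos by (simp add: N_def)
  define g where "g \<pi> X = likelihood m n \<rho> \<pi> X * indicator G (permuted m n \<pi> X)" for \<pi> X
  define h where "h X = (\<Sum>\<pi>\<in>?L. g \<pi> X) / N" for X
  have perm: "\<And>k. k < m \<Longrightarrow> \<pi> k permutes {1..n}" if "\<pi> \<in> ?L" for \<pi>
    using latents_permutes[OF that] .
  have g0: "0 \<le> g \<pi> X" for \<pi> X using likelihood_nonneg[OF m \<rho>] by (simp add: g_def)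
  have g_meas: "g \<pi> \<in> borel_measurable ?Q" if "\<pi> \<in> ?L" for \<pi>
    unfolding g_def using measurable_permuted[of m \<pi> n] measurable_likelihood[of m \<pi> n \<rho>] perm[OF that] by measurable
  have h_meas [measurable]: "h \<in> borel_measurable ?Q"
    unfolding h_def by (intro borel_measurable_divide borel_measurable_sum g_meas) auto
  have subst: "(\<integral>\<^sup>+ X. F (permuted m n \<pi> X) \<partial>?Q) = (\<integral>\<^sup>+ X. F X \<partial>?Q)"
    if "\<pi> \<in> ?L" "F \<in> borel_measurable ?Q" for F :: "(nat \<times> nat set \<Rightarrow> real) \<Rightarrow> ennreal" and \<pi>
  proof -
    have meas: "permuted m n \<pi> \<in> ?Q \<rightarrow>\<^sub>M ?Q" by (rule measurable_permuted) (rule perm[OF that(1)])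
    have law: "distr ?Q ?Q (permuted m n \<pi>) = ?Q" by (rule permuted_null_law) (rule perm[OF that(1)])
    show ?thesis using nn_integral_distr[OF meas, of F] that(2) unfolding law by simp
  qed
  have dens: "ennreal (h X) = (\<Sum>\<pi>\<in>?L. ennreal (g \<pi> X)) / ennreal N" for X
    using N g0 by (simp add: h_def divide_ennreal[symmetric] sum_nonneg)
  show ?thesis
  proof (rule total_variation_le_density[where h = h])
    show "prob_space (planted_law m n \<rho>)" by (rule prob_space_planted_law[OF m \<rho>])
    show "prob_space ?Q" by (rule prob_space_null_law)
    show "sets (planted_law m n \<rho>) = sets ?Q" by (simp add: sets_planted_law[OF m \<rho>] sets_null_law)
    fix X show "0 \<le> h X" unfolding h_def using N g0 by (intro divide_nonneg_pos sum_nonneg) auto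
  next
    show "0 \<le> \<epsilon>'" by fact
    show "h \<in> borel_measurable ?Q" by fact
  next
    fix A assume A [measurable]: "A \<in> sets ?Q"
    have "(\<integral>\<^sup>+ X. ennreal (h X) * indicator A X \<partial>?Q) = (\<integral>\<^sup>+ X. (\<Sum>\<pi>\<in>?L. ennreal (g \<pi> X) * indicator A X) / ennreal N \<partial>?Q)"
      unfolding dens by (intro nn_integral_cong) (simp split: split_indicator)
    also have "\<dots> = (\<Sum>\<pi>\<in>?L. \<integral>\<^sup>+ X. ennreal (g \<pi> X) * indicator A X \<partial>?Q) / ennreal N"
    proof -
      have "(\<lambda>X. ennreal (g \<pi> X) * indicator A X) \<in> borel_measurable ?Q" if "\<pi> \<in> ?L" for \<pi>
        using g_meas[OF that] by measurable
      then show ?thesis by (simp only: nn_integral_divide borel_measurable_sum nn_integral_sum)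
    qed
    also have "\<dots> \<le> (\<Sum>\<pi>\<in>?L. emeasure (planted_law_given m n \<rho> \<pi>) A) / ennreal N"
    proof (intro divide_right_mono_ennreal sum_mono)
      fix \<pi> assume \<pi>: "\<pi> \<in> ?L"
      have "(\<integral>\<^sup>+ X. ennreal (g \<pi> X) * indicator A X \<partial>?Q) \<le> (\<integral>\<^sup>+ X. ennreal (likelihood m n \<rho> \<pi> X) * indicator A X \<partial>?Q)"
        using likelihood_nonneg[OF m \<rho>] by (intro nn_integral_mono) (auto simp: g_def split: split_indicator)
      also have "\<dots> = emeasure (planted_law_given m n \<rho> \<pi>) A"
      proof -
        have "planted_law_given m n \<rho> \<pi> = density ?Q (\<lambda>X. ennreal (likelihood m n \<rho> \<pi> X))"
          by (rule planted_law_given_density[OF m \<rho>]) (rule perm[OF \<pi>])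
        moreover have "likelihood m n \<rho> \<pi> \<in> borel_measurable ?Q"
          by (rule measurable_likelihood) (rule perm[OF \<pi>])
        ultimately show ?thesis using A by (simp add: emeasure_density)
      qed
      finally show "(\<integral>\<^sup>+ X. ennreal (g \<pi> X) * indicator A X \<partial>?Q) \<le> emeasure (planted_law_given m n \<rho> \<pi>) A" .
    qed
    also have "\<dots> = emeasure (planted_law m n \<rho>) A"
      using A by (subst emeasure_planted_law[OF m \<rho>]) (auto simp: sets_null_law N_def ennreal_of_nat_eq_real_of_nat)
    finally show "(\<integral>\<^sup>+ X. ennreal (h X) * indicator A X \<partial>?Q) \<le> emeasure (planted_law m n \<rho>) A" .
  next
    have "(\<integral>\<^sup>+ X. ennreal (h X) \<partial>?Q) = (\<Sum>\<pi>\<in>?L. \<integral>\<^sup>+ X. ennreal (g \<pi> X) \<partial>?Q) / ennreal N"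
      unfolding dens using g_meas by (subst nn_integral_divide) (auto simp: nn_integral_sum)
    also have "\<dots> = (\<Sum>\<pi>\<in>?L. \<integral>\<^sup>+ X. ennreal (joint_ratio m n \<rho> X) * indicator G X \<partial>?Q) / ennreal N"
    proof (intro arg_cong2[where f = "(/)"] refl sum.cong)
      fix \<pi> assume \<pi>: "\<pi> \<in> ?L"
      have "(\<integral>\<^sup>+ X. ennreal (g \<pi> X) \<partial>?Q)
          = (\<integral>\<^sup>+ X. (\<lambda>Y. ennreal (joint_ratio m n \<rho> Y) * indicator G Y) (permuted m n \<pi> X) \<partial>?Q)"
        by (intro nn_integral_cong) (auto simp: g_def likelihood_permuted(1)[OF \<pi> \<pi>] split: split_indicator)
      also have "\<dots> = (\<integral>\<^sup>+ X. ennreal (joint_ratio m n \<rho> X) * indicator G X \<partial>?Q)"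
        by (rule subst[OF \<pi>]) measurable
      finally show "(\<integral>\<^sup>+ X. ennreal (g \<pi> X) \<partial>?Q) = (\<integral>\<^sup>+ X. ennreal (joint_ratio m n \<rho> X) * indicator G X \<partial>?Q)" .
    qed
    also have "\<dots> = (\<integral>\<^sup>+ X. ennreal (joint_ratio m n \<rho> X) * indicator G X \<partial>?Q)"
      using N by (simp add: N_def ennreal_of_nat_eq_real_of_nat[symmetric] mult.commute[of "of_nat _"]
          ennreal_mult_divide_eq card_gt_0_iff)
    finally show "ennreal (1 - \<epsilon>) \<le> (\<integral>\<^sup>+ X. ennreal (h X) \<partial>?Q)" using mean by simp
  next
    have "(\<integral>\<^sup>+ X. ennreal ((h X)\<^sup>2) \<partial>?Q) = (\<integral>\<^sup>+ X. (\<Sum>\<pi>\<in>?L. \<Sum>\<pi>'\<in>?L. ennreal (g \<pi> X * g \<pi>' X)) / ennreal (N\<^sup>2) \<partial>?Q)"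
    proof (intro nn_integral_cong)
      fix X
      have "(h X)\<^sup>2 = (\<Sum>\<pi>\<in>?L. \<Sum>\<pi>'\<in>?L. g \<pi> X * g \<pi>' X) / N\<^sup>2"
        by (simp add: h_def power_divide power2_eq_square[of "sum _ _"] sum_product)
      then show "ennreal ((h X)\<^sup>2) = (\<Sum>\<pi>\<in>?L. \<Sum>\<pi>'\<in>?L. ennreal (g \<pi> X * g \<pi>' X)) / ennreal (N\<^sup>2)"
        using N g0 by (simp add: divide_ennreal[symmetric] sum_nonneg)
    qed
    also have "\<dots> = (\<Sum>\<pi>\<in>?L. \<Sum>\<pi>'\<in>?L. \<integral>\<^sup>+ X. ennreal (g \<pi> X * g \<pi>' X) \<partial>?Q) / ennreal (N\<^sup>2)"
    proof -
      have "(\<lambda>X. ennreal (g \<pi> X * g \<pi>' X)) \<in> borel_measurable ?Q" if "\<pi> \<in> ?L" "\<pi>' \<in> ?L" for \<pi> \<pi>'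
        using g_meas[OF that(1)] g_meas[OF that(2)] by measurable
      then show ?thesis by (simp only: nn_integral_divide borel_measurable_sum nn_integral_sum cong: sum.cong)
    qed
    also have "\<dots> \<le> (\<Sum>\<pi>\<in>?L. ennreal (N * (1 + \<epsilon>'))) / ennreal (N\<^sup>2)"
    proof (intro divide_right_mono_ennreal sum_mono)
      fix \<pi> assume \<pi>: "\<pi> \<in> ?L"
      have "(\<Sum>\<pi>'\<in>?L. \<integral>\<^sup>+ X. ennreal (g \<pi> X * g \<pi>' X) \<partial>?Q)
          \<le> (\<Sum>\<pi>'\<in>?L. \<integral>\<^sup>+ X. ennreal (joint_ratio m n \<rho> X * shifted_ratio m n \<rho> (relative \<pi> \<pi>') X) * indicator G X \<partial>?Q)"
      \<comment> \<open>Only the truncation that belongs to \<pi> is kept; omitting the one of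
        \<pi>' can only enlarge the integral.\<close>
      proof (intro sum_mono)
        fix \<pi>' assume \<pi>': "\<pi>' \<in> ?L"
        have rel: "relative \<pi> \<pi>' \<in> ?L" using bij_betw_relative[OF \<pi>] \<pi>' by (auto dest: bij_betwE)
        have "(\<integral>\<^sup>+ X. ennreal (g \<pi> X * g \<pi>' X) \<partial>?Q)
            \<le> (\<integral>\<^sup>+ X. (\<lambda>Y. ennreal (joint_ratio m n \<rho> Y * shifted_ratio m n \<rho> (relative \<pi> \<pi>') Y) * indicator G Y) (permuted m n \<pi> X) \<partial>?Q)"
          using joint_ratio_nonneg[OF m \<rho>] shifted_ratio_nonneg[OF m \<rho>]
          by (intro nn_integral_mono) (auto simp: g_def likelihood_permuted[OF \<pi> \<pi>'] split: split_indicator)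
        also have "\<dots> = (\<integral>\<^sup>+ X. ennreal (joint_ratio m n \<rho> X * shifted_ratio m n \<rho> (relative \<pi> \<pi>') X) * indicator G X \<partial>?Q)"
          by (rule subst[OF \<pi>]) (use rel in measurable)
        finally show "(\<integral>\<^sup>+ X. ennreal (g \<pi> X * g \<pi>' X) \<partial>?Q)
          \<le> (\<integral>\<^sup>+ X. ennreal (joint_ratio m n \<rho> X * shifted_ratio m n \<rho> (relative \<pi> \<pi>') X) * indicator G X \<partial>?Q)" .
      qed
      also have "\<dots> = (\<Sum>\<phi>\<in>?L. \<integral>\<^sup>+ X. ennreal (joint_ratio m n \<rho> X * shifted_ratio m n \<rho> \<phi> X) * indicator G X \<partial>?Q)"
        by (rule sum.reindex_bij_betw[OF bij_betw_relative[OF \<pi>],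
              where g = "\<lambda>\<phi>. \<integral>\<^sup>+ X. ennreal (joint_ratio m n \<rho> X * shifted_ratio m n \<rho> \<phi> X) * indicator G X \<partial>?Q"])
      also have "\<dots> \<le> ennreal (N * (1 + \<epsilon>'))" using square by (simp add: N_def)
      finally show "(\<Sum>\<pi>'\<in>?L. \<integral>\<^sup>+ X. ennreal (g \<pi> X * g \<pi>' X) \<partial>?Q) \<le> ennreal (N * (1 + \<epsilon>'))" .
    qed
    also have "\<dots> = ennreal (1 + \<epsilon>')"
      using N \<epsilon> by (simp add: N_def[symmetric] ennreal_of_nat_eq_real_of_nat ennreal_mult[symmetric] divide_ennreal power2_eq_square)
    finally show "(\<integral>\<^sup>+ X. ennreal ((h X)\<^sup>2) \<partial>?Q) \<le> ennreal (1 + \<epsilon>')" .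
  qed
qed

section \<open>Edges on which two permutations agree\<close>

lemma card_nsets_two_le: "finite A \<Longrightarrow> 2 * card (nsets A 2) \<le> (card A)\<^sup>2"
  by (simp add: card_nsets choose_two power2_eq_square) (metis diff_le_self mult_le_mono2 div_mult2_eq
      div_times_less_eq_dividend dvd_div_mult_self le_trans mult.commute)

lemma edge_eqE:
  assumes "a \<in> edges n"
  obtains i j where "a = {i, j}" "i < j" "i \<in> {1..n}" "j \<in> {1..n}"
proof -
  obtain x y where "a = {x, y}" "x \<noteq> y" "a \<subseteq> {1..n}"
    using assms by (auto simp: nsets_def card_2_iff)
  then show ?thesis using that[of x y] that[of y x] by (cases x y rule: linorder_cases) auto
qed

text \<open>The endpoints of such an edge are matched either in place, and then the edge lies inside
  the agreement set, or crosswise, and then its smaller endpoint determines the other one because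
  \<open>h\<close> is injective.\<close>

lemma card_common_edges_le:
  assumes g: "g permutes {1..n}" and h: "h permutes {1..n}"
  shows "card {a\<in>edges n. g ` a = h ` a}
    \<le> card (nsets {i\<in>{1..n}. g i = h i} 2) + card {i\<in>{1..n}. \<exists>j\<in>{1..n}. i < j \<and> g i = h j \<and> g j = h i}"
proof -
  let ?A = "{i\<in>{1..n}. g i = h i}" and ?S = "{i\<in>{1..n}. \<exists>j\<in>{1..n}. i < j \<and> g i = h j \<and> g j = h i}"
  let ?f = "\<lambda>i. {i, inv_into UNIV h (g i)}"
  have "{a\<in>edges n. g ` a = h ` a} \<subseteq> nsets ?A 2 \<union> ?f ` ?S"
  proof clarify
    fix a assume a: "a \<in> edges n" "g ` a = h ` a" "a \<notin> ?f ` ?S"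
    obtain i j where ij: "a = {i, j}" "i < j" "i \<in> {1..n}" "j \<in> {1..n}" using a(1) by (rule edge_eqE)
    have "{g i, g j} = {h i, h j}" using a(2) by (simp add: ij)
    then consider "g i = h i" "g j = h j" | "g i = h j" "g j = h i" by (auto simp: doubleton_eq_iff)
    then show "a \<in> nsets ?A 2"
    proof cases
      case 1
      then show ?thesis using ij by (auto simp: nsets_def)
    next
      case 2
      have "i \<in> ?S" using ij 2 by auto
      moreover have "?f i = a" using 2 permutes_inverses(2)[OF h] by (simp add: ij)
      ultimately show ?thesis using a(3) by blast
    qed
  qed
  then have "card {a\<in>edges n. g ` a = h ` a} \<le> card (nsets ?A 2 \<union> ?f ` ?S)"
    by (rule card_mono[rotated]) (auto intro: finite_imp_finite_nsets)
  also have "\<dots> \<le> card (nsets ?A 2) + card (?f ` ?S)" by (rule card_Un_le)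
  also have "\<dots> \<le> card (nsets ?A 2) + card ?S" by (intro add_left_mono card_image_le) auto
  finally show ?thesis .
qed

lemma swapped_le_n: "swapped n k l \<phi> \<le> n"
proof -
  have "swapped n k l \<phi> \<le> card {1..n}" unfolding swapped_def by (intro card_mono) auto
  then show ?thesis by simp
qed

lemma agree_le_n: "agree n k l \<phi> \<le> n"
proof -
  have "agree n k l \<phi> \<le> card {1..n}" unfolding agree_def by (intro card_mono) auto
  then show ?thesis by simp
qed

lemma edge_bijections_latents:
  assumes "1 \<le> m" "\<phi> \<in> latents m n"
  shows "edge_bijections m (edges n) (\<lambda>k e. inv_into UNIV (\<phi> k) ` e) (\<lambda>k e. \<phi> k ` e)"
proof
  show "1 \<le> m" by fact
  fix k assume "k < m"
  then have "\<phi> k permutes {1..n}" using latents_permutes[OF assms(2)] by simp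
  then show "bij_betw ((`) (inv_into UNIV (\<phi> k))) (edges n) (edges n)" "\<And>e. \<phi> k ` inv_into UNIV (\<phi> k) ` e = e"
    by (auto intro!: bij_betw_image_edges permutes_inv simp: inv_image_image)
qed simp

subsection \<open>The truncation region\<close>

text \<open>Sorting the two indices makes the family symmetric, and the empty set elsewhere keeps it
  within the edge set for all arguments; \<open>truncated_moment_le\<close> and
  \<open>overlap_mgf_le\<close> ask for both.\<close>

definition agreement_edges :: "nat \<Rightarrow> (nat \<times> nat \<Rightarrow> nat set) \<Rightarrow> nat \<Rightarrow> nat \<Rightarrow> nat set set" where
  "agreement_edges m T k l = (if (k, l) \<in> off_pairs m then nsets (T (min k l, max k l)) 2 else {})"

definition edge_total :: "nat \<Rightarrow> (nat \<times> nat \<Rightarrow> nat set) \<Rightarrow> real" where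
  "edge_total m T = (\<Sum>(k, l)\<in>off_pairs m. real (card (agreement_edges m T k l)))"

text \<open>A finite set containing every \<open>agree_sets m n \<phi>\<close>. The logarithm of its
  size is O(n), which a union bound can afford when the deviations are on the scale n ln n.\<close>

definition choices :: "nat \<Rightarrow> nat \<Rightarrow> (nat \<times> nat \<Rightarrow> nat set) set" where
  "choices m n = PiE (off_pairs m) (\<lambda>_. Pow {1..n})"

definition agree_sets :: "nat \<Rightarrow> nat \<Rightarrow> (nat \<Rightarrow> nat \<Rightarrow> nat) \<Rightarrow> nat \<times> nat \<Rightarrow> nat set" where
  "agree_sets m n \<phi> = (\<lambda>(k, l)\<in>off_pairs m. {i\<in>{1..n}. \<phi> k i = \<phi> l i})"

abbreviation overlap_sum :: "nat \<Rightarrow> (nat \<times> nat \<Rightarrow> nat set) \<Rightarrow> (nat \<times> nat set \<Rightarrow> real) \<Rightarrow> real" where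
  "overlap_sum m T \<equiv> edge_bijections.overlap m (agreement_edges m T)"

text \<open>The same data set has to serve all relative tuples, so the bound is imposed for every
  family \<open>T\<close>. Its main term is the planted mean of the overlap with
  \<open>equi_slope\<close> in place of \<rho>, which matches the linear term of
  \<open>overlap_mgf_le\<close> exactly; \<open>t\<close> is the slack.\<close>

definition region :: "nat \<Rightarrow> nat \<Rightarrow> real \<Rightarrow> real \<Rightarrow> (nat \<times> nat set \<Rightarrow> real) set" where
  "region m n r t = {X \<in> space (null_law m n). \<forall>T\<in>choices m n. overlap_sum m T X \<le> equi_slope m r / 2 * edge_total m T + t}"

lemma finite_choices [simp]: "finite (choices m n)"
  unfolding choices_def by (intro finite_PiE) auto

lemma card_choices_le: "card (choices m n) \<le> 2 ^ (n * m\<^sup>2)"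
proof -
  have "card (choices m n) = (2 ^ n) ^ card (off_pairs m)"
    unfolding choices_def by (simp add: card_PiE card_Pow)
  also have "\<dots> = 2 ^ (n * card (off_pairs m))" by (simp add: power_mult)
  also have "card (off_pairs m) \<le> m\<^sup>2"
    using card_mono[of "{..<m} \<times> {..<m}" "off_pairs m"] by (auto simp: off_pairs_def power2_eq_square)
  then have "(2 :: nat) ^ (n * card (off_pairs m)) \<le> 2 ^ (n * m\<^sup>2)" by (intro power_increasing) auto
  finally show ?thesis .
qed

lemma agreement_edges_commute: "agreement_edges m T k l = agreement_edges m T l k"
  by (auto simp: agreement_edges_def off_pairs_def min.commute max.commute)

lemma agreement_edges_subset:
  assumes "T \<in> choices m n"
  shows "agreement_edges m T k l \<subseteq> edges n"
proof (cases "(k, l) \<in> off_pairs m")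
  case True
  then have "(min k l, max k l) \<in> off_pairs m" by (auto simp: off_pairs_def min_def max_def)
  then have "T (min k l, max k l) \<subseteq> {1..n}" using PiE_mem[OF assms[unfolded choices_def]] by blast
  then show ?thesis unfolding agreement_edges_def by (auto intro: nsets_mono dest: subsetD[OF nsets_mono])
qed (simp add: agreement_edges_def)

lemma agree_sets_choices: "agree_sets m n \<phi> \<in> choices m n"
  by (auto simp: agree_sets_def choices_def)

lemma agreement_edges_agree_sets:
  assumes "(k, l) \<in> off_pairs m"
  shows "agreement_edges m (agree_sets m n \<phi>) k l = nsets {i\<in>{1..n}. \<phi> k i = \<phi> l i} 2"
proof -
  have "(min k l, max k l) \<in> off_pairs m" using assms by (auto simp: off_pairs_def min_def max_def)
  then have "agree_sets m n \<phi> (min k l, max k l) = {i\<in>{1..n}. \<phi> k i = \<phi> l i}"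
    by (auto simp: agree_sets_def min_def max_def)
  then show ?thesis using assms by (simp add: agreement_edges_def)
qed

lemma edge_total_le:
  assumes "T \<in> choices m n"
  shows "edge_total m T \<le> real m ^ 2 * real n ^ 2"
proof -
  have N: "real (card (edges n)) \<le> real n ^ 2"
    using card_nsets_two_le[of "{1..n}"] by (simp flip: of_nat_power)
  have "edge_total m T \<le> (\<Sum>(k, l)\<in>off_pairs m. real n ^ 2)"
    unfolding edge_total_def case_prod_unfold
  proof (intro sum_mono)
    fix p
    have "card (agreement_edges m T (fst p) (snd p)) \<le> card (edges n)"
      using agreement_edges_subset[OF assms] by (intro card_mono) auto
    then show "real (card (agreement_edges m T (fst p) (snd p))) \<le> real n ^ 2" using N by linarith
  qed
  also have "\<dots> = card (off_pairs m) * real n ^ 2" by (simp add: case_prod_unfold)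
  also have "\<dots> \<le> real m ^ 2 * real n ^ 2"
  proof (intro mult_right_mono)
    have "card (off_pairs m) \<le> m\<^sup>2"
      using card_mono[of "{..<m} \<times> {..<m}" "off_pairs m"] by (auto simp: off_pairs_def power2_eq_square)
    then show "real (card (off_pairs m)) \<le> real m ^ 2" by (simp flip: of_nat_power)
  qed simp
  finally show ?thesis .
qed

lemma edge_total_agree_sets_le:
  "edge_total m (agree_sets m n \<phi>) \<le> (\<Sum>(k, l)\<in>off_pairs m. (real (agree n k l \<phi>))\<^sup>2 / 2)"
  unfolding edge_total_def case_prod_unfold
proof (intro sum_mono)
  fix p assume "p \<in> off_pairs m"
  then have "agreement_edges m (agree_sets m n \<phi>) (fst p) (snd p) = nsets {i\<in>{1..n}. \<phi> (fst p) i = \<phi> (snd p) i} 2"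
    by (intro agreement_edges_agree_sets) simp
  moreover have "2 * card (nsets {i\<in>{1..n}. \<phi> (fst p) i = \<phi> (snd p) i} 2) \<le> (agree n (fst p) (snd p) \<phi>)\<^sup>2"
    unfolding agree_def by (intro card_nsets_two_le) simp
  ultimately have "2 * card (agreement_edges m (agree_sets m n \<phi>) (fst p) (snd p)) \<le> (agree n (fst p) (snd p) \<phi>)\<^sup>2" by simp
  from of_nat_mono[OF this, where 'a = real]
  show "real (card (agreement_edges m (agree_sets m n \<phi>) (fst p) (snd p))) \<le> (real (agree n (fst p) (snd p) \<phi>))\<^sup>2 / 2"
    by simp
qed

lemma card_off_pairs_le: "real (card (off_pairs m)) \<le> real m ^ 2"
proof -
  have "card (off_pairs m) \<le> m\<^sup>2"
    using card_mono[of "{..<m} \<times> {..<m}" "off_pairs m"] by (auto simp: off_pairs_def power2_eq_square)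
  then show ?thesis by (simp flip: of_nat_power)
qed

lemma card_edges_le: "real (card (edges n)) \<le> real n ^ 2"
  using card_nsets_two_le[of "{1..n}"] by (simp flip: of_nat_power)

lemma measurable_overlap_sum:
  assumes "1 \<le> m" and T: "T \<in> choices m n"
  shows "overlap_sum m T \<in> borel_measurable (null_law m n)"
proof -
  interpret edge_bijections m "edges n" "\<lambda>k e. inv_into UNIV id ` e" "\<lambda>k e. id ` e"
    using edge_bijections_latents[OF assms(1) id_in_latents] .
  have "(\<lambda>X. X (k, a)) \<in> borel_measurable (null_law m n)" if "a \<in> agreement_edges m T k l \<or> a \<in> agreement_edges m T l k" for k l a
  proof -
    have "a \<in> edges n" using that agreement_edges_subset[OF T] by blast
    moreover have "k < m" using that by (auto simp: agreement_edges_def off_pairs_def split: if_splits)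
    ultimately have "(k, a) \<in> {..<m} \<times> edges n" by simp
    then show ?thesis unfolding null_law_gaussian by measurable
  qed
  then have "(\<lambda>X. overlap_sum m T X) \<in> borel_measurable (null_law m n)"
    unfolding overlap_def case_prod_unfold using agreement_edges_commute
    by (intro borel_measurable_divide borel_measurable_sum borel_measurable_times) auto
  then show ?thesis .
qed

section \<open>Moment bounds for one relative tuple\<close>

context
  fixes m n :: nat and \<phi> :: "nat \<Rightarrow> nat \<Rightarrow> nat"
  assumes m: "1 \<le> m" and \<phi>: "\<phi> \<in> latents m n"
begin

interpretation edge_bijections m "edges n" "\<lambda>k e. inv_into UNIV (\<phi> k) ` e" "\<lambda>k e. \<phi> k ` e"
  by (rule edge_bijections_latents[OF m \<phi>])

lemma common_le:
  "common \<le> edge_total m (agree_sets m n \<phi>) + (\<Sum>(k, l)\<in>off_pairs m. real (swapped n k l \<phi>))"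
  unfolding common_def edge_total_def sum.distrib[symmetric] case_prod_unfold
proof (intro sum_mono)
  fix p assume p: "p \<in> off_pairs m"
  then have "fst p < m" "snd p < m" by (auto simp: off_pairs_def)
  then have "card {a\<in>edges n. \<phi> (fst p) ` a = \<phi> (snd p) ` a}
      \<le> card (nsets {i\<in>{1..n}. \<phi> (fst p) i = \<phi> (snd p) i} 2) + swapped n (fst p) (snd p) \<phi>"
    unfolding swapped_def by (intro card_common_edges_le latents_permutes[OF \<phi>])
  then show "real (card {a\<in>edges n. \<phi> (fst p) ` a = \<phi> (snd p) ` a})
      \<le> real (card (agreement_edges m (agree_sets m n \<phi>) (fst p) (snd p))) + real (swapped n (fst p) (snd p) \<phi>)"
    using agreement_edges_agree_sets[of "fst p" "snd p" m n \<phi>] p by simp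
qed

text \<open>A matched pair \<open>(a, b)\<close> is determined by \<open>a\<close>, and
  \<open>a\<close> is an edge on which \<open>g\<close> and \<open>h\<close> act alike. Thus
  \<open>card_common_edges_le\<close> applies to these two composed permutations, whose vertex
  agreements are counted by \<open>paired\<close>.\<close>

lemma card_matches_le:
  assumes "k < m" "l < m" "k' < m" "l' < m"
  shows "card (matches k l k' l') \<le> (paired n k l k' l' \<phi>)\<^sup>2 + n"
proof -
  have perm: "\<phi> k permutes {1..n}" "\<phi> l permutes {1..n}" "\<phi> k' permutes {1..n}" "\<phi> l' permutes {1..n}"
    using assms latents_permutes[OF \<phi>] by auto
  define g where "g = inv_into UNIV (\<phi> l) \<circ> \<phi> k"
  define h where "h = inv_into UNIV (\<phi> l') \<circ> \<phi> k'"
  have gh: "g permutes {1..n}" "h permutes {1..n}"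
    unfolding g_def h_def by (intro permutes_compose permutes_inv perm)+
  have img: "g ` a = b" if "\<phi> k ` a = \<phi> l ` b" for a b
    unfolding g_def image_comp[symmetric] that by (rule inv_image_image(1)[OF perm(2)])
  have img': "h ` a = b" if "\<phi> k' ` a = \<phi> l' ` b" for a b
    unfolding h_def image_comp[symmetric] that by (rule inv_image_image(1)[OF perm(4)])
  have "card (matches k l k' l') \<le> card {a\<in>edges n. g ` a = h ` a}"
  proof (rule card_inj_on_le[where f = fst])
    show "inj_on fst (matches k l k' l')"
    proof (rule inj_onI)
      fix p q assume pq: "p \<in> matches k l k' l'" "q \<in> matches k l k' l'" "fst p = fst q"
      obtain a b a' b' where eqs: "p = (a, b)" "q = (a', b')" by (cases p, cases q)
      have "\<phi> k ` a = \<phi> l ` b" "\<phi> k ` a' = \<phi> l ` b'"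
        using pq(1,2) unfolding eqs matches_def by blast+
      then show "p = q" using img[of a b] img[of a' b'] pq(3) by (simp add: eqs)
    qed
    show "fst ` matches k l k' l' \<subseteq> {a\<in>edges n. g ` a = h ` a}"
    proof
      fix a assume "a \<in> fst ` matches k l k' l'"
      then obtain b where "(a, b) \<in> matches k l k' l'" by auto
      then show "a \<in> {a\<in>edges n. g ` a = h ` a}" using img[of a b] img'[of a b] by (auto simp: matches_def)
    qed
  qed simp
  also have "\<dots> \<le> card (nsets {i\<in>{1..n}. g i = h i} 2) + card {i\<in>{1..n}. \<exists>j\<in>{1..n}. i < j \<and> g i = h j \<and> g j = h i}"
    by (rule card_common_edges_le[OF gh])
  also have "card {i\<in>{1..n}. \<exists>j\<in>{1..n}. i < j \<and> g i = h j \<and> g j = h i} \<le> card {1..n}"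
    by (intro card_mono) auto
  also have "card (nsets {i\<in>{1..n}. g i = h i} 2) \<le> (card {i\<in>{1..n}. g i = h i})\<^sup>2"
    using card_nsets_two_le[of "{i\<in>{1..n}. g i = h i}"] by simp
  also have "card {i\<in>{1..n}. g i = h i} \<le> paired n k l k' l' \<phi>"
    unfolding paired_def
  proof (rule card_inj_on_le[where f = "\<lambda>i. (i, g i)"])
    show "(\<lambda>i. (i, g i)) ` {i\<in>{1..n}. g i = h i} \<subseteq> {(i, j)\<in>{1..n} \<times> {1..n}. \<phi> k i = \<phi> l j \<and> \<phi> k' i = \<phi> l' j}"
    proof (rule image_subsetI)
      fix i assume i: "i \<in> {i\<in>{1..n}. g i = h i}"
      have "g i \<in> {1..n}" using i permutes_in_image[OF gh(1)] by blast
      moreover have "\<phi> k i = \<phi> l (g i)" "\<phi> k' i = \<phi> l' (h i)"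
        using permutes_inverses(1)[OF perm(2)] permutes_inverses(1)[OF perm(4)] by (simp_all add: g_def h_def)
      ultimately show "(i, g i) \<in> {(i, j)\<in>{1..n} \<times> {1..n}. \<phi> k i = \<phi> l j \<and> \<phi> k' i = \<phi> l' j}"
        using i by simp
    qed
    show "finite {(i, j)\<in>{1..n} \<times> {1..n}. \<phi> k i = \<phi> l j \<and> \<phi> k' i = \<phi> l' j}"
      by (rule finite_subset[of _ "{1..n} \<times> {1..n}"]) auto
  qed (simp add: inj_on_def)
  finally show ?thesis by (simp add: power_mono)
qed

lemma cross_le:
  assumes "\<And>k l k' l'. (k, l) \<in> off_pairs m \<Longrightarrow> (k', l') \<in> off_pairs m - {(k, l)} \<Longrightarrow> real (paired n k l k' l' \<phi>) \<le> c"
    and c: "0 \<le> c"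
  shows "cross \<le> real m ^ 4 * (c\<^sup>2 + n)"
proof -
  have P: "real (card (off_pairs m)) \<le> real m ^ 2" by (rule card_off_pairs_le)
  have each: "real (card (matches (fst p) (snd p) (fst q) (snd q))) \<le> c\<^sup>2 + n"
    if p: "p \<in> off_pairs m" and q: "q \<in> off_pairs m - {p}" for p q
  proof -
    have "card (matches (fst p) (snd p) (fst q) (snd q)) \<le> (paired n (fst p) (snd p) (fst q) (snd q) \<phi>)\<^sup>2 + n"
      using p q by (intro card_matches_le) (auto simp: off_pairs_def)
    then have "real (card (matches (fst p) (snd p) (fst q) (snd q))) \<le> (real (paired n (fst p) (snd p) (fst q) (snd q) \<phi>))\<^sup>2 + n"
      by (metis of_nat_add of_nat_le_iff of_nat_power)
    also have "\<dots> \<le> c\<^sup>2 + n"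
      using p q assms(1)[of "fst p" "snd p" "fst q" "snd q"] by (intro add_right_mono power_mono) auto
    finally show ?thesis .
  qed
  have "cross \<le> (\<Sum>p\<in>off_pairs m. \<Sum>q\<in>off_pairs m - {p}. c\<^sup>2 + n)"
    unfolding cross_def case_prod_unfold prod.collapse by (intro sum_mono each)
  also have "\<dots> \<le> (\<Sum>p\<in>off_pairs m. \<Sum>q\<in>off_pairs m. c\<^sup>2 + n)"
    by (intro sum_mono sum_mono2) auto
  also have "\<dots> = (real (card (off_pairs m)) * real (card (off_pairs m))) * (c\<^sup>2 + n)" by simp
  also have "\<dots> \<le> (real m ^ 2 * real m ^ 2) * (c\<^sup>2 + n)"
    using P by (intro mult_right_mono mult_mono) auto
  finally show ?thesis by (simp add: power_add[symmetric])
qed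

lemma paired_le_n:
  assumes "k < m" "l < m"
  shows "paired n k l k' l' \<phi> \<le> n"
proof -
  have "\<phi> l permutes {1..n}" using latents_permutes[OF \<phi> assms(2)] .
  then have inj: "\<phi> l x = \<phi> l y \<longleftrightarrow> x = y" for x y using inj_eq[OF permutes_inj] by metis
  have "paired n k l k' l' \<phi> \<le> card {1..n}"
    unfolding paired_def
  proof (rule card_inj_on_le[where f = fst])
    show "inj_on fst {(i, j)\<in>{1..n} \<times> {1..n}. \<phi> k i = \<phi> l j \<and> \<phi> k' i = \<phi> l' j}"
    proof (rule inj_onI)
      fix p q assume pq: "p \<in> {(i, j)\<in>{1..n} \<times> {1..n}. \<phi> k i = \<phi> l j \<and> \<phi> k' i = \<phi> l' j}"
        "q \<in> {(i, j)\<in>{1..n} \<times> {1..n}. \<phi> k i = \<phi> l j \<and> \<phi> k' i = \<phi> l' j}" "fst p = fst q"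
      then have "\<phi> k (fst p) = \<phi> l (snd p)" "\<phi> k (fst q) = \<phi> l (snd q)" by auto
      then have "\<phi> l (snd p) = \<phi> l (snd q)" using pq(3) by simp
      then show "p = q" using pq(3) inj by (simp add: prod_eq_iff)
    qed
  qed auto
  then show ?thesis by simp
qed

text \<open>The bound without truncation. Its merit is the error of order n^2 \<rho>^6, which tends
  to 0 when \<rho>^2 is of order ln n / n.\<close>

lemma relative_moment_le:
  assumes \<rho>: "0 \<le> \<rho>" "\<rho> < 1" "6 * real m ^ 2 * \<rho>\<^sup>2 \<le> 1"
  shows "(\<integral>\<^sup>+ X. ennreal (joint_ratio m n \<rho> X * shifted_ratio m n \<rho> \<phi> X) * indicator G X \<partial>null_law m n)
    \<le> ennreal (exp (\<rho>\<^sup>2 * common + \<rho> ^ 4 * cross + 100 * real m ^ 6 * real n ^ 2 * \<rho> ^ 6))"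
proof -
  have r: "0 \<le> \<rho>\<^sup>2" "\<rho>\<^sup>2 \<le> 1 / 2"
  proof -
    have "1 * \<rho>\<^sup>2 \<le> real m ^ 2 * \<rho>\<^sup>2" using m by (intro mult_right_mono one_le_power) auto
    then show "\<rho>\<^sup>2 \<le> 1 / 2" using \<rho>(3) by simp
  qed simp
  have s: "0 \<le> equi_slope m (\<rho>\<^sup>2)" "equi_slope m (\<rho>\<^sup>2) \<le> 2 * \<rho>\<^sup>2"
    using equi_slope_bounds[OF m r] by auto
  have pos: "0 \<le> common" "0 \<le> cross"
    by (auto simp: common_def cross_def intro!: sum_nonneg)
  have "(\<integral>\<^sup>+ X. ennreal (joint_ratio m n \<rho> X * shifted_ratio m n \<rho> \<phi> X) * indicator G X \<partial>null_law m n)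
      \<le> (\<integral>\<^sup>+ X. ennreal (joint_ratio m n \<rho> X * shifted_ratio m n \<rho> \<phi> X) \<partial>null_law m n)"
    by (intro nn_integral_mono) (auto split: split_indicator)
  also have "\<dots> = (\<integral>\<^sup>+ Z. ennreal (\<Prod>e\<in>edges n. equi_ratio m (\<rho>\<^sup>2) (\<lambda>k. Z (inv_into UNIV (\<phi> k) ` e))) \<partial>gaussian_on (edges n))"
    unfolding joint_ratio_def shifted_ratio_def null_law_gaussian
    by (rule equi_second_moment[OF m \<rho>(1,2) finE bij_\<theta> \<psi>\<theta>])
  also have "\<dots> \<le> ennreal (exp (equi_slope m (\<rho>\<^sup>2) / 2 * common + (equi_slope m (\<rho>\<^sup>2))\<^sup>2 / 4 * cross
        + 100 * real m ^ 6 * card (edges n) * (\<rho>\<^sup>2) ^ 3))"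
    by (rule second_moment_le[OF r(1) \<rho>(3)])
  also have "\<dots> \<le> ennreal (exp (\<rho>\<^sup>2 * common + \<rho> ^ 4 * cross + 100 * real m ^ 6 * real n ^ 2 * \<rho> ^ 6))"
  proof (intro ennreal_leI, subst exp_le_cancel_iff, intro add_mono)
    show "equi_slope m (\<rho>\<^sup>2) / 2 * common \<le> \<rho>\<^sup>2 * common" using s pos by (intro mult_right_mono) auto
    have "(equi_slope m (\<rho>\<^sup>2))\<^sup>2 \<le> (2 * \<rho>\<^sup>2)\<^sup>2" using s by (intro power_mono) auto
    then show "(equi_slope m (\<rho>\<^sup>2))\<^sup>2 / 4 * cross \<le> \<rho> ^ 4 * cross" using pos by (intro mult_right_mono) auto
    show "100 * real m ^ 6 * card (edges n) * (\<rho>\<^sup>2) ^ 3 \<le> 100 * real m ^ 6 * real n ^ 2 * \<rho> ^ 6"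
      using card_edges_le[of n] \<rho>(1) by (simp add: power_mult[symmetric] mult_left_mono mult_right_mono)
  qed
  finally show ?thesis .
qed

lemma relative_moment_le_paired:
  assumes \<rho>: "0 \<le> \<rho>" "\<rho> < 1" "6 * real m ^ 2 * \<rho>\<^sup>2 \<le> 1"
    and c: "\<And>k l k' l'. (k, l) \<in> off_pairs m \<Longrightarrow> (k', l') \<in> off_pairs m - {(k, l)} \<Longrightarrow> real (paired n k l k' l' \<phi>) \<le> c" "0 \<le> c"
  shows "(\<integral>\<^sup>+ X. ennreal (joint_ratio m n \<rho> X * shifted_ratio m n \<rho> \<phi> X) * indicator G X \<partial>null_law m n)
    \<le> ennreal (exp (\<rho>\<^sup>2 * (edge_total m (agree_sets m n \<phi>) + (\<Sum>(k, l)\<in>off_pairs m. real (swapped n k l \<phi>)))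
        + \<rho> ^ 4 * (real m ^ 4 * (c\<^sup>2 + n)) + 100 * real m ^ 6 * real n ^ 2 * \<rho> ^ 6))"
proof -
  have "\<rho>\<^sup>2 * common + \<rho> ^ 4 * cross + 100 * real m ^ 6 * real n ^ 2 * \<rho> ^ 6
      \<le> \<rho>\<^sup>2 * (edge_total m (agree_sets m n \<phi>) + (\<Sum>(k, l)\<in>off_pairs m. real (swapped n k l \<phi>)))
        + \<rho> ^ 4 * (real m ^ 4 * (c\<^sup>2 + n)) + 100 * real m ^ 6 * real n ^ 2 * \<rho> ^ 6"
    using common_le cross_le[OF c] \<rho>(1) by (intro add_right_mono add_mono mult_left_mono) auto
  then show ?thesis
    using relative_moment_le[OF \<rho>, of G] by (elim order_trans) (intro ennreal_leI, simp)
qed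

text \<open>On the region the overlap is at most \<open>b\<close>, so the factor
  \<open>exp (s * (b - overlap))\<close> can only enlarge the integrand and brings in the tilted
  moment. Per agreement edge the threshold contributes \<open>s^2 / 2\<close> and the tilted moment
  \<open>- s^2 / 4\<close>. What remains is \<open>s^2 / 4\<close>, to leading order half of the
  coefficient without truncation; the swaps go into the term linear in \<open>n\<close>.\<close>

lemma relative_moment_truncated_le:
  assumes \<rho>: "0 \<le> \<rho>" "\<rho> < 1" "12 * real m * \<rho> \<le> 1" and t: "0 \<le> t"
  shows "(\<integral>\<^sup>+ X. ennreal (joint_ratio m n \<rho> X * shifted_ratio m n \<rho> \<phi> X) * indicator (region m n \<rho> t) X \<partial>null_law m n)
    \<le> ennreal (exp ((equi_slope m \<rho>)\<^sup>2 / 4 * edge_total m (agree_sets m n \<phi>) + 2 * real m ^ 2 * real n * \<rho>\<^sup>2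
        + 2 * \<rho> * t + 1000 * real m ^ 4 * real n ^ 2 * \<rho> ^ 3))"
proof -
  define s where "s = equi_slope m \<rho>"
  define T where "T = agree_sets m n \<phi>"
  have T: "T \<in> choices m n" by (simp add: T_def agree_sets_choices)
  have r: "\<rho> \<le> 1 / 2"
  proof -
    have "1 * \<rho> \<le> real m * \<rho>" using m \<rho> by (intro mult_right_mono) auto
    then show ?thesis using \<rho>(3) by simp
  qed
  have s: "0 \<le> s" "s \<le> 2 * \<rho>" using equi_slope_bounds[OF m \<rho>(1) r] by (auto simp: s_def)
  define b where "b = s / 2 * edge_total m T + t"
  have R\<psi>: "\<phi> k ` a = \<phi> l ` a" if "a \<in> agreement_edges m T k l" for k l a
  proof -
    have kl: "(k, l) \<in> off_pairs m" using that by (auto simp: agreement_edges_def split: if_splits)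
    have "a \<subseteq> {i\<in>{1..n}. \<phi> k i = \<phi> l i}"
      using that unfolding T_def agreement_edges_agree_sets[OF kl] by (auto simp: nsets_def)
    then show ?thesis by (intro image_cong) auto
  qed
  have L0: "0 \<le> joint_ratio m n \<rho> X * shifted_ratio m n \<rho> \<phi> X" for X
    by (intro mult_nonneg_nonneg joint_ratio_nonneg shifted_ratio_nonneg m \<rho>)
  have "(\<integral>\<^sup>+ X. ennreal (joint_ratio m n \<rho> X * shifted_ratio m n \<rho> \<phi> X) * indicator (region m n \<rho> t) X \<partial>null_law m n)
      \<le> (\<integral>\<^sup>+ X. ennreal (exp (s * b)) * ennreal (joint_ratio m n \<rho> X * shifted_ratio m n \<rho> \<phi> X * exp (- (s * overlap_sum m T X))) \<partial>null_law m n)"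
  proof (intro nn_integral_mono)
    fix X
    show "ennreal (joint_ratio m n \<rho> X * shifted_ratio m n \<rho> \<phi> X) * indicator (region m n \<rho> t) X
        \<le> ennreal (exp (s * b)) * ennreal (joint_ratio m n \<rho> X * shifted_ratio m n \<rho> \<phi> X * exp (- (s * overlap_sum m T X)))"
    proof (cases "X \<in> region m n \<rho> t")
      case True
      then have "overlap_sum m T X \<le> b" using T by (auto simp: region_def b_def s_def)
      then have "s * overlap_sum m T X \<le> s * b" using s by (intro mult_left_mono)
      then have "1 \<le> exp (s * b) * exp (- (s * overlap_sum m T X))" by (simp add: exp_add[symmetric])
      from mult_left_mono[OF this L0[of X]]
      have "joint_ratio m n \<rho> X * shifted_ratio m n \<rho> \<phi> X
          \<le> exp (s * b) * (joint_ratio m n \<rho> X * shifted_ratio m n \<rho> \<phi> X * exp (- (s * overlap_sum m T X)))"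
        by (simp add: mult_ac)
      then show ?thesis using True L0[of X] by (simp add: ennreal_mult[symmetric] ennreal_leI)
    qed simp
  qed
  also have "\<dots> = ennreal (exp (s * b)) * (\<integral>\<^sup>+ X. ennreal (joint_ratio m n \<rho> X * shifted_ratio m n \<rho> \<phi> X * exp (- (s * overlap_sum m T X))) \<partial>null_law m n)"
  proof (rule nn_integral_cmult)
    note [measurable] = measurable_overlap_sum[OF m T]
    show "(\<lambda>X. ennreal (joint_ratio m n \<rho> X * shifted_ratio m n \<rho> \<phi> X * exp (- (s * overlap_sum m T X)))) \<in> borel_measurable (null_law m n)"
      using \<phi> by measurable
  qed
  also have "\<dots> \<le> ennreal (exp (s * b)) * ennreal (exp (s\<^sup>2 / 4 * (2 * common - 3 * edge_total m T)
        + 1000 * real m ^ 4 * card (edges n) * \<rho> ^ 3))"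
    unfolding joint_ratio_def shifted_ratio_def null_law_gaussian s_def edge_total_def
    using agreement_edges_subset[OF T] agreement_edges_commute[of m T] R\<psi>
    by (intro mult_left_mono truncated_moment_le \<rho>) auto
  also have "\<dots> = ennreal (exp (s * b + (s\<^sup>2 / 4 * (2 * common - 3 * edge_total m T)
        + 1000 * real m ^ 4 * card (edges n) * \<rho> ^ 3)))"
    by (simp add: ennreal_mult[symmetric] exp_add)
  also have "\<dots> \<le> ennreal (exp (s\<^sup>2 / 4 * edge_total m T + 2 * real m ^ 2 * real n * \<rho>\<^sup>2
        + 2 * \<rho> * t + 1000 * real m ^ 4 * real n ^ 2 * \<rho> ^ 3))"
  proof (intro ennreal_leI, subst exp_le_cancel_iff)
    define W where "W = (\<Sum>(k, l)\<in>off_pairs m. real (swapped n k l \<phi>))"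
    have "W \<le> (\<Sum>(k, l)\<in>off_pairs m. real n)"
      unfolding W_def case_prod_unfold by (intro sum_mono) (simp add: swapped_le_n)
    also have "\<dots> = real (card (off_pairs m)) * n" by (simp add: case_prod_unfold)
    also have "\<dots> \<le> real m ^ 2 * n"
    proof (intro mult_right_mono)
      have "card (off_pairs m) \<le> m\<^sup>2"
        using card_mono[of "{..<m} \<times> {..<m}" "off_pairs m"] by (auto simp: off_pairs_def power2_eq_square)
      then show "real (card (off_pairs m)) \<le> real m ^ 2" by (simp flip: of_nat_power)
    qed simp
    finally have W: "W \<le> real m ^ 2 * n" .
    have "common \<le> edge_total m T + real m ^ 2 * n" using common_le W by (simp add: T_def W_def)
    then have "s\<^sup>2 / 4 * (2 * common - 3 * edge_total m T) \<le> s\<^sup>2 / 4 * (2 * (real m ^ 2 * n) - edge_total m T)"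
      by (intro mult_left_mono) auto
    moreover have "s * b = s\<^sup>2 / 2 * edge_total m T + s * t" by (simp add: b_def power2_eq_square algebra_simps)
    moreover have "s * t \<le> 2 * \<rho> * t" using s t by (intro mult_right_mono)
    moreover have "s\<^sup>2 * (real m ^ 2 * n) \<le> (2 * \<rho>)\<^sup>2 * (real m ^ 2 * n)"
      using s by (intro mult_right_mono power_mono) auto
    moreover have "1000 * real m ^ 4 * card (edges n) * \<rho> ^ 3 \<le> 1000 * real m ^ 4 * real n ^ 2 * \<rho> ^ 3"
      using card_edges_le[of n] \<rho>(1) by (intro mult_right_mono mult_left_mono) auto
    ultimately show "s * b + (s\<^sup>2 / 4 * (2 * common - 3 * edge_total m T) + 1000 * real m ^ 4 * card (edges n) * \<rho> ^ 3)
        \<le> s\<^sup>2 / 4 * edge_total m T + 2 * real m ^ 2 * real n * \<rho>\<^sup>2 + 2 * \<rho> * t + 1000 * real m ^ 4 * real n ^ 2 * \<rho> ^ 3"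
      by (simp add: algebra_simps power2_eq_square)
  qed
  finally show ?thesis by (simp add: s_def T_def)
qed

end

section \<open>The mass of the region under the aligned planted law\<close>

lemma region_measurable [measurable]:
  assumes "1 \<le> m"
  shows "region m n r t \<in> sets (null_law m n)"
proof -
  have "{X \<in> space (null_law m n). overlap_sum m T X \<le> c} \<in> sets (null_law m n)" if "T \<in> choices m n" for T c
    using measurable_overlap_sum[OF assms that] by measurable
  then show ?thesis
    unfolding region_def by (intro sets.sets_Collect_finite_All) auto
qed

lemma joint_ratio_integral:
  assumes "1 \<le> m" "0 \<le> \<rho>" "\<rho> < 1"
  shows "(\<integral>\<^sup>+ X. ennreal (joint_ratio m n \<rho> X) \<partial>null_law m n) = 1"
proof -
  have "planted_law_given m n \<rho> (\<lambda>_. id) = density (null_law m n) (\<lambda>X. ennreal (joint_ratio m n \<rho> X))"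
    unfolding joint_ratio_likelihood by (rule planted_law_given_density[OF assms permutes_id])
  then have "prob_space (density (null_law m n) (\<lambda>X. ennreal (joint_ratio m n \<rho> X)))"
    using prob_space_planted_law_given[OF assms] by metis
  from prob_space.emeasure_space_1[OF this] show ?thesis
    by (simp add: emeasure_density cong: nn_integral_cong)
qed

text \<open>A Chernoff bound with parameter \<kappa> for each family \<open>T\<close>, followed by a
  union bound whose size is the power of 2. The linear term of \<open>overlap_mgf_le\<close> cancels
  against the main term of the threshold, leaving only the slack \<open>t\<close> to work against
  the variance term.\<close>

lemma region_mean_ge:
  assumes m: "1 \<le> m" and \<rho>: "0 \<le> \<rho>" "\<rho> < 1" and \<kappa>: "0 \<le> \<kappa>" "6 * real m * (\<rho> + \<kappa>) \<le> 1"
  shows "ennreal (1 - 2 ^ (n * m\<^sup>2) * exp (- (\<kappa> * t) + \<kappa>\<^sup>2 / 4 * (real m ^ 2 * real n ^ 2)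
        + 100 * real m ^ 4 * real n ^ 2 * (\<rho> + \<kappa>) ^ 3))
    \<le> (\<integral>\<^sup>+ X. ennreal (joint_ratio m n \<rho> X) * indicator (region m n \<rho> t) X \<partial>null_law m n)"
proof -
  interpret edge_bijections m "edges n" "\<lambda>k e. inv_into UNIV id ` e" "\<lambda>k e. id ` e"
    using edge_bijections_latents[OF m id_in_latents] .
  define c where "c = exp (- (\<kappa> * t) + \<kappa>\<^sup>2 / 4 * (real m ^ 2 * real n ^ 2)
        + 100 * real m ^ 4 * real n ^ 2 * (\<rho> + \<kappa>) ^ 3)"
  define b where "b T = equi_slope m \<rho> / 2 * edge_total m T + t" for T
  let ?Q = "null_law m n" and ?J = "joint_ratio m n \<rho>"
  have J0: "0 \<le> ?J X" for X by (rule joint_ratio_nonneg[OF m \<rho>])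
  have meas: "overlap_sum m T \<in> borel_measurable ?Q" if "T \<in> choices m n" for T
    using measurable_overlap_sum[OF m that] .
  have meas_tail: "(\<lambda>X. ennreal (?J X * exp (\<kappa> * (overlap_sum m T X - b T)))) \<in> borel_measurable ?Q"
    if "T \<in> choices m n" for T
    using meas[OF that] by measurable
  have [measurable]: "region m n \<rho> t \<in> sets ?Q" by (rule region_measurable[OF m])
  have meas_region: "(\<lambda>X. ennreal (?J X) * indicator (region m n \<rho> t) X) \<in> borel_measurable ?Q"
    by measurable
  have tail: "(\<integral>\<^sup>+ X. ennreal (?J X * exp (\<kappa> * (overlap_sum m T X - b T))) \<partial>?Q) \<le> ennreal c" if T: "T \<in> choices m n" for T
  proof -
    have "(\<integral>\<^sup>+ X. ennreal (?J X * exp (\<kappa> * (overlap_sum m T X - b T))) \<partial>?Q)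
        = (\<integral>\<^sup>+ X. ennreal (exp (- (\<kappa> * b T))) * ennreal (?J X * exp (\<kappa> * overlap_sum m T X)) \<partial>?Q)"
    proof (rule nn_integral_cong)
      fix X
      have "exp (\<kappa> * (overlap_sum m T X - b T)) = exp (- (\<kappa> * b T)) * exp (\<kappa> * overlap_sum m T X)"
        by (simp add: exp_add[symmetric] algebra_simps)
      then show "ennreal (?J X * exp (\<kappa> * (overlap_sum m T X - b T)))
          = ennreal (exp (- (\<kappa> * b T))) * ennreal (?J X * exp (\<kappa> * overlap_sum m T X))"
        using J0 by (simp add: ennreal_mult[symmetric] mult_ac)
    qed
    also have "\<dots> = ennreal (exp (- (\<kappa> * b T))) * (\<integral>\<^sup>+ X. ennreal (?J X * exp (\<kappa> * overlap_sum m T X)) \<partial>?Q)"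
      using meas[OF T] by (intro nn_integral_cmult) measurable
    also have "\<dots> \<le> ennreal (exp (- (\<kappa> * b T))) * ennreal (exp ((equi_slope m \<rho> * \<kappa> / 2 + \<kappa>\<^sup>2 / 4) * edge_total m T
        + 100 * real m ^ 4 * card (edges n) * (\<rho> + \<kappa>) ^ 3))"
      unfolding joint_ratio_def null_law_gaussian edge_total_def
      using agreement_edges_subset[OF T] agreement_edges_commute[of m T]
      by (intro mult_left_mono overlap_mgf_le \<rho> \<kappa>) auto
    also have "\<dots> = ennreal (exp (- (\<kappa> * b T) + ((equi_slope m \<rho> * \<kappa> / 2 + \<kappa>\<^sup>2 / 4) * edge_total m T
        + 100 * real m ^ 4 * card (edges n) * (\<rho> + \<kappa>) ^ 3)))"
      unfolding exp_add[of "- (\<kappa> * b T)"] by (rule ennreal_mult[symmetric]) (rule exp_ge_zero)+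
    also have "\<dots> \<le> ennreal c"
      unfolding c_def
    proof (intro ennreal_leI, subst exp_le_cancel_iff)
      have "\<kappa>\<^sup>2 / 4 * edge_total m T \<le> \<kappa>\<^sup>2 / 4 * (real m ^ 2 * real n ^ 2)"
        using edge_total_le[OF T] by (intro mult_left_mono) auto
      moreover have "100 * real m ^ 4 * card (edges n) * (\<rho> + \<kappa>) ^ 3 \<le> 100 * real m ^ 4 * real n ^ 2 * (\<rho> + \<kappa>) ^ 3"
        using card_edges_le[of n] \<rho> \<kappa> by (intro mult_right_mono mult_left_mono) auto
      moreover have "- (\<kappa> * b T) + (equi_slope m \<rho> * \<kappa> / 2 + \<kappa>\<^sup>2 / 4) * edge_total m T = - (\<kappa> * t) + \<kappa>\<^sup>2 / 4 * edge_total m T"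
        by (simp add: b_def algebra_simps)
      ultimately show "- (\<kappa> * b T) + ((equi_slope m \<rho> * \<kappa> / 2 + \<kappa>\<^sup>2 / 4) * edge_total m T
          + 100 * real m ^ 4 * card (edges n) * (\<rho> + \<kappa>) ^ 3)
        \<le> - (\<kappa> * t) + \<kappa>\<^sup>2 / 4 * (real m ^ 2 * real n ^ 2) + 100 * real m ^ 4 * real n ^ 2 * (\<rho> + \<kappa>) ^ 3"
        by simp
    qed
    finally show ?thesis .
  qed
  have "1 = (\<integral>\<^sup>+ X. ennreal (?J X) \<partial>?Q)" by (rule joint_ratio_integral[OF m \<rho>, symmetric])
  also have "\<dots> \<le> (\<integral>\<^sup>+ X. ennreal (?J X) * indicator (region m n \<rho> t) X
      + (\<Sum>T\<in>choices m n. ennreal (?J X * exp (\<kappa> * (overlap_sum m T X - b T)))) \<partial>?Q)"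
  proof (intro nn_integral_mono)
    fix X assume X: "X \<in> space ?Q"
    show "ennreal (?J X) \<le> ennreal (?J X) * indicator (region m n \<rho> t) X
      + (\<Sum>T\<in>choices m n. ennreal (?J X * exp (\<kappa> * (overlap_sum m T X - b T))))"
    proof (cases "X \<in> region m n \<rho> t")
      case False
      then obtain T where T: "T \<in> choices m n" "b T \<le> overlap_sum m T X"
        using X by (auto simp: region_def b_def not_le intro: less_imp_le)
      then have "1 \<le> exp (\<kappa> * (overlap_sum m T X - b T))" using \<kappa> by simp
      from mult_left_mono[OF this J0[of X]]
      have "ennreal (?J X) \<le> ennreal (?J X * exp (\<kappa> * (overlap_sum m T X - b T)))" by (intro ennreal_leI) simp
      also have "\<dots> \<le> (\<Sum>T\<in>choices m n. ennreal (?J X * exp (\<kappa> * (overlap_sum m T X - b T))))"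
        using T by (intro member_le_sum) auto
      finally show ?thesis using False by simp
    qed simp
  qed
  also have "\<dots> = (\<integral>\<^sup>+ X. ennreal (?J X) * indicator (region m n \<rho> t) X \<partial>?Q)
      + (\<integral>\<^sup>+ X. (\<Sum>T\<in>choices m n. ennreal (?J X * exp (\<kappa> * (overlap_sum m T X - b T)))) \<partial>?Q)"
    by (rule nn_integral_add[OF meas_region borel_measurable_sum[OF meas_tail]])
  also have "(\<integral>\<^sup>+ X. (\<Sum>T\<in>choices m n. ennreal (?J X * exp (\<kappa> * (overlap_sum m T X - b T)))) \<partial>?Q)
      = (\<Sum>T\<in>choices m n. \<integral>\<^sup>+ X. ennreal (?J X * exp (\<kappa> * (overlap_sum m T X - b T))) \<partial>?Q)"
    by (rule nn_integral_sum[OF meas_tail])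
  also have "\<dots> \<le> (\<Sum>T\<in>choices m n. ennreal c)" by (intro sum_mono tail)
  also have "\<dots> = ennreal (real (card (choices m n)) * c)"
    by (simp add: ennreal_mult ennreal_of_nat_eq_real_of_nat c_def)
  also have "\<dots> \<le> ennreal (2 ^ (n * m\<^sup>2) * c)"
  proof (intro ennreal_leI mult_right_mono)
    show "real (card (choices m n)) \<le> 2 ^ (n * m\<^sup>2)"
      using of_nat_mono[OF card_choices_le[of m n], where 'a = real] by simp
    show "0 \<le> c" by (simp add: c_def)
  qed
  finally have "1 \<le> (\<integral>\<^sup>+ X. ennreal (?J X) * indicator (region m n \<rho> t) X \<partial>?Q) + ennreal (2 ^ (n * m\<^sup>2) * c)"
    by (simp add: add_left_mono)
  then have "1 - ennreal (2 ^ (n * m\<^sup>2) * c) \<le> (\<integral>\<^sup>+ X. ennreal (?J X) * indicator (region m n \<rho> t) X \<partial>?Q)"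
    by (simp add: ennreal_minus_le_iff add.commute)
  then show ?thesis by (simp add: c_def ennreal_minus[symmetric])
qed

subsection \<open>Asymptotics\<close>

text \<open>The slope decreases in \<open>m\<close>, and at \<open>m = 2\<close> the bound is an
  equality.\<close>

lemma equi_slope_le:
  assumes "2 \<le> m" "0 \<le> r" "r < 1"
  shows "equi_slope m r \<le> r / (1 - r\<^sup>2)"
proof -
  have "(1 - r) * (1 + r) \<le> (1 - r) * (1 + (real m - 1) * r)"
    using assms mult_right_mono[of 1 "real m - 1" r] by (intro mult_left_mono) auto
  moreover have "(1 - r) * (1 + r) = 1 - r\<^sup>2" by (simp add: algebra_simps power2_eq_square)
  moreover have "0 < 1 - r\<^sup>2" using assms by (simp add: abs_square_less_1)
  ultimately show ?thesis
    unfolding equi_slope_def using assms by (intro divide_left_mono) auto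
qed

text \<open>Three kinds of relative tuples give the three exponentials. If all statistics are at
  most \<open>K = n^(1/4)\<close>, the exponent vanishes because \<open>K^2 ln n / n\<close> does.
  If some statistic exceeds \<open>K\<close> but no pair agrees on more than
  \<open>\<delta> n\<close> vertices, the moment is compared with \<open>x ^ peak\<close> for
  \<open>x = n^(1/8)\<close>; its mean costs \<open>exp (n^(1/8))\<close>, which is less than the
  gain \<open>exp (L * K / 16)\<close>. Otherwise it is compared with \<open>n ^ repeats\<close>,
  whose mean costs \<open>exp (M^2 * n)\<close>, against a gain of order n ln n in the exponent. The
  slack is scaled by the bound \<open>b\<close> and not by \<rho>, so that it stays large enough for
  the union bound even if \<rho> is tiny.\<close>

lemma region_square_le:
  fixes m n :: nat and \<rho> \<eta> M L K b \<delta> :: real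
  defines "M \<equiv> real m" and "L \<equiv> ln (real n)" and "K \<equiv> real n powr (1 / 4)" and "b \<equiv> 2 * sqrt (ln (real n) / real n)"
  defines "\<delta> \<equiv> 1 / (32 * (real m)\<^sup>2)"
  assumes m: "2 \<le> m" and n: "2 \<le> n" and \<eta>: "0 < \<eta>" "\<eta> < 1"
    and \<rho>: "0 \<le> \<rho>" "\<rho> < 1" "\<rho>\<^sup>2 \<le> 8 * (1 - \<eta>) / M * (L / n)" "\<rho> \<le> b"
    and small: "12 * M * \<rho> \<le> 1" "6 * M ^ 2 * \<rho>\<^sup>2 \<le> 1" "1 - \<eta> \<le> (1 - \<eta> / 2) * (1 - \<rho>\<^sup>2)\<^sup>2"
  shows "(\<Sum>\<phi>\<in>latents m n. \<integral>\<^sup>+ X. ennreal (joint_ratio m n \<rho> X * shifted_ratio m n \<rho> \<phi> X)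
        * indicator (region m n \<rho> (\<eta> * \<delta> / 32 * real n ^ 2 * b)) X \<partial>null_law m n)
    \<le> ennreal (card (latents m n) * (exp (4 * (L / n) * M ^ 2 * (K ^ 2 + K) + 16 * (L / n) ^ 2 * M ^ 4 * (9 * K ^ 2 + n) + 6400 * M ^ 6 * real n ^ 2 * (L / n) ^ 3)
        + (3 * M ^ 4 + 1) * exp (real n powr (1 / 8) + 4 * M ^ 2 * L + 32 * M ^ 4 * L ^ 2 + 6400 * M ^ 6 * real n ^ 2 * (L / n) ^ 3 - L * K / 16)
        + exp (M ^ 2 * n + 8 * M ^ 2 * L + 1000 * M ^ 4 * real n ^ 2 * b ^ 3 - \<eta> * \<delta> / 4 * real n * L)))"
proof -
  define v where "v = L / n"
  define t where "t = \<eta> * \<delta> / 32 * real n ^ 2 * b"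
  define x where "x = real n powr (1 / 8)"
  define D where "D = repeats m n"
  have m1: "1 \<le> m" and M: "2 \<le> M" using m by (auto simp: M_def)
  have n0: "0 < real n" and L: "0 \<le> L" using n by (auto simp: L_def)
  have v: "0 \<le> v" "v * n = L" using n0 L by (auto simp: v_def)
  have b: "0 \<le> b" "b\<^sup>2 = 4 * v" using n0 L by (auto simp: b_def v_def L_def power_mult_distrib)
  have \<delta>: "0 < \<delta>" "M ^ 2 * \<delta> = 1 / 32" using M by (auto simp: \<delta>_def M_def)
  have K: "1 \<le> K" using n by (auto simp: K_def ge_one_powr_ge_zero)
  have x: "1 \<le> x" using n by (auto simp: x_def ge_one_powr_ge_zero)
  have t: "0 \<le> t" using \<eta> \<delta> b by (auto simp: t_def)
  have \<rho>2: "\<rho>\<^sup>2 \<le> 4 * v" using power_mono[OF \<rho>(4,1), of 2] b by simp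
  have \<rho>4: "\<rho> ^ 4 \<le> 16 * v ^ 2"
  proof -
    have "(\<rho>\<^sup>2) ^ 2 \<le> (4 * v) ^ 2" by (rule power_mono[OF \<rho>2]) simp
    then show ?thesis by (simp add: power_mult[symmetric] power_mult_distrib)
  qed
  have \<rho>6: "\<rho> ^ 6 \<le> 64 * v ^ 3"
  proof -
    have "(\<rho>\<^sup>2) ^ 3 \<le> (4 * v) ^ 3" by (rule power_mono[OF \<rho>2]) simp
    then show ?thesis by (simp add: power_mult[symmetric] power_mult_distrib)
  qed
  have P: "real (card (off_pairs m)) \<le> M ^ 2" using card_off_pairs_le by (simp add: M_def)
  define g1 where "g1 = 4 * v * M ^ 2 * (K ^ 2 + K) + 16 * v ^ 2 * M ^ 4 * (9 * K ^ 2 + n) + 6400 * M ^ 6 * real n ^ 2 * v ^ 3"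
  define g2 where "g2 = 4 * M ^ 2 * L + 32 * M ^ 4 * L ^ 2 + 6400 * M ^ 6 * real n ^ 2 * v ^ 3 - L * K / 16"
  define g3 where "g3 = 8 * M ^ 2 * L + 1000 * M ^ 4 * real n ^ 2 * b ^ 3 - \<eta> * \<delta> / 4 * real n * L"
  let ?S = "\<lambda>\<phi>. \<integral>\<^sup>+ X. ennreal (joint_ratio m n \<rho> X * shifted_ratio m n \<rho> \<phi> X) * indicator (region m n \<rho> t) X \<partial>null_law m n"
  have exponent: "\<rho>\<^sup>2 * a + \<rho> ^ 4 * (M ^ 4 * c) + 100 * M ^ 6 * real n ^ 2 * \<rho> ^ 6
      \<le> 4 * v * A + 16 * v ^ 2 * M ^ 4 * C + 6400 * M ^ 6 * real n ^ 2 * v ^ 3"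
    if "0 \<le> a" "a \<le> A" "0 \<le> c" "c \<le> C" for a A c C
  proof -
    have 1: "\<rho>\<^sup>2 * a \<le> 4 * v * A" using \<rho>2 that v by (intro mult_mono) auto
    have "\<rho> ^ 4 * (M ^ 4 * c) \<le> 16 * v ^ 2 * (M ^ 4 * C)"
      using \<rho>4 that v M by (intro mult_mono mult_left_mono) auto
    then have 2: "\<rho> ^ 4 * (M ^ 4 * c) \<le> 16 * v ^ 2 * M ^ 4 * C" by (simp only: mult.assoc)
    have "100 * M ^ 6 * real n ^ 2 * \<rho> ^ 6 \<le> 100 * M ^ 6 * real n ^ 2 * (64 * v ^ 3)"
      using \<rho>6 M by (intro mult_left_mono) auto
    also have "\<dots> = 6400 * M ^ 6 * real n ^ 2 * v ^ 3" by simp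
    finally have 3: "100 * M ^ 6 * real n ^ 2 * \<rho> ^ 6 \<le> 6400 * M ^ 6 * real n ^ 2 * v ^ 3" .
    show ?thesis by (rule add_mono[OF add_mono[OF 1 2] 3])
  qed
  have one: "?S \<phi> \<le> ennreal (exp g1 + x ^ peak m n \<phi> * exp g2 + real n ^ D \<phi> * exp g3)" if \<phi>: "\<phi> \<in> latents m n" for \<phi>
  proof -
    define ET where "ET = edge_total m (agree_sets m n \<phi>)"
    define SW where "SW = (\<Sum>(k, l)\<in>off_pairs m. real (swapped n k l \<phi>))"
    have nonneg: "0 \<le> ET" "0 \<le> SW" by (auto simp: ET_def SW_def edge_total_def intro!: sum_nonneg)
    have ET: "ET \<le> (\<Sum>(k, l)\<in>off_pairs m. (real (agree n k l \<phi>))\<^sup>2 / 2)"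
      unfolding ET_def by (rule edge_total_agree_sets_le)
    have terms: "0 \<le> x ^ peak m n \<phi> * exp g2" "0 \<le> real n ^ D \<phi> * exp g3" using x by auto
    consider (good) "real (peak m n \<phi>) \<le> K"
      | (middle) "K < peak m n \<phi>" "\<And>k l. (k, l) \<in> off_pairs m \<Longrightarrow> real (agree n k l \<phi>) \<le> \<delta> * n"
      | (large) k l where "(k, l) \<in> off_pairs m" "\<delta> * n < real (agree n k l \<phi>)"
      by (meson not_le)
    then show ?thesis
    proof cases
      case good
      have "ET \<le> (\<Sum>(k, l)\<in>off_pairs m. K ^ 2)"
      proof (rule order_trans[OF ET], unfold case_prod_unfold, intro sum_mono)
        fix p assume "p \<in> off_pairs m"
        then have "agree n (fst p) (snd p) \<phi> \<le> peak m n \<phi>" by (intro agree_le_peak[of _ _ m]) simp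
        then have "real (agree n (fst p) (snd p) \<phi>) \<le> K" using good by linarith
        then have "(real (agree n (fst p) (snd p) \<phi>))\<^sup>2 \<le> K ^ 2" by (intro power_mono) auto
        then show "(real (agree n (fst p) (snd p) \<phi>))\<^sup>2 / 2 \<le> K ^ 2"
          using zero_le_power2[of "real (agree n (fst p) (snd p) \<phi>)"] by linarith
      qed
      moreover have "SW \<le> (\<Sum>(k, l)\<in>off_pairs m. K)"
        unfolding SW_def case_prod_unfold
      proof (intro sum_mono)
        fix p assume "p \<in> off_pairs m"
        then have "swapped n (fst p) (snd p) \<phi> \<le> peak m n \<phi>" by (intro swapped_le_peak[of _ _ m]) simp
        then show "real (swapped n (fst p) (snd p) \<phi>) \<le> K" using good by linarith
      qed
      ultimately have "ET + SW \<le> card (off_pairs m) * (K ^ 2 + K)"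
        by (simp add: case_prod_unfold distrib_left)
      also have "\<dots> \<le> M ^ 2 * (K ^ 2 + K)" using P K by (intro mult_right_mono) auto
      finally have A: "ET + SW \<le> M ^ 2 * (K ^ 2 + K)" .
      have "?S \<phi> \<le> ennreal (exp (\<rho>\<^sup>2 * (ET + SW) + \<rho> ^ 4 * (M ^ 4 * ((3 * K)\<^sup>2 + n)) + 100 * M ^ 6 * real n ^ 2 * \<rho> ^ 6))"
        unfolding ET_def SW_def M_def
      proof (rule relative_moment_le_paired[OF m1 \<phi> \<rho>(1,2)])
        show "6 * real m ^ 2 * \<rho>\<^sup>2 \<le> 1" using small by (simp add: M_def)
        fix k l k' l' assume "(k, l) \<in> off_pairs m" "(k', l') \<in> off_pairs m - {(k, l)}"
        then have "paired n k l k' l' \<phi> \<le> 3 * peak m n \<phi>" by (rule paired_le_peak[OF \<phi>])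
        from of_nat_mono[OF this, where 'a = real]
        show "real (paired n k l k' l' \<phi>) \<le> 3 * K" using good by simp
      qed (use K in simp)
      also have "\<dots> \<le> ennreal (exp g1)"
      proof (intro ennreal_leI, subst exp_le_cancel_iff)
        have "\<rho>\<^sup>2 * (ET + SW) + \<rho> ^ 4 * (M ^ 4 * ((3 * K)\<^sup>2 + n)) + 100 * M ^ 6 * real n ^ 2 * \<rho> ^ 6
            \<le> 4 * v * (M ^ 2 * (K ^ 2 + K)) + 16 * v ^ 2 * M ^ 4 * (9 * K ^ 2 + n) + 6400 * M ^ 6 * real n ^ 2 * v ^ 3"
          using nonneg A by (intro exponent) (auto simp: power_mult_distrib)
        then show "\<rho>\<^sup>2 * (ET + SW) + \<rho> ^ 4 * (M ^ 4 * ((3 * K)\<^sup>2 + n)) + 100 * M ^ 6 * real n ^ 2 * \<rho> ^ 6 \<le> g1"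
          by (simp only: g1_def mult.assoc)
      qed
      also have "\<dots> \<le> ennreal (exp g1 + x ^ peak m n \<phi> * exp g2 + real n ^ D \<phi> * exp g3)"
        using terms by (intro ennreal_leI) linarith
      finally show ?thesis .
    next
      case middle
      \<comment> \<open>One factor of each squared agreement is bounded by
        \<open>\<delta> * n\<close> and the other by \<open>p\<close>. With
        \<open>\<delta> = 1 / (32 * M^2)\<close> and \<open>\<rho>^2 \<le> 4 * v\<close> the main
        exponent is at most \<open>L * p / 16\<close>, half of the \<open>L * p / 8\<close> in
        \<open>x ^ p\<close>; the other half is at least \<open>L * K / 16\<close> and is the gain
        in \<open>g2\<close>.\<close>
      define p where "p = real (peak m n \<phi>)"
      have "ET \<le> (\<Sum>(k, l)\<in>off_pairs m. \<delta> * n * p / 2)"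
      proof (rule order_trans[OF ET], unfold case_prod_unfold, intro sum_mono)
        fix q assume q: "q \<in> off_pairs m"
        then have "agree n (fst q) (snd q) \<phi> \<le> peak m n \<phi>" by (intro agree_le_peak[of _ _ m]) simp
        then have "real (agree n (fst q) (snd q) \<phi>) \<le> p" by (simp add: p_def)
        moreover have "real (agree n (fst q) (snd q) \<phi>) \<le> \<delta> * n" using middle(2)[of "fst q" "snd q"] q by simp
        ultimately have "real (agree n (fst q) (snd q) \<phi>) * real (agree n (fst q) (snd q) \<phi>) \<le> (\<delta> * n) * p"
          using \<delta> by (intro mult_mono) auto
        then show "(real (agree n (fst q) (snd q) \<phi>))\<^sup>2 / 2 \<le> \<delta> * n * p / 2"
          by (simp add: power2_eq_square)
      qed
      moreover have "SW \<le> (\<Sum>(k, l)\<in>off_pairs m. real n)"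
        unfolding SW_def case_prod_unfold by (intro sum_mono) (simp add: swapped_le_n)
      ultimately have "ET + SW \<le> card (off_pairs m) * (\<delta> * n * p / 2 + n)"
        by (simp add: case_prod_unfold distrib_left)
      also have "\<dots> \<le> M ^ 2 * (\<delta> * n * p / 2 + n)"
        using P \<delta> by (intro mult_right_mono) (auto simp: p_def)
      finally have A: "ET + SW \<le> M ^ 2 * (\<delta> * n * p / 2 + n)" .
      have "?S \<phi> \<le> ennreal (exp (\<rho>\<^sup>2 * (ET + SW) + \<rho> ^ 4 * (M ^ 4 * ((real n)\<^sup>2 + n)) + 100 * M ^ 6 * real n ^ 2 * \<rho> ^ 6))"
        unfolding ET_def SW_def M_def
      proof (rule relative_moment_le_paired[OF m1 \<phi> \<rho>(1,2)])
        show "6 * real m ^ 2 * \<rho>\<^sup>2 \<le> 1" using small by (simp add: M_def)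
        fix k l k' l' assume "(k, l) \<in> off_pairs m"
        then show "real (paired n k l k' l' \<phi>) \<le> real n"
          using paired_le_n[OF m1 \<phi>, of k l k' l'] by (auto simp: off_pairs_def)
      qed simp
      also have "\<dots> \<le> ennreal (exp (L * p / 16 + (g2 + L * K / 16)))"
      proof (intro ennreal_leI, subst exp_le_cancel_iff)
        have "real n \<le> (real n)\<^sup>2" using n by (simp add: power2_eq_square)
        then have "\<rho>\<^sup>2 * (ET + SW) + \<rho> ^ 4 * (M ^ 4 * ((real n)\<^sup>2 + n)) + 100 * M ^ 6 * real n ^ 2 * \<rho> ^ 6
            \<le> 4 * v * (M ^ 2 * (\<delta> * n * p / 2 + n)) + 16 * v ^ 2 * M ^ 4 * (2 * (real n)\<^sup>2) + 6400 * M ^ 6 * real n ^ 2 * v ^ 3"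
          using nonneg A by (intro exponent) auto
        also have "4 * v * (M ^ 2 * (\<delta> * n * p / 2 + n)) = 2 * (M ^ 2 * \<delta>) * (v * n) * p + 4 * M ^ 2 * (v * n)"
          by (simp add: algebra_simps)
        also have "\<dots> = L * p / 16 + 4 * M ^ 2 * L" unfolding \<delta>(2) v(2) by simp
        also have "16 * v ^ 2 * M ^ 4 * (2 * (real n)\<^sup>2) = 32 * M ^ 4 * (v * n) ^ 2"
          by (simp add: power_mult_distrib)
        finally show "\<rho>\<^sup>2 * (ET + SW) + \<rho> ^ 4 * (M ^ 4 * ((real n)\<^sup>2 + n)) + 100 * M ^ 6 * real n ^ 2 * \<rho> ^ 6
            \<le> L * p / 16 + (g2 + L * K / 16)"
          unfolding v(2) by (simp add: g2_def)
      qed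
      also have "\<dots> \<le> ennreal (x ^ peak m n \<phi> * exp g2)"
      proof (intro ennreal_leI)
        have "x ^ peak m n \<phi> = exp (p * (L / 8))"
        proof -
          have "x = exp (L / 8)" using n0 by (simp add: x_def L_def powr_def)
          then show ?thesis unfolding p_def exp_of_nat_mult by simp
        qed
        moreover have "L * K \<le> L * p" using middle(1) L by (intro mult_left_mono) (auto simp: p_def)
        then have "L * p / 16 + (g2 + L * K / 16) \<le> p * (L / 8) + g2" by (simp add: mult.commute)
        ultimately show "exp (L * p / 16 + (g2 + L * K / 16)) \<le> x ^ peak m n \<phi> * exp g2"
          by (simp add: exp_add[symmetric])
      qed
      also have "\<dots> \<le> ennreal (exp g1 + x ^ peak m n \<phi> * exp g2 + real n ^ D \<phi> * exp g3)"
        using terms exp_ge_zero[of g1] by (intro ennreal_leI) linarith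
      finally show ?thesis .
    next
      case large
      define s where "s = equi_slope m \<rho>"
      define d where "d = real (D \<phi>)"
      have d: "\<delta> * n \<le> d"
        using large agree_le_repeats[OF large(1), of n \<phi>] by (simp add: d_def D_def)
      \<comment> \<open>One factor of each square is at most \<open>n\<close> and the other factors
        sum to at most \<open>M * d\<close>, so \<open>ET \<le> n * M * d / 2\<close>. With
        \<open>s^2\<close> close to at most \<open>8 * (1 - \<eta>) / M * (L / n)\<close>, the
        exponent \<open>s^2 / 4 * ET\<close> is about \<open>(1 - \<eta>) * L * d\<close>, while
        \<open>n ^ d\<close> pays for \<open>L * d\<close>: this balance fixes the constant
        \<open>8 / m\<close>.\<close>
      have "ET \<le> real n / 2 * (\<Sum>(k, l)\<in>off_pairs m. real (agree n k l \<phi>))"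
        unfolding sum_distrib_left
      proof (rule order_trans[OF ET], unfold case_prod_unfold, intro sum_mono)
        fix q
        have "real (agree n (fst q) (snd q) \<phi>) * real (agree n (fst q) (snd q) \<phi>) \<le> real n * real (agree n (fst q) (snd q) \<phi>)"
          using agree_le_n by (intro mult_right_mono) auto
        then show "(real (agree n (fst q) (snd q) \<phi>))\<^sup>2 / 2 \<le> real n / 2 * real (agree n (fst q) (snd q) \<phi>)"
          by (simp add: power2_eq_square)
      qed
      also have "(\<Sum>(k, l)\<in>off_pairs m. real (agree n k l \<phi>)) \<le> M * d"
        using of_nat_mono[OF sum_agree_le_repeats[of n \<phi> m], where 'a = real]
        by (simp add: case_prod_unfold M_def d_def D_def)
      finally have ET': "ET \<le> real n / 2 * (M * d)" by (simp add: mult_left_mono)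
      have one_minus: "0 < 1 - \<rho>\<^sup>2" using \<rho> by (simp add: abs_square_less_1)
      have s0: "0 \<le> s" using \<rho> m1 by (auto simp: s_def equi_slope_def intro!: divide_nonneg_nonneg mult_nonneg_nonneg add_nonneg_nonneg)
      have "s\<^sup>2 \<le> (\<rho> / (1 - \<rho>\<^sup>2))\<^sup>2"
        using equi_slope_le[OF m \<rho>(1,2)] s0 by (intro power_mono) (auto simp: s_def)
      also have "\<dots> \<le> (8 * (1 - \<eta>) / M * v) / (1 - \<rho>\<^sup>2)\<^sup>2"
        unfolding power_divide using \<rho>(3) by (intro divide_right_mono) (auto simp: v_def)
      also have "\<dots> = (8 / M * v) * ((1 - \<eta>) / (1 - \<rho>\<^sup>2)\<^sup>2)" by simp
      \<comment> \<open>The denominator from \<open>equi_slope_le\<close> is absorbed at the price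
        of half of \<eta>.\<close>
      also have "\<dots> \<le> (8 / M * v) * (1 - \<eta> / 2)"
        using small(3) one_minus M v by (intro mult_left_mono) (auto simp: field_simps)
      finally have "s\<^sup>2 \<le> (8 / M * v) * (1 - \<eta> / 2)" .
      then have "s\<^sup>2 / 4 * ET \<le> ((8 / M * v) * (1 - \<eta> / 2)) / 4 * (real n / 2 * (M * d))"
        using ET' nonneg v \<eta> M by (intro mult_mono divide_right_mono) (auto simp: d_def)
      also have "\<dots> = (1 - \<eta> / 2) * (v * n) * d" using M by (simp add: field_simps)
      also have "\<dots> = L * d - \<eta> / 2 * L * d" unfolding v(2) by (simp add: algebra_simps)
      also have "\<dots> \<le> L * d - \<eta> / 2 * L * (\<delta> * n)"
        using d L \<eta> by (intro diff_left_mono mult_left_mono) auto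
      finally have first: "s\<^sup>2 / 4 * ET \<le> L * d - \<eta> / 2 * L * (\<delta> * n)" .
      have second: "2 * M ^ 2 * real n * \<rho>\<^sup>2 \<le> 8 * M ^ 2 * L"
      proof -
        have "2 * M ^ 2 * real n * \<rho>\<^sup>2 \<le> 2 * M ^ 2 * real n * (4 * v)" using \<rho>2 M by (intro mult_left_mono) auto
        also have "\<dots> = 8 * M ^ 2 * (v * n)" by simp
        finally show ?thesis unfolding v(2) .
      qed
      \<comment> \<open>The constant 32 in \<open>t\<close> is chosen such that the slack consumes
        half of the gain \<open>\<eta> / 2 * L * (\<delta> * n)\<close>; the other half is the
        negative term of \<open>g3\<close>.\<close>
      have third: "2 * \<rho> * t \<le> \<eta> * \<delta> / 4 * real n * L"
      proof -
        have "2 * \<rho> * t \<le> 2 * b * t" using \<rho>(4) t by (intro mult_right_mono mult_left_mono) auto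
        also have "\<dots> = \<eta> * \<delta> / 16 * real n ^ 2 * b\<^sup>2" by (simp add: t_def power2_eq_square)
        also have "\<dots> = \<eta> * \<delta> / 4 * real n * (v * n)" unfolding b(2) by (simp add: power2_eq_square)
        finally show ?thesis unfolding v(2) .
      qed
      have fourth: "1000 * M ^ 4 * real n ^ 2 * \<rho> ^ 3 \<le> 1000 * M ^ 4 * real n ^ 2 * b ^ 3"
        using \<rho>(1,4) M by (intro mult_left_mono power_mono) auto
      have "?S \<phi> \<le> ennreal (exp (s\<^sup>2 / 4 * ET + 2 * M ^ 2 * real n * \<rho>\<^sup>2 + 2 * \<rho> * t + 1000 * M ^ 4 * real n ^ 2 * \<rho> ^ 3))"
        unfolding s_def ET_def M_def
        using small(1) by (intro relative_moment_truncated_le m1 \<phi> \<rho>(1,2) t) (simp add: M_def)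
      also have "\<dots> \<le> ennreal (exp (d * L + g3))"
      proof (intro ennreal_leI, subst exp_le_cancel_iff)
        have "L * d - \<eta> / 2 * L * (\<delta> * n) + 8 * M ^ 2 * L + \<eta> * \<delta> / 4 * real n * L + 1000 * M ^ 4 * real n ^ 2 * b ^ 3 = d * L + g3"
          by (simp add: g3_def algebra_simps)
        then show "s\<^sup>2 / 4 * ET + 2 * M ^ 2 * real n * \<rho>\<^sup>2 + 2 * \<rho> * t + 1000 * M ^ 4 * real n ^ 2 * \<rho> ^ 3 \<le> d * L + g3"
          using first second third fourth by linarith
      qed
      also have "exp (d * L + g3) = real n ^ D \<phi> * exp g3"
      proof -
        have "exp L = real n" using n0 by (simp add: L_def)
        then show ?thesis unfolding exp_add d_def exp_of_nat_mult by simp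
      qed
      also have "ennreal \<dots> \<le> ennreal (exp g1 + x ^ peak m n \<phi> * exp g2 + real n ^ D \<phi> * exp g3)"
        using terms exp_ge_zero[of g1] by (intro ennreal_leI) linarith
      finally show ?thesis .
    qed
  qed
  have "(\<Sum>\<phi>\<in>latents m n. ?S \<phi>) \<le> (\<Sum>\<phi>\<in>latents m n. ennreal (exp g1 + x ^ peak m n \<phi> * exp g2 + real n ^ D \<phi> * exp g3))"
    by (intro sum_mono one)
  also have "\<dots> = ennreal (\<Sum>\<phi>\<in>latents m n. exp g1 + x ^ peak m n \<phi> * exp g2 + real n ^ D \<phi> * exp g3)"
    using x by (intro sum_ennreal) (auto intro!: add_nonneg_nonneg)
  also have "\<dots> \<le> ennreal (card (latents m n) * (exp g1 + (3 * M ^ 4 + 1) * exp (x + g2) + exp (M ^ 2 * n + g3)))"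
  proof (intro ennreal_leI)
    define N where "N = real (card (latents m n))"
    have "(\<Sum>\<phi>\<in>latents m n. exp g1 + x ^ peak m n \<phi> * exp g2 + real n ^ D \<phi> * exp g3)
        = N * exp g1 + (\<Sum>\<phi>\<in>latents m n. x ^ peak m n \<phi>) * exp g2 + (\<Sum>\<phi>\<in>latents m n. real n ^ D \<phi>) * exp g3"
      by (simp add: sum.distrib sum_distrib_right N_def)
    also have "\<dots> \<le> N * exp g1 + ((3 * M ^ 4 + 1) * N * exp x) * exp g2 + (N * exp (M * n) ^ m) * exp g3"
      using peak_moment[OF x, of m n] repeats_moment[of "real n" m n]
      by (intro add_mono mult_right_mono) (auto simp: M_def N_def D_def)
    also have "exp (M * n) ^ m = exp (M ^ 2 * n)"
      by (simp add: exp_of_nat_mult[symmetric] M_def power2_eq_square mult_ac)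
    finally show "(\<Sum>\<phi>\<in>latents m n. exp g1 + x ^ peak m n \<phi> * exp g2 + real n ^ D \<phi> * exp g3)
        \<le> N * (exp g1 + (3 * M ^ 4 + 1) * exp (x + g2) + exp (M ^ 2 * n + g3))"
      by (simp add: exp_add algebra_simps)
  qed
  finally show ?thesis
    by (simp add: g1_def g2_def g3_def t_def x_def v_def add.assoc[symmetric] add_diff_eq)
qed

section \<open>Total variation and testing errors\<close>

lemma abs_measure_diff_le_total_variation:
  assumes "prob_space P" "prob_space Q" "A \<in> sets P"
  shows "\<bar>measure P A - measure Q A\<bar> \<le> total_variation P Q"
  unfolding total_variation_def
proof (rule cSUP_upper[OF assms(3)], rule bdd_aboveI2)
  interpret P: prob_space P by (rule assms)
  interpret Q: prob_space Q by (rule assms)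
  fix B
  have "0 \<le> measure P B" "measure P B \<le> 1" "0 \<le> measure Q B" "measure Q B \<le> 1" by auto
  then show "\<bar>measure P B - measure Q B\<bar> \<le> 1" by linarith
qed

lemma total_variation_nonneg:
  assumes "prob_space P" "prob_space Q"
  shows "0 \<le> total_variation P Q"
  using abs_measure_diff_le_total_variation[OF assms, of "{}"] by simp

text \<open>With \<open>B\<close> the event that the test rejects, the two errors add up to
  \<open>1 - (P B - Q B)\<close>.\<close>

lemma testing_error_ge:
  assumes "prob_space P" "prob_space Q" and sets: "sets P = sets S" "sets Q = sets S"
    and \<psi>: "\<psi> \<in> S \<rightarrow>\<^sub>M count_space {0, 1 :: nat}"
  shows "1 - total_variation P Q \<le> measure P {X \<in> space S. \<psi> X = 0} + measure Q {X \<in> space S. \<psi> X = 1}"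
proof -
  interpret P: prob_space P by (rule assms)
  have space: "space P = space S" using sets(1) by (rule sets_eq_imp_space_eq)
  define B where "B = {X \<in> space S. \<psi> X = 1}"
  have B_vimage: "B = \<psi> -` {1} \<inter> space S" by (auto simp: B_def)
  have B: "B \<in> sets P" unfolding B_vimage sets using measurable_sets[OF \<psi>, of "{1}"] by simp
  have "\<psi> X = 0 \<or> \<psi> X = 1" if "X \<in> space S" for X
    using measurable_space[OF \<psi> that] by auto
  then have "{X \<in> space S. \<psi> X = 0} = space P - B" by (auto simp: space B_def)
  then have "measure P {X \<in> space S. \<psi> X = 0} = 1 - measure P B"
    using P.prob_compl[OF B] by simp
  with abs_measure_diff_le_total_variation[OF assms(1,2) B] show ?thesis
    unfolding B_def by linarith
qed

text \<open>Everything is expressed for a single \<open>n\<close> by functions free of \<rho>, so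
  that the limit can be taken in explicit expressions. \<open>g4\<close> bounds the mass lost by
  truncation, and the others are the three exponents of \<open>region_square_le\<close>.\<close>

lemma total_variation_planted_bound:
  fixes m n :: nat and \<rho> \<eta> M L K b \<delta> d c g1 g2 g3 g4 :: real
  defines "M \<equiv> real m" and "L \<equiv> ln (real n)" and "K \<equiv> real n powr (1 / 4)" and "b \<equiv> 2 * sqrt (ln (real n) / real n)"
  defines "\<delta> \<equiv> 1 / (32 * (real m)\<^sup>2)"
  defines "d \<equiv> 3 * (\<eta> * \<delta> / 32) ^ 2 / M ^ 2" and "c \<equiv> 1 + \<eta> * \<delta> / 32 / M ^ 2"
  defines "g1 \<equiv> 4 * (L / n) * M ^ 2 * (K ^ 2 + K) + 16 * (L / n) ^ 2 * M ^ 4 * (9 * K ^ 2 + n) + 6400 * M ^ 6 * real n ^ 2 * (L / n) ^ 3"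
    and "g2 \<equiv> real n powr (1 / 8) + 4 * M ^ 2 * L + 32 * M ^ 4 * L ^ 2 + 6400 * M ^ 6 * real n ^ 2 * (L / n) ^ 3 - L * K / 16"
    and "g3 \<equiv> M ^ 2 * n + 8 * M ^ 2 * L + 1000 * M ^ 4 * real n ^ 2 * b ^ 3 - \<eta> * \<delta> / 4 * real n * L"
    and "g4 \<equiv> M ^ 2 * n * ln 2 + 100 * M ^ 4 * real n ^ 2 * (c * b) ^ 3 - d * n * L"
  assumes m: "2 \<le> m" and n: "2 \<le> n" and \<eta>: "0 < \<eta>" "\<eta> < 1"
    and \<rho>: "0 \<le> \<rho>" "\<rho> < 1" "\<rho>\<^sup>2 \<le> 8 * (1 - \<eta>) / M * (L / n)"
    and small: "12 * M * c * b \<le> 1" "6 * M ^ 2 * b\<^sup>2 \<le> 1" "1 - \<eta> \<le> (1 - \<eta> / 2) * (1 - b\<^sup>2)\<^sup>2"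
  shows "total_variation (planted_law m n \<rho>) (null_law m n)
    \<le> sqrt (2 * exp g4 + (exp g1 - 1 + (3 * M ^ 4 + 1) * exp g2 + exp g3))"
proof -
  define a where "a = \<eta> * \<delta> / 32"
  \<comment> \<open>With \<open>t = a * n^2 * b\<close> the exponent
    \<open>- \<kappa> t + \<kappa>^2 M^2 n^2 / 4\<close> is minimal at
    \<open>2 * a * b / M^2\<close>. Half of that value already gives
    \<open>- 3 a^2 b^2 n^2 / (4 M^2)\<close>, which is \<open>- d * n * L\<close> because
    \<open>b^2 = 4 * L / n\<close>; the constant \<open>c\<close> is chosen to have
    \<open>\<rho> + \<kappa> \<le> c * b\<close>.\<close>
  define \<kappa> where "\<kappa> = a / M ^ 2 * b"
  define t where "t = \<eta> * \<delta> / 32 * real n ^ 2 * b"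
  have m1: "1 \<le> m" and M: "2 \<le> M" using m by (auto simp: M_def)
  have n0: "0 < real n" and L: "0 \<le> L" using n by (auto simp: L_def)
  have b: "0 \<le> b" "b\<^sup>2 = 4 * (L / n)" using n0 L by (auto simp: b_def L_def power_mult_distrib)
  have a: "0 < a" using \<eta> m by (simp add: a_def \<delta>_def)
  have c: "c = 1 + a / M ^ 2" "1 \<le> c" using a M by (auto simp: c_def a_def)
  have \<kappa>: "0 \<le> \<kappa>" using a b M by (simp add: \<kappa>_def)
  \<comment> \<open>Since \<open>m\<close> is at least 2, the hypothesis yields
    \<open>\<rho>^2 \<le> 4 * L / n\<close>; this is the origin of the factor 2 in
    \<open>b\<close>.\<close>
  have "8 * (1 - \<eta>) / M \<le> 8 * 1 / 2"
    using \<eta> M by (intro frac_le) auto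
  then have "8 * (1 - \<eta>) / M * (L / n) \<le> 4 * (L / n)"
    using L n0 by (intro mult_right_mono) auto
  then have \<rho>2: "\<rho>\<^sup>2 \<le> b\<^sup>2" using \<rho>(3) b(2) by linarith
  then have \<rho>b: "\<rho> \<le> b" using b(1) by (rule power2_le_imp_le)
  have cb: "\<rho> + \<kappa> \<le> c * b" using \<rho>b by (simp add: c \<kappa>_def algebra_simps)
  have bcb: "b \<le> c * b" using c b by (simp add: mult_le_cancel_right1)
  have small1: "12 * M * \<rho> \<le> 1"
  proof -
    have "12 * M * \<rho> \<le> 12 * M * (c * b)" using \<rho>b bcb M by (intro mult_left_mono) auto
    then show ?thesis using small(1) by (simp add: mult.assoc)
  qed
  have small2: "6 * real m * (\<rho> + \<kappa>) \<le> 1"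
  proof -
    have "6 * M * (\<rho> + \<kappa>) \<le> 12 * M * (c * b)" using cb M \<rho> \<kappa> by (intro mult_mono) auto
    also have "\<dots> \<le> 1" using small(1) by (simp add: mult.assoc)
    finally show ?thesis by (simp only: M_def)
  qed
  have small3: "6 * M ^ 2 * \<rho>\<^sup>2 \<le> 1"
  proof -
    have "6 * M ^ 2 * \<rho>\<^sup>2 \<le> 6 * M ^ 2 * b\<^sup>2" using \<rho>2 by (intro mult_left_mono) auto
    then show ?thesis using small(2) by linarith
  qed
  have b1: "b\<^sup>2 \<le> 1"
  proof -
    have "1 * b\<^sup>2 \<le> 6 * M ^ 2 * b\<^sup>2"
      using power_mono[OF M, of 2] by (intro mult_right_mono) auto
    then show ?thesis using small(2) by linarith
  qed
  have small4: "1 - \<eta> \<le> (1 - \<eta> / 2) * (1 - \<rho>\<^sup>2)\<^sup>2"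
  proof -
    have "(1 - b\<^sup>2)\<^sup>2 \<le> (1 - \<rho>\<^sup>2)\<^sup>2" using \<rho>2 b1 by (intro power_mono) auto
    then have "(1 - \<eta> / 2) * (1 - b\<^sup>2)\<^sup>2 \<le> (1 - \<eta> / 2) * (1 - \<rho>\<^sup>2)\<^sup>2"
      using \<eta> by (intro mult_left_mono) auto
    then show ?thesis using small(3) by linarith
  qed
  have mean: "ennreal (1 - exp g4)
      \<le> (\<integral>\<^sup>+ X. ennreal (joint_ratio m n \<rho> X) * indicator (region m n \<rho> t) X \<partial>null_law m n)"
  proof (rule order_trans[OF _ region_mean_ge[OF m1 \<rho>(1,2) \<kappa> small2]], rule ennreal_leI)
    have two: "(2 :: real) ^ (n * m\<^sup>2) = exp (M ^ 2 * n * ln 2)"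
    proof -
      have "exp (M ^ 2 * n * ln 2) = exp (real (n * m\<^sup>2) * ln 2)"
        by (simp add: M_def mult.commute)
      also have "\<dots> = 2 ^ (n * m\<^sup>2)" by (simp only: exp_of_nat_mult) simp
      finally show ?thesis by simp
    qed
    have b2n: "b * b * real n ^ 2 = 4 * n * L"
      using b(2) n0 by (simp add: power2_eq_square field_simps)
    have k1: "\<kappa> * t = a\<^sup>2 / M ^ 2 * (b * b * real n ^ 2)"
      by (simp add: \<kappa>_def t_def a_def[symmetric] power2_eq_square)
    have k2: "\<kappa>\<^sup>2 / 4 * (real m ^ 2 * real n ^ 2) = a\<^sup>2 / M ^ 2 * (b * b * real n ^ 2) / 4"
      using M by (simp add: \<kappa>_def M_def[symmetric] power_mult_distrib power_divide power2_eq_square[of b] field_simps power2_eq_square[of M])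
    have lin: "- (\<kappa> * t) + \<kappa>\<^sup>2 / 4 * (real m ^ 2 * real n ^ 2) = - (d * n * L)"
      unfolding k1 k2 b2n d_def a_def[symmetric] by (simp add: field_simps)
    have "(\<rho> + \<kappa>) ^ 3 \<le> (c * b) ^ 3" using cb \<rho> \<kappa> by (intro power_mono) auto
    then have "100 * real m ^ 4 * real n ^ 2 * (\<rho> + \<kappa>) ^ 3 \<le> 100 * M ^ 4 * real n ^ 2 * (c * b) ^ 3"
      unfolding M_def by (intro mult_left_mono) auto
    then have "M ^ 2 * n * ln 2 + (- (\<kappa> * t) + \<kappa>\<^sup>2 / 4 * (real m ^ 2 * real n ^ 2)
        + 100 * real m ^ 4 * real n ^ 2 * (\<rho> + \<kappa>) ^ 3) \<le> g4"
      unfolding lin g4_def by linarith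
    then show "1 - exp g4 \<le> 1 - 2 ^ (n * m\<^sup>2) * exp (- (\<kappa> * t) + \<kappa>\<^sup>2 / 4 * (real m ^ 2 * real n ^ 2)
        + 100 * real m ^ 4 * real n ^ 2 * (\<rho> + \<kappa>) ^ 3)"
      unfolding two exp_add[symmetric] by simp
  qed
  have square: "(\<Sum>\<phi>\<in>latents m n. \<integral>\<^sup>+ X. ennreal (joint_ratio m n \<rho> X * shifted_ratio m n \<rho> \<phi> X)
        * indicator (region m n \<rho> t) X \<partial>null_law m n)
    \<le> ennreal (card (latents m n) * (1 + (exp g1 - 1 + (3 * M ^ 4 + 1) * exp g2 + exp g3)))"
  proof -
    have "(\<Sum>\<phi>\<in>latents m n. \<integral>\<^sup>+ X. ennreal (joint_ratio m n \<rho> X * shifted_ratio m n \<rho> \<phi> X)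
        * indicator (region m n \<rho> t) X \<partial>null_law m n)
      \<le> ennreal (card (latents m n) * (exp g1 + (3 * M ^ 4 + 1) * exp g2 + exp g3))"
      unfolding g1_def g2_def g3_def t_def
      unfolding M_def L_def K_def b_def \<delta>_def
      by (rule region_square_le[OF m n \<eta> \<rho>(1,2) \<rho>(3)[unfolded M_def L_def] \<rho>b[unfolded b_def]
            small1[unfolded M_def] small3[unfolded M_def] small4])
    also have "exp g1 + (3 * M ^ 4 + 1) * exp g2 + exp g3 = 1 + (exp g1 - 1 + (3 * M ^ 4 + 1) * exp g2 + exp g3)"
      by simp
    finally show ?thesis .
  qed
  have "0 \<le> g1" using L n0 M by (simp add: g1_def K_def)
  then have "1 \<le> exp g1" by simp
  moreover have "0 \<le> (3 * M ^ 4 + 1) * exp g2" using M by simp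
  moreover have "0 \<le> exp g3" by simp
  ultimately have "0 \<le> exp g1 - 1 + (3 * M ^ 4 + 1) * exp g2 + exp g3" by linarith
  from total_variation_planted_le[OF m1 \<rho>(1,2) region_measurable[OF m1] mean square this]
  show ?thesis .
qed

theorem theorem2:
  fixes m :: nat and \<eta> :: real and \<rho> :: "nat \<Rightarrow> real"
  assumes "m \<ge> 2"
    and "0 < \<eta>" and "\<eta> < 1"
    and "\<And>n. n \<ge> 1 \<Longrightarrow> 0 \<le> \<rho> n \<and> \<rho> n < 1"
    and "\<And>n. n \<ge> 1 \<Longrightarrow> (\<rho> n)\<^sup>2 \<le> 8 * (1 - \<eta>) / real m * (ln (real n) / real n)"
  shows "(\<lambda>n. total_variation (planted_law m n (\<rho> n)) (null_law m n)) \<longlonglongrightarrow> 0 \<and>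
    \<not> (\<exists>\<psi>. (\<forall>n. \<psi> n \<in> data_space m n \<rightarrow>\<^sub>M count_space {0, 1}) \<and> achieves_weak_detection m \<rho> \<psi>)"
proof
  define M where "M = real m"
  define \<delta> where "\<delta> = 1 / (32 * (real m)\<^sup>2)"
  define d where "d = 3 * (\<eta> * \<delta> / 32) ^ 2 / M ^ 2"
  define c where "c = 1 + \<eta> * \<delta> / 32 / M ^ 2"
  define e where "e = \<eta> * \<delta> / 4"
  define b where "b n = 2 * sqrt (ln (real n) / real n)" for n
  define g1 where "g1 n = 4 * (ln (real n) / n) * M ^ 2 * ((real n powr (1 / 4)) ^ 2 + real n powr (1 / 4))
    + 16 * (ln n / n) ^ 2 * M ^ 4 * (9 * (real n powr (1 / 4)) ^ 2 + n) + 6400 * M ^ 6 * real n ^ 2 * (ln n / n) ^ 3" for n :: nat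
  define g2 where "g2 n = real n powr (1 / 8) + 4 * M ^ 2 * ln n + 32 * M ^ 4 * (ln n) ^ 2
    + 6400 * M ^ 6 * real n ^ 2 * (ln n / n) ^ 3 - ln n * real n powr (1 / 4) / 16" for n :: nat
  define g3 where "g3 n = M ^ 2 * n + 8 * M ^ 2 * ln n + 1000 * M ^ 4 * real n ^ 2 * b n ^ 3 - e * real n * ln n" for n :: nat
  define g4 where "g4 n = M ^ 2 * n * ln 2 + 100 * M ^ 4 * real n ^ 2 * (c * b n) ^ 3 - d * n * ln n" for n :: nat
  let ?TV = "\<lambda>n. total_variation (planted_law m n (\<rho> n)) (null_law m n)"
  have m1: "1 \<le> m" and M: "M > 0" using assms(1) by (auto simp: M_def)
  have \<delta>: "\<delta> > 0" using assms(1) by (simp add: \<delta>_def)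
  have e: "e > 0" and d: "d > 0" using assms(2) \<delta> M by (auto simp: e_def d_def)
  have "0 < \<eta> * \<delta> / 32 / M ^ 2" using assms(2) \<delta> M by simp
  then have c: "c > 0" by (simp add: c_def)
  \<comment> \<open>\<open>g1\<close> is of order n^(-1/2) ln n. The other three tend to minus
    infinity: in \<open>g2\<close> the term with \<open>n^(1/4) ln n\<close> beats
    \<open>n^(1/8)\<close>, and in \<open>g3\<close> and \<open>g4\<close> the term of order n ln n
    beats both the linear one and the cubic error, since \<open>n^2 b^3\<close> is of order n^(1/2)
    (ln n)^(3/2).\<close>
  have "g1 \<longlonglongrightarrow> 0" unfolding g1_def using M by real_asymp
  moreover have "(\<lambda>n. exp (g2 n)) \<longlonglongrightarrow> 0" unfolding g2_def using M by real_asymp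
  moreover have "(\<lambda>n. exp (g3 n)) \<longlonglongrightarrow> 0" unfolding g3_def b_def using M e by real_asymp
  moreover have "(\<lambda>n. exp (g4 n)) \<longlonglongrightarrow> 0" unfolding g4_def b_def using M d c by real_asymp
  ultimately have "(\<lambda>n. sqrt (2 * exp (g4 n) + (exp (g1 n) - 1 + (3 * M ^ 4 + 1) * exp (g2 n) + exp (g3 n))))
      \<longlonglongrightarrow> sqrt (2 * 0 + (exp 0 - 1 + (3 * M ^ 4 + 1) * 0 + 0))"
    by (intro tendsto_intros)
  then have lim: "(\<lambda>n. sqrt (2 * exp (g4 n) + (exp (g1 n) - 1 + (3 * M ^ 4 + 1) * exp (g2 n) + exp (g3 n)))) \<longlonglongrightarrow> 0"
    by simp
  have b: "b \<longlonglongrightarrow> 0" unfolding b_def by real_asymp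
  have "(\<lambda>n. 12 * M * c * b n) \<longlonglongrightarrow> 12 * M * c * 0" by (intro tendsto_intros b)
  then have s1: "\<forall>\<^sub>F n in sequentially. 12 * M * c * b n < 1"
    by (rule order_tendstoD) simp
  have "(\<lambda>n. 6 * M ^ 2 * (b n)\<^sup>2) \<longlonglongrightarrow> 6 * M ^ 2 * 0\<^sup>2" by (intro tendsto_intros b)
  then have s2: "\<forall>\<^sub>F n in sequentially. 6 * M ^ 2 * (b n)\<^sup>2 < 1"
    by (rule order_tendstoD) simp
  have "(\<lambda>n. (1 - \<eta> / 2) * (1 - (b n)\<^sup>2)\<^sup>2) \<longlonglongrightarrow> (1 - \<eta> / 2) * (1 - 0\<^sup>2)\<^sup>2" by (intro tendsto_intros b)
  then have s3: "\<forall>\<^sub>F n in sequentially. 1 - \<eta> < (1 - \<eta> / 2) * (1 - (b n)\<^sup>2)\<^sup>2"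
    by (rule order_tendstoD) (use assms(2) in simp)
  have prob: "prob_space (planted_law m n (\<rho> n))" "prob_space (null_law m n)" if "1 \<le> n" for n
    using assms(4)[OF that] m1 by (auto intro: prob_space_planted_law prob_space_null_law)
  have upper: "\<forall>\<^sub>F n in sequentially. ?TV n
      \<le> sqrt (2 * exp (g4 n) + (exp (g1 n) - 1 + (3 * M ^ 4 + 1) * exp (g2 n) + exp (g3 n)))"
    using s1 s2 s3 eventually_ge_at_top[of 2]
  proof eventually_elim
    case (elim n)
    then have n1: "1 \<le> n" by simp
    show ?case
      unfolding g1_def g2_def g3_def g4_def
      unfolding c_def d_def e_def
      unfolding b_def \<delta>_def M_def
      by (rule total_variation_planted_bound[OF assms(1) elim(4) assms(2,3)])
        (use assms(4,5)[OF n1] elim(1-3) in \<open>auto simp: c_def b_def \<delta>_def M_def\<close>)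
  qed
  have lower: "\<forall>\<^sub>F n in sequentially. 0 \<le> ?TV n"
    using eventually_ge_at_top[of 1] by eventually_elim (intro total_variation_nonneg prob)
  show TV: "?TV \<longlonglongrightarrow> 0" by (rule tendsto_sandwich[OF lower upper tendsto_const lim])
  \<comment> \<open>The error sum of any test is at least \<open>1 - ?TV n\<close> for
    \<open>n \<ge> 1\<close>, which eventually exceeds \<open>1 - c\<close> for every fixed
    \<open>c > 0\<close>.\<close>
  show "\<not> (\<exists>\<psi>. (\<forall>n. \<psi> n \<in> data_space m n \<rightarrow>\<^sub>M count_space {0, 1}) \<and> achieves_weak_detection m \<rho> \<psi>)"
  proof
    assume "\<exists>\<psi>. (\<forall>n. \<psi> n \<in> data_space m n \<rightarrow>\<^sub>M count_space {0, 1}) \<and> achieves_weak_detection m \<rho> \<psi>"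
    then obtain \<psi> :: "nat \<Rightarrow> (nat \<times> nat set \<Rightarrow> real) \<Rightarrow> nat" and c where \<psi>: "\<And>n. \<psi> n \<in> data_space m n \<rightarrow>\<^sub>M count_space {0, 1}" and c: "0 < c"
      and detect: "\<forall>\<^sub>F n in sequentially.
        measure (planted_law m n (\<rho> n)) {X \<in> space (data_space m n). \<psi> n X = 0}
        + measure (null_law m n) {X \<in> space (data_space m n). \<psi> n X = 1} \<le> 1 - c"
      unfolding achieves_weak_detection_def by blast
    have "\<forall>\<^sub>F n in sequentially. ?TV n < c" using TV c by (rule order_tendstoD)
    with detect eventually_ge_at_top[of 1] have "\<forall>\<^sub>F n :: nat in sequentially. False"
    proof eventually_elim
      case (elim n)
      have "sets (planted_law m n (\<rho> n)) = sets (data_space m n)"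
        using assms(4)[OF elim(2)] m1 by (intro sets_planted_law) auto
      moreover have "sets (null_law m n) = sets (data_space m n)" by (rule sets_null_law)
      ultimately show False
        using testing_error_ge[OF prob[OF elim(2)] _ _ \<psi>[of n]] elim(1,3) by fastforce
    qed
    then show False by simp
  qed
qed

end
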